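(* Let $k\ge 6$ be an integer and let $G$ be a finite simple $3$-connected non-bipartite graph. If the minimum degree of $G$ is at least $k$, then $G$ contains $k$ cycles of consecutive lengths (i.e. there is an integer $\ell$ such that $G$ contains a cycle of length $\ell+i$ for each $i\in\{0,1,\dots,k-1\}$), unless $G$ is the complete graph $K_{k+1}$.
   Context: All graphs are finite, simple and undirected. The length of a cycle is its number of edges. *)

theory Defs
  imports "Graph_Theory.Graph_Theory"
begin

text \<open>A finite simple undirected graph is a \<^const>\<open>graph\<close>: a finite symmetric digraph
  without loops and parallel arcs, each undirected edge being a pair of opposite arcs. Hence the
  degree of a vertex is its out-degree.\<close>

definition min_degree :: "('a, 'b) pre_digraph \<Rightarrow> nat" where
  "min_degree G = Min (out_degree G ` verts G)"

definition vertex_connected :: "nat \<Rightarrow> ('a, 'b) pre_digraph \<Rightarrow> bool" where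
  "vertex_connected n G \<longleftrightarrow>
     n < card (verts G) \<and>
     (\<forall>X \<subseteq> verts G. card X < n \<longrightarrow> connected (G \<restriction> (verts G - X)))"

definition bipartite :: "('a, 'b) pre_digraph \<Rightarrow> bool" where
  "bipartite G \<longleftrightarrow>
     (\<exists>A B. A \<union> B = verts G \<and> A \<inter> B = {} \<and>
        (\<forall>(u, v) \<in> arcs_ends G. u \<in> A \<and> v \<in> B \<or> u \<in> B \<and> v \<in> A))"

text \<open>In a symmetric digraph, going back and forth along one edge is a
  \<^const>\<open>pre_digraph.cycle\<close> of length 2, which is not a cycle of the undirected graph.\<close>

definition has_cycle_of_length :: "('a, 'b) pre_digraph \<Rightarrow> nat \<Rightarrow> bool" where
  "has_cycle_of_length G l \<longleftrightarrow> 3 \<le> l \<and> (\<exists>p. pre_digraph.cycle G p \<and> length p = l)"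

end

theory Submission
  imports Defs
begin

text \<open>
  A set of lengths is admissible if it contains an arithmetic progression of \<open>k\<close> terms with difference
  1 or 2. The main tool is that if adding the edge \<open>xy\<close> makes a graph 2-connected and every
  vertex other than \<open>x\<close> and \<open>y\<close> has degree at least \<open>k + 1\<close>, then the graph has paths from \<open>x\<close> to \<open>y\<close> of
  \<open>k\<close> admissible lengths. In a minimal counterexample, take a maximal dense structure at \<open>x\<close>: a clique,
  a clique completely joined to neighbours of \<open>x\<close>, or a complete bipartite graph. Contract it and
  apply the induction hypothesis to a component of the rest. The degree lost by the contraction is
  made up for by the interval of path lengths available inside the structure.

  If the graph contains a triangle, the same contraction argument with a clique or a diamond split
  into two parts yields the cycles. Otherwise choose an odd cycle \<open>C\<close> and a connected set \<open>D\<close> disjoint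
  from it such that \<open>D\<close> is as large as possible. Three-connectivity and parity force \<open>C\<close> to be
  induced and to be the whole complement of \<open>D\<close>, and a vertex that does not separate \<open>D\<close> has at most two
  neighbours on \<open>C\<close>, at distance 2. So \<open>D\<close>, or an end piece of \<open>D\<close> at a cut vertex, still has
  large minimum degree. Its admissible paths are closed up by arcs of \<open>C\<close>, where the two complementary
  arcs between two vertices have lengths of different parity and fill the gaps.
\<close>

subsection \<open>Path lengths and admissible sets\<close>

text \<open>The path theorem wants degree \<open>k + 1\<close>, but \<open>G\<close> only guarantees
  \<open>k\<close>, and vertices of \<open>D\<close> also spend edges on \<open>C\<close>. A vertex
  that does not separate \<open>D\<close> keeps degree at least \<open>k - 2\<close> in
  \<open>D\<close>, or \<open>k - 1\<close> if it has at most one neighbour on \<open>C\<close>.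
  This yields \<open>k - 3\<close> or \<open>k - 2\<close> admissible lengths, and the missing ones
  must come from the arcs of \<open>C\<close>; hence the care about where on \<open>C\<close> the
  ends of the paths are attached. Several of the resulting counts, such as
  \<open>2 * (k - 3) \<ge> k\<close>, hold exactly from \<open>k = 6\<close> on. In the path
  theorem, a structure only qualifies if it leaves a neighbour of \<open>y\<close> outside. A
  maximal one may therefore admit a further vertex \<open>w\<close> after all; but then every
  neighbour of \<open>y\<close> lies in the structure or is \<open>w\<close>. In that case
  \<open>w\<close> takes over the role of \<open>y\<close> as the target, or the structure already
  contains enough paths by itself.\<close>

definition gpath :: "('a \<Rightarrow> 'a \<Rightarrow> bool) \<Rightarrow> 'a set \<Rightarrow> 'a list \<Rightarrow> bool" where
  "gpath E S xs \<longleftrightarrow> xs \<noteq> [] \<and> distinct xs \<and> set xs \<subseteq> S \<and> successively E xs"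

definition path_lens :: "('a \<Rightarrow> 'a \<Rightarrow> bool) \<Rightarrow> 'a set \<Rightarrow> 'a \<Rightarrow> 'a \<Rightarrow> nat set" where
  "path_lens E S a b = {n. \<exists>xs. gpath E S xs \<and> hd xs = a \<and> last xs = b \<and> length xs = Suc n}"

text \<open>Connectivity as the existence of leaving edges, the same shape as \<open>rooted\<close>
  and \<open>con3\<close>: a failure of any of them is a set without outgoing edges. The empty set
  counts as connected.\<close>

definition conn_set :: "('a \<Rightarrow> 'a \<Rightarrow> bool) \<Rightarrow> 'a set \<Rightarrow> bool" where
  "conn_set E S \<longleftrightarrow> (\<forall>D. D \<noteq> {} \<longrightarrow> D \<subset> S \<longrightarrow> (\<exists>d\<in>D. \<exists>e\<in>S - D. E d e))"

lemma path_lensI: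
  "gpath E S xs \<Longrightarrow> length xs = Suc n \<Longrightarrow> n \<in> path_lens E S (hd xs) (last xs)"
  unfolding path_lens_def by auto

lemma path_lensE:
  assumes "n \<in> path_lens E S a b"
  obtains xs where "gpath E S xs" "hd xs = a" "last xs = b" "length xs = Suc n"
  using assms unfolding path_lens_def by auto

lemma path_lens_in:
  assumes "n \<in> path_lens E S a b" shows "a \<in> S" "b \<in> S"
  using assms hd_in_set last_in_set by (fastforce elim!: path_lensE simp: gpath_def)+

lemma path_lens_refl: "a \<in> S \<Longrightarrow> 0 \<in> path_lens E S a a"
  using path_lensI[of E S "[a]" 0] by (auto simp: gpath_def)

lemma path_lens_mono: "n \<in> path_lens E S a b \<Longrightarrow> S \<subseteq> T \<Longrightarrow> n \<in> path_lens E T a b"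
  unfolding path_lens_def gpath_def by blast

lemma path_lens_Cons:
  assumes "n \<in> path_lens E S a b" "E v a" "v \<notin> S"
  shows "Suc n \<in> path_lens E (insert v S) v b"
proof -
  obtain xs where xs: "gpath E S xs" "hd xs = a" "last xs = b" "length xs = Suc n"
    using assms(1) by (rule path_lensE)
  have "gpath E (insert v S) (v # xs)"
    using xs assms unfolding gpath_def by (auto simp: successively_Cons)
  from path_lensI[OF this, of "Suc n"] xs show ?thesis
    by (auto simp: gpath_def)
qed

lemma path_lens_rev:
  assumes "symp E" "n \<in> path_lens E S a b" shows "n \<in> path_lens E S b a"
proof -
  obtain xs where xs: "gpath E S xs" "hd xs = a" "last xs = b" "length xs = Suc n"
    using assms(2) by (rule path_lensE)
  have "successively (\<lambda>u v. E v u) xs"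
    using xs(1) assms(1) unfolding gpath_def
    by (auto intro: successively_mono dest: sympD)
  then have "gpath E S (rev xs)"
    using xs(1) unfolding gpath_def by auto
  from path_lensI[OF this, of n] xs show ?thesis
    by (auto simp: gpath_def hd_rev last_rev)
qed

lemma path_lens_join:
  assumes "n \<in> path_lens E S a b" "m \<in> path_lens E T b c" "S \<inter> T \<subseteq> {b}"
  shows "n + m \<in> path_lens E (S \<union> T) a c"
proof -
  obtain xs where xs: "gpath E S xs" "hd xs = a" "last xs = b" "length xs = Suc n"
    using assms(1) by (rule path_lensE)
  obtain ys where ys: "gpath E T ys" "hd ys = b" "last ys = c" "length ys = Suc m"
    using assms(2) by (rule path_lensE)
  obtain ys' where ys': "ys = b # ys'" using ys unfolding gpath_def by (cases ys) auto
  have "b \<notin> set ys'" using ys ys' unfolding gpath_def by auto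
  then have dis: "set xs \<inter> set ys' = {}"
    using xs(1) ys(1) ys' assms(3) unfolding gpath_def by auto
  have "gpath E (S \<union> T) (xs @ ys')"
    using xs ys ys' dis unfolding gpath_def
    by (auto simp: successively_append_iff successively_Cons)
  from path_lensI[OF this, of "n + m"] xs ys ys' show ?thesis
    by (auto simp: gpath_def split: if_splits)
qed

lemma path_lens_snoc:
  assumes "n \<in> path_lens E S a b" "E b v" "v \<notin> S"
  shows "Suc n \<in> path_lens E (insert v S) a v"
proof -
  have bS: "b \<in> S" using assms(1) path_lens_in by fast
  have "gpath E {b, v} [b, v]" using assms bS unfolding gpath_def by auto
  from path_lensI[OF this, of 1] have "1 \<in> path_lens E {b, v} b v" by simp
  from path_lens_join[OF assms(1) this] assms(3) bS show ?thesis
    by (auto intro: path_lens_mono)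
qed

text \<open>Splitting off the last vertex produces the vertex \<open>y'\<close> that
  \<open>linked\<close> asks for.\<close>

lemma path_lens_penultimate:
  assumes "n \<in> path_lens E S a b" "a \<noteq> b"
  shows "\<exists>b' m. E b' b \<and> b' \<in> S \<and> b' \<noteq> b \<and> n = Suc m \<and> m \<in> path_lens E (S - {b}) a b'"
proof -
  obtain xs where xs: "gpath E S xs" "hd xs = a" "last xs = b" "length xs = Suc n"
    using assms(1) by (rule path_lensE)
  define ys where "ys = butlast xs"
  have xe: "xs = ys @ [b]" using xs unfolding ys_def gpath_def by auto
  have ne: "ys \<noteq> []" using xe xs assms(2) by auto
  obtain m where m: "n = Suc m" using xs xe ne by (cases n) auto
  have "gpath E (S - {b}) ys"
    using xs(1) xe ne unfolding gpath_def by (auto simp: successively_append_iff)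
  from path_lensI[OF this, of m] have "m \<in> path_lens E (S - {b}) (hd ys) (last ys)"
    using xs xe m by auto
  moreover have "hd ys = a" using xs(2) xe ne by auto
  moreover have "E (last ys) b" using xs(1) xe ne unfolding gpath_def
    by (auto simp: successively_append_iff)
  moreover have "last ys \<in> S" "last ys \<noteq> b"
    using xs(1) xe ne unfolding gpath_def by (auto dest: last_in_set)
  ultimately show ?thesis using m by auto
qed

text \<open>The set of vertices reached by paths from \<open>a\<close> has no edge leaving it: a
  path to \<open>d\<close> stays in that set, so it extends by any neighbour \<open>e\<close>
  outside.\<close>

lemma conn_set_path:
  assumes "conn_set E S" "a \<in> S" "b \<in> S"
  obtains n where "n \<in> path_lens E S a b"
proof -
  define D where "D = {w. \<exists>n. n \<in> path_lens E S a w}"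
  have aD: "a \<in> D" unfolding D_def using path_lens_refl assms by fast
  have DS: "D \<subseteq> S" unfolding D_def using path_lens_in by fast
  have pre: "set xs \<subseteq> D" if "gpath E S xs" "hd xs = a" for xs
    using that
  proof (induction xs rule: rev_induct)
    case (snoc v xs)
    show ?case
    proof (cases "xs = []")
      case True then show ?thesis using snoc aD by simp
    next
      case False
      then have "gpath E S xs" "hd xs = a" using snoc.prems
        unfolding gpath_def by (auto simp: successively_append_iff)
      then have "set xs \<subseteq> D" using snoc.IH by blast
      moreover have "length xs \<in> path_lens E S a v"
        using path_lensI[OF snoc.prems(1), of "length xs"] snoc.prems(2) by simp
      ultimately show ?thesis unfolding D_def by auto
    qed
  qed simp
  have "D = S"
  proof (rule ccontr)
    assume "D \<noteq> S"
    then obtain d e where de: "d \<in> D" "e \<in> S - D" "E d e"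
      using assms(1) aD DS unfolding conn_set_def by blast
    obtain n xs where xs: "gpath E S xs" "hd xs = a" "last xs = d" "length xs = Suc n"
      using de(1) unfolding D_def path_lens_def by auto
    have "e \<notin> set xs" using pre[OF xs(1,2)] de by auto
    then have "gpath E S (xs @ [e])" using xs de unfolding gpath_def
      by (auto simp: successively_append_iff)
    from path_lensI[OF this, of "Suc n"] have "e \<in> D" using xs unfolding D_def gpath_def by auto
    then show False using de by auto
  qed
  then show ?thesis using that assms unfolding D_def by blast
qed

text \<open>\<open>P\<close> is the least set that contains \<open>v\<close> and is closed under
  neighbours in \<open>S\<close>. A part of it without outgoing edges, or the complement of that
  part in \<open>P\<close>, would be a smaller such set.\<close>

lemma component:
  assumes "symp E" "v \<in> S"
  obtains P where "v \<in> P" "P \<subseteq> S" "conn_set E P" "\<And>p w. p \<in> P \<Longrightarrow> w \<in> S \<Longrightarrow> E p w \<Longrightarrow> w \<in> P"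
proof -
  define F where "F = {P. v \<in> P \<and> P \<subseteq> S \<and> (\<forall>p\<in>P. \<forall>w\<in>S. E p w \<longrightarrow> w \<in> P)}"
  define P where "P = \<Inter>F"
  have SF: "S \<in> F" using assms unfolding F_def by auto
  have PF: "P \<in> F" unfolding P_def F_def
    by (use SF in \<open>auto simp: F_def\<close>)
  have min: "P \<subseteq> Q" if "Q \<in> F" for Q using that unfolding P_def by auto
  have "conn_set E P" unfolding conn_set_def
  proof (intro allI impI, rule ccontr)
    fix D assume D: "D \<noteq> {}" "D \<subset> P" and no: "\<not> (\<exists>d\<in>D. \<exists>e\<in>P - D. E d e)"
    show False
    proof (cases "v \<in> D")
      case True
      then have "D \<in> F" using D no PF unfolding F_def by blast
      then show False using min D by auto
    next
      case False
      have "P - D \<in> F" using D no PF False assms(1) unfolding F_def by (blast dest: sympD)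
      then show False using min D by blast
    qed
  qed
  then show ?thesis using that[of P] PF unfolding F_def by blast
qed

section \<open>Arithmetic progressions of path lengths\<close>

definition adm :: "nat \<Rightarrow> nat set \<Rightarrow> bool" where
  "adm k L \<longleftrightarrow> (\<exists>a d. (d = 1 \<or> d = 2) \<and> (\<forall>i<k. a + d * i \<in> L))"

lemma adm_mono: "adm k L \<Longrightarrow> L \<subseteq> M \<Longrightarrow> adm k M"
  unfolding adm_def by blast

lemma adm_shift: "adm k L \<Longrightarrow> (\<And>n. n \<in> L \<Longrightarrow> n + c \<in> M) \<Longrightarrow> adm k M"
  unfolding adm_def by (metis add.assoc add.commute)

text \<open>An interval of \<open>l + 1\<close> lengths fills the gaps of a progression with
  difference 1 or 2, so the sums contain \<open>k' + l\<close> consecutive numbers. With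
  \<open>l = 0\<close> the gaps of difference 2 would stay open, hence the proviso
  \<open>k' = 1 \<or> 1 \<le> l\<close>.\<close>

lemma adm_interval:
  assumes "adm k' L" "1 \<le> k'" "k \<le> k' + l" "k' = 1 \<or> 1 \<le> l" and M: "\<And>n j. n \<in> L \<Longrightarrow> j \<le> l \<Longrightarrow> n + (b + j) \<in> M"
  shows "adm k M"
proof -
  obtain a d where d: "d = 1 \<or> d = 2" and L: "\<And>i. i < k' \<Longrightarrow> a + d * i \<in> L"
    using assms(1) unfolding adm_def by auto
  have "a + b + i \<in> M" if i: "i < k" for i
  proof (cases "d = 1")
    case True
    define p where "p = min i (k' - 1)"
    have "p < k'" "i - p \<le> l" "p \<le> i" using assms(2,3) i unfolding p_def by auto
    then show ?thesis using M[OF L[of p], of "i - p"] True by (simp add: algebra_simps)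
  next
    case False
    then have d2: "d = 2" using d by simp
    define p where "p = min (i div 2) (k' - 1)"
    have "p < k'" using assms(2) unfolding p_def by auto
    moreover have "i - 2 * p \<le> l" using assms(2,3,4) i unfolding p_def by (auto simp: min_def)
    moreover have "2 * p \<le> i" unfolding p_def by auto
    ultimately show ?thesis using M[OF L[of p], of "i - 2 * p"] d2 by (simp add: algebra_simps)
  qed
  then show ?thesis unfolding adm_def by (intro exI[of _ "a + b"] exI[of _ 1]) auto
qed

text \<open>The added lengths have step 2, so difference 2 is preserved. A progression of difference
  1 with at least two terms meets both parities, and even shifts of it again fill an interval. A
  single term may be counted as having difference 2.\<close>

lemma adm_even_steps:
  assumes "adm k' L" "1 \<le> k'" "k \<le> k' + l" and M: "\<And>n j. n \<in> L \<Longrightarrow> j \<le> l \<Longrightarrow> n + (b + 2 * j) \<in> M"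
  shows "adm k M"
proof -
  obtain a d where d: "d = 1 \<or> d = 2" and L: "\<And>i. i < k' \<Longrightarrow> a + d * i \<in> L"
    using assms(1) unfolding adm_def by auto
  show ?thesis
  proof (cases "d = 1 \<and> 2 \<le> k'")
    case True
    have key: "\<exists>p j. p < k' \<and> j \<le> l \<and> i = p + 2 * j" if i: "i < k" for i
    proof (cases "i < k'")
      case True
      then show ?thesis by (intro exI[of _ i] exI[of _ 0]) auto
    next
      case F: False
      \<comment> \<open>Beyond the end of the progression, the last term or the last but one is
        shifted, according to the parity of the excess \<open>r\<close>.\<close>
      define r where "r = i - (k' - 1)"
      have r: "i = k' - 1 + r" "r \<le> l" "1 \<le> r" using F i assms(2,3) unfolding r_def by auto
      show ?thesis
      proof (cases "even r")
        case True
        then obtain j where "r = 2 * j" by (rule evenE)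
        then show ?thesis using r True assms(2) by (intro exI[of _ "k' - 1"] exI[of _ j]) auto
      next
        case False
        then obtain j where "r = 2 * j + 1" by (rule oddE)
        then show ?thesis using r True assms(2)
          by (intro exI[of _ "k' - 2"] exI[of _ "Suc j"]) auto
      qed
    qed
    have "a + b + i \<in> M" if i: "i < k" for i
    proof -
      obtain p j where "p < k'" "j \<le> l" "i = p + 2 * j" using key[OF i] by blast
      then show ?thesis using M[OF L[of p], of j] True by (simp add: algebra_simps)
    qed
    then show ?thesis unfolding adm_def by (intro exI[of _ "a + b"] exI[of _ 1]) auto
  next
    case False
    have "a + b + 2 * i \<in> M" if i: "i < k" for i
    proof (cases "d = 2")
      case True
      define p where "p = min i (k' - 1)"
      have "p < k'" "i - p \<le> l" "p \<le> i" using assms(2,3) i unfolding p_def by auto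
      then show ?thesis using M[OF L[of p], of "i - p"] True by (simp add: algebra_simps)
    next
      case F: False
      then have "k' = 1" using False d assms(2) by auto
      then show ?thesis using M[OF L[of 0], of i] i assms(3) by (simp add: algebra_simps)
    qed
    then show ?thesis unfolding adm_def by (intro exI[of _ "a + b"] exI[of _ 2]) auto
  qed
qed

lemma adm_1: "n \<in> L \<Longrightarrow> k \<le> 1 \<Longrightarrow> adm k L"
  unfolding adm_def by (rule exI[of _ n], rule exI[of _ 1]) (use less_le_trans in fastforce)

text \<open>The second progression acts as an interval or as even steps adding \<open>p - 1\<close>
  lengths to the first, which makes \<open>2 * p - 1\<close>.\<close>

lemma adm_sum:
  assumes "adm p L" "adm p L'" "2 \<le> p" "k \<le> 2 * p - 1" and M: "\<And>n m. n \<in> L \<Longrightarrow> m \<in> L' \<Longrightarrow> n + m \<in> M"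
  shows "adm k M"
proof -
  obtain a d where d: "d = 1 \<or> d = 2" and L: "\<And>i. i < p \<Longrightarrow> a + d * i \<in> L"
    using assms(1) unfolding adm_def by auto
  obtain a' d' where d': "d' = 1 \<or> d' = 2" and L': "\<And>i. i < p \<Longrightarrow> a' + d' * i \<in> L'"
    using assms(2) unfolding adm_def by auto
  show ?thesis
  proof (cases "d' = 1")
    case True
    show ?thesis
      by (rule adm_interval[OF assms(1), of k "p - 1" a']) (use assms(3,4) True L' M in auto)
  next
    case False
    then have "d' = 2" using d' by simp
    show ?thesis
      by (rule adm_even_steps[OF assms(1), of k "p - 1" a'])
        (use assms(3,4) \<open>d' = 2\<close> L' M in \<open>auto simp: mult.commute\<close>)
  qed
qed

subsection \<open>Rooted graphs\<close>

text \<open>Adding the edge \<open>xy\<close> makes the graph 2-connected.\<close>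

definition rooted :: "('a \<Rightarrow> 'a \<Rightarrow> bool) \<Rightarrow> 'a set \<Rightarrow> 'a \<Rightarrow> 'a \<Rightarrow> bool" where
  "rooted E V x y \<longleftrightarrow> finite V \<and> x \<in> V \<and> y \<in> V \<and> x \<noteq> y \<and>
     (\<forall>D c. D \<noteq> {} \<longrightarrow> D \<subseteq> V - {x, y} \<longrightarrow> (\<exists>d\<in>D. \<exists>v\<in>V - D - {c}. E d v))"

text \<open>All \<open>k\<close> paths share their last edge \<open>y'y\<close>; without this the induction could not reroute their ends.\<close>

definition linked :: "('a \<Rightarrow> 'a \<Rightarrow> bool) \<Rightarrow> 'a set \<Rightarrow> 'a \<Rightarrow> 'a \<Rightarrow> nat \<Rightarrow> bool" where
  "linked E V x y k \<longleftrightarrow> (\<exists>y'\<in>V. E y' y \<and> y' \<noteq> x \<and> y' \<noteq> y \<and> adm k (path_lens E (V - {y}) x y'))"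

definition nb :: "('a \<Rightarrow> 'a \<Rightarrow> bool) \<Rightarrow> 'a set \<Rightarrow> 'a \<Rightarrow> 'a set" where
  "nb E S v = {w \<in> S. E v w}"

text \<open>Nothing is demanded for \<open>k \<le> 1\<close>, where rootedness alone provides a
  path. A contraction can lower the parameter to 1 and leave no usable degree at all.\<close>

definition deg_ok :: "('a \<Rightarrow> 'a \<Rightarrow> bool) \<Rightarrow> 'a set \<Rightarrow> nat \<Rightarrow> 'a \<Rightarrow> bool" where
  "deg_ok E V k v \<longleftrightarrow> k \<le> 1 \<or> k + 1 \<le> card (nb E V v)"

lemma nb_iff [simp]: "w \<in> nb E S v \<longleftrightarrow> w \<in> S \<and> E v w"
  unfolding nb_def by auto

lemma finite_nb [simp]: "finite S \<Longrightarrow> finite (nb E S v)"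
  unfolding nb_def by auto

text \<open>A component of the vertices other than the roots touches each root, by rootedness with
  the other root as excluded vertex. One path through it is enough.\<close>

lemma linked_base:
  assumes "symp E" "rooted E V x y" "V \<noteq> {x, y}" "k \<le> 1"
  shows "linked E V x y k"
proof -
  have xy: "x \<in> V" "y \<in> V" "x \<noteq> y" and fin: "finite V" using assms unfolding rooted_def by auto
  have r: "\<exists>d\<in>D. \<exists>v\<in>V - D - {c}. E d v" if "D \<noteq> {}" "D \<subseteq> V - {x, y}" for D c
    using assms(2) that unfolding rooted_def by blast
  obtain v where v: "v \<in> V - {x, y}" using assms(3) xy by blast
  obtain P where P: "v \<in> P" "P \<subseteq> V - {x, y}" "conn_set E P"
      "\<And>p w. p \<in> P \<Longrightarrow> w \<in> V - {x, y} \<Longrightarrow> E p w \<Longrightarrow> w \<in> P"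
    using component[OF assms(1) v] by metis
  have "P \<noteq> {}" using P by auto
  then obtain p where p: "p \<in> P" "E p y" using r[of P x] P by blast
  obtain q where q: "q \<in> P" "E q x" using r[of P y] P \<open>P \<noteq> {}\<close> by blast
  obtain n where "n \<in> path_lens E P q p" using conn_set_path[OF P(3) q(1) p(1)] .
  then have "Suc n \<in> path_lens E (insert x P) x p"
    using path_lens_Cons q assms(1) P(2) by (metis DiffD2 insertI1 subsetD sympD)
  then have "Suc n \<in> path_lens E (V - {y}) x p"
    by (rule path_lens_mono) (use P xy in auto)
  then have "adm k (path_lens E (V - {y}) x p)" using assms(4) adm_1 by fast
  then show ?thesis unfolding linked_def using p P by blast
qed

text \<open>Contracting \<open>U\<close> and \<open>T\<close> to the two roots of a smaller rooted graph on \<open>P\<close>.\<close>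

lemma contract_roots:
  fixes E :: "'a \<Rightarrow> 'a \<Rightarrow> bool"
  assumes IH: "\<And>(E'::'a \<Rightarrow> 'a \<Rightarrow> bool) V' x' y' k'. card V' < N \<Longrightarrow> symp E' \<Longrightarrow> irreflp E' \<Longrightarrow>
      rooted E' V' x' y' \<Longrightarrow> V' \<noteq> {x', y'} \<Longrightarrow> (\<And>v. v \<in> V' - {x', y'} \<Longrightarrow> deg_ok E' V' k' v) \<Longrightarrow>
      linked E' V' x' y' k'"
    and E: "symp E" "irreflp E"
    and P: "finite P" "P \<noteq> {}" "conn_set E P" "card P + 2 < N"
    and UT: "U \<inter> P = {}" "T \<inter> P = {}" "U \<inter> T = {}"
    and aU: "p \<in> P" "u \<in> U" "E p u" and aT: "p' \<in> P" "t \<in> T" "E p' t"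
    and nohang: "\<And>D c. D \<noteq> {} \<Longrightarrow> D \<subseteq> P \<Longrightarrow> c \<in> P - D \<Longrightarrow> \<exists>d\<in>D. \<exists>v\<in>P \<union> U \<union> T - D - {c}. E d v"
    and deg: "\<And>p. p \<in> P \<Longrightarrow> k \<le> 1 \<or> k + 1 \<le> card (nb E P p) +
        (if \<exists>u\<in>U. E p u then 1 else 0) + (if \<exists>t\<in>T. E p t then 1 else 0)"
  obtains t' where "t' \<in> P" "\<exists>t\<in>T. E t' t" "adm k (\<Union>u\<in>U. path_lens E (insert u P) u t')"
proof -
  \<comment> \<open>The vertex \<open>u\<close> stands for all of \<open>U\<close> and
    \<open>t\<close> for all of \<open>T\<close>, so the new graph lives on the same vertex type.
    The two new roots are not adjacent.\<close>
  define E' where "E' = (\<lambda>a b. (a \<in> P \<and> b \<in> P \<and> E a b) \<or> (a \<in> P \<and> b = u \<and> (\<exists>m\<in>U. E a m)) \<or>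
     (b \<in> P \<and> a = u \<and> (\<exists>m\<in>U. E b m)) \<or> (a \<in> P \<and> b = t \<and> (\<exists>m\<in>T. E a m)) \<or>
     (b \<in> P \<and> a = t \<and> (\<exists>m\<in>T. E b m)))"
  define V' where "V' = P \<union> {u, t}"
  have ut: "u \<notin> P" "t \<notin> P" "u \<noteq> t" using UT aU aT by auto
  have sE': "symp E'" unfolding E'_def by (rule sympI) (use sympD[OF E(1)] in blast)
  have iE': "irreflp E'" unfolding E'_def irreflp_def using ut E(2) by (auto dest: irreflpD)
  have card: "card V' < N" unfolding V'_def using P ut by simp
  have ro: "rooted E' V' u t"
    unfolding rooted_def
  proof (intro conjI allI impI)
    fix D c assume D: "D \<noteq> {}" "D \<subseteq> V' - {u, t}"
    then have DP: "D \<subseteq> P" unfolding V'_def by auto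
    show "\<exists>d\<in>D. \<exists>v\<in>V' - D - {c}. E' d v"
    proof (cases "c \<in> P - D")
      case True
      then obtain d v where dv: "d \<in> D" "v \<in> P \<union> U \<union> T - D - {c}" "E d v"
        using nohang[OF D(1) DP] by blast
      have "E' d (if v \<in> P then v else if v \<in> U then u else t)"
        using dv DP unfolding E'_def by auto
      moreover have "(if v \<in> P then v else if v \<in> U then u else t) \<in> V' - D - {c}"
        using dv DP ut True unfolding V'_def by auto
      ultimately show ?thesis using dv(1) by blast
    next
      case False
      show ?thesis
      \<comment> \<open>If \<open>D\<close> is all of \<open>P\<close>, both roots lie outside and
        at most one of them is \<open>c\<close>. Otherwise connectivity of \<open>P\<close> gives an
        edge that ends in \<open>P - D\<close>, and \<open>c\<close> is not there.\<close>
      proof (cases "D = P")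
        case True
        have "E' p u" "E' p' t" using aU aT unfolding E'_def by auto
        moreover have "u \<in> V' - D - {c} \<or> t \<in> V' - D - {c}" using ut True unfolding V'_def by auto
        ultimately show ?thesis using aU(1) aT(1) True by blast
      next
        case F: False
        then obtain d e where "d \<in> D" "e \<in> P - D" "E d e"
          using P(3) D(1) DP unfolding conn_set_def by blast
        then have "E' d e" "e \<in> V' - D - {c}" using DP False unfolding E'_def V'_def by auto
        then show ?thesis using \<open>d \<in> D\<close> by blast
      qed
    qed
  qed (use P ut in \<open>auto simp: V'_def\<close>)
  have dg: "deg_ok E' V' k v" if v: "v \<in> V' - {u, t}" for v
  proof -
    have vP: "v \<in> P" using v unfolding V'_def by auto
    have "nb E' V' v = nb E P v \<union> (if \<exists>u\<in>U. E v u then {u} else {}) \<union> (if \<exists>t\<in>T. E v t then {t} else {})"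
      using vP ut unfolding E'_def V'_def by auto
    moreover have "card \<dots> = card (nb E P v) + (if \<exists>u\<in>U. E v u then 1 else 0) + (if \<exists>t\<in>T. E v t then 1 else 0)"
      using P(1) ut by (auto simp: card_insert_if)
    ultimately show ?thesis using deg[OF vP] unfolding deg_ok_def by simp
  qed
  have "V' \<noteq> {u, t}" unfolding V'_def using P ut by auto
  from IH[OF card sE' iE' ro this dg] obtain t' where t': "t' \<in> V'" "E' t' t" "t' \<noteq> u" "t' \<noteq> t"
    and a: "adm k (path_lens E' (V' - {t}) u t')" unfolding linked_def by blast
  have tP: "t' \<in> P" using t' unfolding V'_def by auto
  have tT: "\<exists>t\<in>T. E t' t" using t'(2) tP ut unfolding E'_def by auto
  \<comment> \<open>Only the first vertex of a path needs replacing: the vertex after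
    \<open>u\<close> has a real neighbour in \<open>U\<close>. Different paths may thus start at
    different vertices of \<open>U\<close>.\<close>
  have "path_lens E' (V' - {t}) u t' \<subseteq> (\<Union>u\<in>U. path_lens E (insert u P) u t')"
  proof
    fix n assume "n \<in> path_lens E' (V' - {t}) u t'"
    then obtain xs where xs: "gpath E' (V' - {t}) xs" "hd xs = u" "last xs = t'" "length xs = Suc n"
      by (rule path_lensE)
    obtain ys where ys: "xs = u # ys" using xs(1,2) unfolding gpath_def by (cases xs) auto
    have ne: "ys \<noteq> []" using ys xs(3) t'(3) by auto
    have sP: "set ys \<subseteq> P" using xs(1) ys unfolding gpath_def V'_def by auto
    have "E' u (hd ys)" using xs(1) ys ne unfolding gpath_def by (auto simp: successively_Cons)
    then obtain m where m: "m \<in> U" "E (hd ys) m"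
      using ut sP ne hd_in_set[OF ne] unfolding E'_def by auto
    have "successively E' ys" using xs(1) ys ne unfolding gpath_def by (auto simp: successively_Cons)
    then have "successively E ys"
      by (rule successively_mono) (use sP ut in \<open>auto simp: E'_def\<close>)
    moreover have "m \<notin> set ys" using m sP UT by auto
    ultimately have "gpath E (insert m P) (m # ys)"
      using xs(1) ys ne sP m sympD[OF E(1)] unfolding gpath_def by (auto simp: successively_Cons)
    from path_lensI[OF this, of n] show "n \<in> (\<Union>u\<in>U. path_lens E (insert u P) u t')"
      using xs ys ne m by auto
  qed
  then show ?thesis using that[OF tP tT] adm_mono[OF a] by blast
qed

subsection \<open>A minimal counterexample\<close>

lemma card_nb_two:
  assumes "nb E V q \<subseteq> P \<union> {a, b}" "P \<subseteq> V" "a \<in> V" "b \<in> V" "a \<noteq> b" "a \<notin> P" "b \<notin> P" "finite P"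
  shows "card (nb E V q) = card (nb E P q) + (if E q a then 1 else 0) + (if E q b then 1 else 0)"
proof -
  have "nb E V q = nb E P q \<union> (if E q a then {a} else {}) \<union> (if E q b then {b} else {})"
    using assms(1-4) by (auto simp: nb_def)
  then show ?thesis using assms(5-8) by (auto simp: card_insert_if)
qed

text \<open>The degree condition is kept out of the locale and reappears as the hypothesis
  \<open>dok\<close> of single lemmas. The locale is interpreted once more on
  \<open>V - {y}\<close>, where the neighbours of \<open>y\<close> have lost a degree.\<close>

locale minimal_unlinked =
  fixes E :: "'a \<Rightarrow> 'a \<Rightarrow> bool" and V :: "'a set" and x y :: 'a and k :: nat
  assumes IH: "\<And>(E'::'a \<Rightarrow> 'a \<Rightarrow> bool) V' x' y' k'. card V' < card V \<Longrightarrow> symp E' \<Longrightarrow> irreflp E' \<Longrightarrow>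
      rooted E' V' x' y' \<Longrightarrow> V' \<noteq> {x', y'} \<Longrightarrow> (\<And>v. v \<in> V' - {x', y'} \<Longrightarrow> deg_ok E' V' k' v) \<Longrightarrow>
      linked E' V' x' y' k'"
    and sym: "symp E" and irrefl: "irreflp E"
    and ro: "rooted E V x y" and nontriv: "V \<noteq> {x, y}" and unlinked: "\<not> linked E V x y k"
begin

lemma E_sym: "E a b \<Longrightarrow> E b a" using sym by (rule sympD)

lemma E_irrefl [simp]: "\<not> E a a" using irrefl by (rule irreflpD)

lemma xy [simp]: "x \<in> V" "y \<in> V" "x \<noteq> y" "y \<noteq> x" and finV [simp]: "finite V"
  using ro unfolding rooted_def by auto

lemma rootedD: "D \<noteq> {} \<Longrightarrow> D \<subseteq> V - {x, y} \<Longrightarrow> \<exists>d\<in>D. \<exists>v\<in>V - D - {c}. E d v"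
  using ro unfolding rooted_def by blast

lemma k_ge: "2 \<le> k"
proof (rule ccontr)
  assume "\<not> 2 \<le> k"
  then have "k \<le> 1" by simp
  then show False using linked_base[OF sym ro nontriv] unlinked by blast
qed

lemma direct:
  assumes "y' \<in> V" "E y' y" "y' \<noteq> x" "adm k (path_lens E A x y')" "A \<subseteq> V - {y}"
  shows False
proof -
  have "adm k (path_lens E (V - {y}) x y')"
    using adm_mono[OF assms(4)] path_lens_mono assms(5) by (metis subsetI)
  moreover have "y' \<noteq> y" using assms(2) by auto
  ultimately show False using unlinked assms unfolding linked_def by blast
qed

text \<open>A fixed tail from \<open>c\<close> to \<open>y\<close> gives all paths the same last
  edge, as \<open>linked\<close> demands.\<close>

lemma finish:
  assumes a: "adm k (path_lens E A x c)" and A: "A \<subseteq> V - {y}" and S: "m \<in> path_lens E S c y" "S \<subseteq> V" "S \<inter> A \<subseteq> {c}"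
    and c: "c \<noteq> x" "c \<noteq> y"
  shows False
proof -
  obtain y' m' where y': "E y' y" "y' \<in> S" "y' \<noteq> y" "m' \<in> path_lens E (S - {y}) c y'"
    using path_lens_penultimate[OF S(1) c(2)] by blast
  have "adm k (path_lens E (A \<union> (S - {y})) x y')"
    using a by (rule adm_shift[where c = m']) (rule path_lens_join, use y' S(3) in auto)
  moreover have "x \<in> A" using a k_ge path_lens_in(1)[of _ E A x c] unfolding adm_def
    by (metis gr0I not_numeral_le_zero)
  ultimately show False
    using direct[of y' "A \<union> (S - {y})"] y' S A c by auto
qed

lemma finish_at:
  assumes t': "t' \<in> P" "E t' t" "adm k (path_lens E (Q \<union> P) x t')" and x: "x \<in> Q" "x \<notin> P"
    and V: "Q \<union> P \<subseteq> V - {y}" "t \<in> V" "t \<notin> Q \<union> P"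
    and tail: "t \<noteq> y \<Longrightarrow> \<exists>m S. m \<in> path_lens E S t y \<and> S \<subseteq> V \<and> S \<inter> (Q \<union> P) = {}"
  shows False
proof (cases "t = y")
  case True
  then show False using direct[of t' "Q \<union> P"] t' V x by auto
next
  case False
  obtain m S where S: "m \<in> path_lens E S t y" "S \<subseteq> V" "S \<inter> (Q \<union> P) = {}"
    using tail[OF False] by blast
  have "adm k (path_lens E (insert t (Q \<union> P)) x t)"
    by (rule adm_shift[OF t'(3), where c = 1]) (use path_lens_snoc[of _ E "Q \<union> P" x t' t] t'(2) V(3) in auto)
  then show False
    by (rule finish[OF _ _ S(1,2)]) (use V S x False in auto)
qed

lemma contract:
  assumes P: "P \<subseteq> V" "P \<noteq> {}" "conn_set E P" "card P + 2 < card V"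
    and UT: "U \<inter> P = {}" "T \<inter> P = {}" "U \<inter> T = {}"
    and aU: "\<exists>p\<in>P. \<exists>u\<in>U. E p u" and aT: "\<exists>p\<in>P. \<exists>t\<in>T. E p t"
    and nohang: "\<And>D c. D \<noteq> {} \<Longrightarrow> D \<subseteq> P \<Longrightarrow> c \<in> P - D \<Longrightarrow> \<exists>d\<in>D. \<exists>v\<in>P \<union> U \<union> T - D - {c}. E d v"
    and deg: "\<And>p. p \<in> P \<Longrightarrow> k' \<le> 1 \<or> k' + 1 \<le> card (nb E P p) +
        (if \<exists>u\<in>U. E p u then 1 else 0) + (if \<exists>t\<in>T. E p t then 1 else 0)"
  shows "\<exists>t'\<in>P. (\<exists>t\<in>T. E t' t) \<and> adm k' (\<Union>u\<in>U. path_lens E (insert u P) u t')"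
proof -
  obtain p u where pu: "p \<in> P" "u \<in> U" "E p u" using aU by blast
  obtain p' t where pt: "p' \<in> P" "t \<in> T" "E p' t" using aT by blast
  have fP: "finite P" using P(1) finite_subset[OF _ finV] by blast
  show ?thesis
    by (rule contract_roots[OF IH sym irrefl fP P(2-4) UT pu pt nohang deg]) blast+
qed

text \<open>No part of a minimal counterexample hangs on \<open>x\<close> and one more vertex
  \<open>c\<close>: with roots \<open>x\<close> and \<open>c\<close> the part is a smaller instance,
  and its paths are continued by a tail from \<open>c\<close> to \<open>y\<close> that avoids it.
  The vertex \<open>v0\<close> makes it strictly smaller; \<open>c = y\<close> is allowed.\<close>

lemma reduce_x:
  assumes D: "D \<noteq> {}" "D \<subseteq> V - {x, y}" "c \<in> V" "c \<noteq> x" "c \<notin> D"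
    and cl: "\<And>d v. d \<in> D \<Longrightarrow> v \<in> V \<Longrightarrow> E d v \<Longrightarrow> v \<in> D \<union> {x, c}"
    and deg: "\<And>d. d \<in> D \<Longrightarrow> deg_ok E V k d" and v0: "v0 \<in> V - D - {x, c}"
  shows False
proof -
  obtain d0 where d0: "d0 \<in> D" using D by auto
  obtain P where P: "d0 \<in> P" "P \<subseteq> D" "conn_set E P" "\<And>p w. p \<in> P \<Longrightarrow> w \<in> D \<Longrightarrow> E p w \<Longrightarrow> w \<in> P"
    using component[OF sym d0] by metis
  have clP: "v \<in> P \<union> {x, c}" if "p \<in> P" "v \<in> V" "E p v" for p v using that P cl by blast
  have Pn: "P \<noteq> {}" "P \<subseteq> V - {x, y}" "finite P" using P D finite_subset[of P V] by auto
  obtain p where p: "p \<in> P" "E p x" using rootedD[OF Pn(1,2), of c] clP by blast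
  obtain p' where p': "p' \<in> P" "E p' c" using rootedD[OF Pn(1,2), of x] clP by blast
  have xc: "x \<notin> P" "c \<notin> P" using P D by auto
  have card: "card P + 2 < card V"
  proof -
    have "card (P \<union> {x, c, v0}) \<le> card V" by (rule card_mono) (use Pn D v0 in auto)
    moreover have "card (P \<union> {x, c, v0}) = card P + 3"
      using v0 P xc Pn D by (subst card_Un_disjoint) auto
    ultimately show ?thesis by simp
  qed
  have dg: "k \<le> 1 \<or> k + 1 \<le> card (nb E P q) + (if \<exists>u\<in>{x}. E q u then 1 else 0) + (if \<exists>t\<in>{c}. E q t then 1 else 0)"
    if q: "q \<in> P" for q
  proof -
    have "nb E V q \<subseteq> P \<union> {x, c}" using clP[OF q] unfolding nb_def by blast
    then have "card (nb E V q) = card (nb E P q) + (if E q x then 1 else 0) + (if E q c then 1 else 0)"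
      by (rule card_nb_two) (use xc D Pn in auto)
    moreover have "deg_ok E V k q" using deg q P by blast
    ultimately show ?thesis unfolding deg_ok_def by auto
  qed
  have "\<exists>t'\<in>P. (\<exists>t\<in>{c}. E t' t) \<and> adm k (\<Union>u\<in>{x}. path_lens E (insert u P) u t')"
  proof (rule contract[OF _ _ P(3) card])
    show "\<exists>d\<in>D'. \<exists>v\<in>P \<union> {x} \<union> {c} - D' - {c'}. E d v"
      if "D' \<noteq> {}" "D' \<subseteq> P" "c' \<in> P - D'" for D' c'
      using rootedD[of D' c'] that Pn clP by blast
    show "k \<le> 1 \<or> k + 1 \<le> card (nb E P q) + (if \<exists>u\<in>{x}. E q u then 1 else 0) + (if \<exists>t\<in>{c}. E q t then 1 else 0)"
      if "q \<in> P" for q using dg[OF that] .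
  qed (use Pn p p' xc D(3-) in auto)
  then obtain t' where t': "t' \<in> P" "\<exists>t\<in>{c}. E t' t" "adm k (\<Union>u\<in>{x}. path_lens E (insert u P) u t')"
    by blast
  have t'': "E t' c" "adm k (path_lens E ({x} \<union> P) x t')" using t'(2,3) by auto
  have Vs: "{x} \<union> P \<subseteq> V - {y}" "c \<notin> {x} \<union> P" using Pn D(4) xc by auto
  show False
  proof (rule finish_at[OF t'(1) t'' _ xc(1) Vs(1) D(3) Vs(2)])
    assume cy: "c \<noteq> y"
    have cS: "c \<in> V - {x} - P" using D xc by auto
    obtain K where K: "c \<in> K" "K \<subseteq> V - {x} - P" "conn_set E K"
        "\<And>p w. p \<in> K \<Longrightarrow> w \<in> V - {x} - P \<Longrightarrow> E p w \<Longrightarrow> w \<in> K"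
      using component[OF sym cS] by metis
    \<comment> \<open>Otherwise \<open>K\<close> and \<open>P\<close> together would be attached to
      \<open>x\<close> alone.\<close>
    have "y \<in> K"
    proof (rule ccontr)
      assume "y \<notin> K"
      then have "\<exists>d\<in>K \<union> P. \<exists>v\<in>V - (K \<union> P) - {x}. E d v" using K(1,2) Pn by (intro rootedD) auto
    then obtain d v where dv: "d \<in> K \<union> P" "v \<in> V" "v \<notin> K" "v \<notin> P" "v \<noteq> x" "E d v" by blast
    show False using dv K(4)[of d v] clP[of d v] K(1) by auto
    qed
    then obtain m where "m \<in> path_lens E K c y" using conn_set_path[OF K(3,1)] by blast
    then show "\<exists>m S. m \<in> path_lens E S c y \<and> S \<subseteq> V \<and> S \<inter> ({x} \<union> P) = {}" using K(2) by blast
  qed simp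
qed

text \<open>The mirror image of \<open>reduce_x\<close>: the part carries the ends of the paths, and
  a fixed path from \<open>x\<close> to \<open>c\<close> is put in front. Here \<open>x\<close>
  itself is the vertex that makes the part smaller.\<close>

lemma reduce_y:
  assumes D: "D \<noteq> {}" "D \<subseteq> V - {x, y}" "c \<in> V" "c \<noteq> x" "c \<noteq> y" "c \<notin> D"
    and cl: "\<And>d v. d \<in> D \<Longrightarrow> v \<in> V \<Longrightarrow> E d v \<Longrightarrow> v \<in> D \<union> {c, y}"
    and deg: "\<And>d. d \<in> D \<Longrightarrow> deg_ok E V k d"
  shows False
proof -
  obtain d0 where d0: "d0 \<in> D" using D by auto
  obtain P where P: "d0 \<in> P" "P \<subseteq> D" "conn_set E P" "\<And>p w. p \<in> P \<Longrightarrow> w \<in> D \<Longrightarrow> E p w \<Longrightarrow> w \<in> P"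
    using component[OF sym d0] by metis
  have clP: "v \<in> P \<union> {c, y}" if "p \<in> P" "v \<in> V" "E p v" for p v using that P cl by blast
  have Pn: "P \<noteq> {}" "P \<subseteq> V - {x, y}" "finite P" using P D finite_subset[of P V] by auto
  obtain p where p: "p \<in> P" "E p c" using rootedD[OF Pn(1,2), of y] clP by blast
  obtain p' where p': "p' \<in> P" "E p' y" using rootedD[OF Pn(1,2), of c] clP by blast
  have xc: "y \<notin> P" "x \<notin> P" "c \<notin> P" using P D by auto
  have card: "card P + 2 < card V"
  proof -
    have "card (P \<union> {x, c, y}) \<le> card V" by (rule card_mono) (use Pn D in auto)
    moreover have "card (P \<union> {x, c, y}) = card P + 3"
      using P xc Pn D by (subst card_Un_disjoint) auto
    ultimately show ?thesis by simp
  qed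
  have dg: "k \<le> 1 \<or> k + 1 \<le> card (nb E P q) + (if \<exists>u\<in>{c}. E q u then 1 else 0) + (if \<exists>t\<in>{y}. E q t then 1 else 0)"
    if q: "q \<in> P" for q
  proof -
    have "nb E V q \<subseteq> P \<union> {c, y}" using clP[OF q] unfolding nb_def by blast
    then have "card (nb E V q) = card (nb E P q) + (if E q c then 1 else 0) + (if E q y then 1 else 0)"
      by (rule card_nb_two) (use xc D Pn in auto)
    moreover have "deg_ok E V k q" using deg q P by blast
    ultimately show ?thesis unfolding deg_ok_def by auto
  qed
  have "\<exists>t'\<in>P. (\<exists>t\<in>{y}. E t' t) \<and> adm k (\<Union>u\<in>{c}. path_lens E (insert u P) u t')"
  proof (rule contract[OF _ _ P(3) card])
    show "\<exists>d\<in>D'. \<exists>v\<in>P \<union> {c} \<union> {y} - D' - {c'}. E d v"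
      if "D' \<noteq> {}" "D' \<subseteq> P" "c' \<in> P - D'" for D' c'
      using rootedD[of D' c'] that Pn clP by blast
    show "k \<le> 1 \<or> k + 1 \<le> card (nb E P q) + (if \<exists>u\<in>{c}. E q u then 1 else 0) + (if \<exists>t\<in>{y}. E q t then 1 else 0)"
      if "q \<in> P" for q using dg[OF that] .
  qed (use Pn p p' xc D(3-) in auto)
  then obtain t' where t': "t' \<in> P" "\<exists>t\<in>{y}. E t' t" "adm k (\<Union>u\<in>{c}. path_lens E (insert u P) u t')"
    by blast
  have cS: "c \<in> V - {y} - P" using D xc by auto
  obtain K where K: "c \<in> K" "K \<subseteq> V - {y} - P" "conn_set E K"
      "\<And>p w. p \<in> K \<Longrightarrow> w \<in> V - {y} - P \<Longrightarrow> E p w \<Longrightarrow> w \<in> K"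
    using component[OF sym cS] by metis
  have "x \<in> K"
  proof (rule ccontr)
    assume "x \<notin> K"
    then have "\<exists>d\<in>K \<union> P. \<exists>v\<in>V - (K \<union> P) - {y}. E d v" using K(1,2) Pn by (intro rootedD) auto
    then obtain d v where dv: "d \<in> K \<union> P" "v \<in> V" "v \<notin> K" "v \<notin> P" "v \<noteq> y" "E d v" by blast
    show False using dv K(4)[of d v] clP[of d v] K(1) by auto
  qed
  then obtain m where m: "m \<in> path_lens E K x c" using conn_set_path[OF K(3) _ K(1)] by blast
  have "adm k (path_lens E (K \<union> insert c P) x t')"
    using t'(3) by (rule adm_shift[where c = m])
      (use path_lens_join[OF m, of _ "insert c P" t'] K(1,2) in \<open>auto simp: add.commute\<close>)
  moreover have "K \<union> insert c P \<subseteq> V - {y}" "t' \<in> V" "E t' y" "t' \<noteq> x" using t'(1,2) Pn xc K(2) D(3,5) by auto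
  ultimately show False using direct by blast
qed

end

lemma card_nb_three_le:
  assumes "nb E V p \<subseteq> P \<union> {a, b, c}" "finite P"
  shows "card (nb E V p) \<le> card (nb E P p) + (if E p a then 1 else 0) + (if E p b then 1 else 0) + (if E p c then 1 else 0)"
proof -
  let ?A = "if E p a then {a} else {}" and ?B = "if E p b then {b} else {}" and ?C = "if E p c then {c} else {}"
  have "nb E V p \<subseteq> nb E P p \<union> ?A \<union> ?B \<union> ?C" using assms(1) by (auto simp: nb_def)
  then have "card (nb E V p) \<le> card (nb E P p \<union> ?A \<union> ?B \<union> ?C)" by (rule card_mono[rotated]) (use assms(2) in auto)
  also have "\<dots> \<le> card (nb E P p) + card ?A + card ?B + card ?C"
    by (intro order.trans[OF card_Un_le] add_mono order.refl)
  finally show ?thesis by (auto split: if_splits)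
qed

section \<open>Contracting a structure at the root\<close>

context minimal_unlinked
begin

lemma card_plus3:
  assumes "P \<subseteq> V" "a \<in> V - P" "b \<in> V - P" "c \<in> V - P" "a \<noteq> b" "a \<noteq> c" "b \<noteq> c"
  shows "card P + 2 < card V"
proof -
  have f: "finite P" using assms(1) finite_subset[OF _ finV] by blast
  have "card (P \<union> {a, b, c}) \<le> card V" by (rule card_mono) (use assms in auto)
  moreover have "card (P \<union> {a, b, c}) = card P + 3"
    using assms f by (subst card_Un_disjoint) auto
  ultimately show ?thesis by simp
qed

text \<open>\<open>Q\<close> is the structure, and \<open>l + 1\<close> lengths of step
  \<open>s\<close> lead in it from \<open>x\<close> to each vertex of \<open>U\<close>. Contracting
  \<open>U\<close> and dropping the rest of \<open>Q\<close> costs a vertex at most \<open>l\<close>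
  edges, because one edge to \<open>U\<close> survives. The induction hypothesis then gives
  \<open>k - l\<close> lengths, and the lengths inside \<open>Q\<close> restore the other
  \<open>l\<close>.\<close>

lemma structure_step:
  assumes Q: "Q \<subseteq> V" "x \<in> Q" "U \<subseteq> Q" "x \<notin> U"
    and P: "P \<subseteq> V" "P \<noteq> {}" "conn_set E P" "P \<inter> Q = {}" and t: "t \<in> V" "t \<notin> P" "t \<notin> Q"
    and at: "\<exists>p\<in>P. E p t" and aU: "\<exists>p\<in>P. \<exists>u\<in>U. E p u"
    and cl: "\<And>p v. p \<in> P \<Longrightarrow> v \<in> V \<Longrightarrow> E p v \<Longrightarrow> v \<in> P \<union> {t} \<union> Q"
    and nohang: "\<And>D c. D \<noteq> {} \<Longrightarrow> D \<subseteq> P \<Longrightarrow> c \<in> P - D \<Longrightarrow>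
        (\<And>d v. d \<in> D \<Longrightarrow> v \<in> V \<Longrightarrow> E d v \<Longrightarrow> v \<in> D \<union> {c} \<union> (Q - U)) \<Longrightarrow> False"
    and dok: "\<And>p. p \<in> P \<Longrightarrow> deg_ok E V k p"
    and loss: "\<And>p. p \<in> P \<Longrightarrow> card (nb E Q p) \<le> l + (if \<exists>u\<in>U. E p u then 1 else 0)"
    and mode: "s = 1 \<and> 1 \<le> l \<or> s = 2"
    and L: "\<And>u j. u \<in> U \<Longrightarrow> j \<le> l \<Longrightarrow> b + s * j \<in> path_lens E Q x u"
  shows "\<exists>t'\<in>P. E t' t \<and> adm k (path_lens E (Q \<union> P) x t')"
proof -
  \<comment> \<open>At least 1, so that there is a path to extend even if \<open>l\<close> reaches
    or exceeds \<open>k\<close>.\<close>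
  define k' where "k' = max 1 (k - l)"
  have fin: "finite P" "finite Q" using P(1) Q(1) finite_subset[OF _ finV] by auto
  obtain p0 u0 where u0: "u0 \<in> U" "p0 \<in> P" "E p0 u0" using aU by blast
  have xP: "x \<notin> P" and UP: "U \<inter> P = {}" using P(4) Q by auto
  have card: "card P + 2 < card V"
    by (rule card_plus3[of _ x u0 t]) (use P Q t u0 in auto)
  have "\<exists>t'\<in>P. (\<exists>t\<in>{t}. E t' t) \<and> adm k' (\<Union>u\<in>U. path_lens E (insert u P) u t')"
  proof (rule contract[OF P(1-3) card])
    show "\<exists>d\<in>D. \<exists>v\<in>P \<union> U \<union> {t} - D - {c}. E d v" if D: "D \<noteq> {}" "D \<subseteq> P" "c \<in> P - D" for D c
    proof (rule ccontr)
      assume no: "\<not> (\<exists>d\<in>D. \<exists>v\<in>P \<union> U \<union> {t} - D - {c}. E d v)"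
      have "v \<in> D \<union> {c} \<union> (Q - U)" if "d \<in> D" "v \<in> V" "E d v" for d v
      proof -
        have "v \<in> P \<union> {t} \<union> Q" using cl that D(2) by blast
        then show ?thesis using no that by blast
      qed
      then show False using nohang[OF D] by blast
    qed
    show "k' \<le> 1 \<or> k' + 1 \<le> card (nb E P p) + (if \<exists>u\<in>U. E p u then 1 else 0) + (if \<exists>t\<in>{t}. E p t then 1 else 0)"
      if p: "p \<in> P" for p
    proof (cases "k' \<le> 1")
      case False
      then have k': "k' = k - l" "1 < k" unfolding k'_def by auto
      have "nb E V p = nb E P p \<union> nb E {t} p \<union> nb E Q p" using cl[OF p] P(1) Q(1) t(1) by (auto simp: nb_def)
      moreover have "card (nb E P p \<union> nb E {t} p \<union> nb E Q p) = card (nb E P p) + card (nb E {t} p) + card (nb E Q p)"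
      proof -
        have "(nb E P p \<union> nb E {t} p) \<inter> nb E Q p = {}" "nb E P p \<inter> nb E {t} p = {}"
          using P(4) t by (auto simp: nb_def)
        then show ?thesis using fin by (simp add: card_Un_disjoint)
      qed
      moreover have "card (nb E {t} p) = (if E p t then 1 else 0)"
      proof -
        have "nb E {t} p = (if E p t then {t} else {})" by (auto simp: nb_def)
        then show ?thesis by simp
      qed
      moreover have "k + 1 \<le> card (nb E V p)" using dok[OF p] k'(2) unfolding deg_ok_def by simp
      ultimately show ?thesis using loss[OF p] k' by (auto split: if_splits)
    qed simp
  qed (use UP P t Q at aU in auto)
  then obtain t' where t': "t' \<in> P" "E t' t" "adm k' (\<Union>u\<in>U. path_lens E (insert u P) u t')" by auto
  have join: "n + (b + s * j) \<in> path_lens E (Q \<union> P) x t'"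
    if n: "n \<in> (\<Union>u\<in>U. path_lens E (insert u P) u t')" and j: "j \<le> l" for n j
  proof -
    obtain u where u: "u \<in> U" "n \<in> path_lens E (insert u P) u t'" using n by blast
    have "b + s * j + n \<in> path_lens E (Q \<union> insert u P) x t'"
      by (rule path_lens_join[OF L[OF u(1) j] u(2)]) (use P(4) in auto)
    moreover have "Q \<union> insert u P = Q \<union> P" using u Q by auto
    ultimately show ?thesis by (simp add: add.commute)
  qed
  have "1 \<le> k'" "k \<le> k' + l" unfolding k'_def by auto
  then have "adm k (path_lens E (Q \<union> P) x t')"
  proof (cases "s = 2")
    case True
    show ?thesis by (rule adm_even_steps[OF t'(3) \<open>1 \<le> k'\<close> \<open>k \<le> k' + l\<close>, of b]) (use join True in auto)
  next
    case False
    then have s: "s = 1" "1 \<le> l" using mode by auto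
    show ?thesis by (rule adm_interval[OF t'(3) \<open>1 \<le> k'\<close> \<open>k \<le> k' + l\<close>, of b]) (use join s in auto)
  qed
  then show ?thesis using t' by blast
qed

text \<open>The common penultimate vertex decides whether all paths end in \<open>x\<close> or all end in \<open>a\<close>.\<close>

lemma merge_step:
  assumes a: "a \<in> V" "a \<noteq> x" "a \<noteq> y" and D: "D \<noteq> {}" "D \<subseteq> V - {x, y, a}" "conn_set E D"
    and c: "c \<in> V" "c \<notin> D" "c \<noteq> x" "c \<noteq> a" "c \<noteq> y"
    and cl: "\<And>d v. d \<in> D \<Longrightarrow> v \<in> V \<Longrightarrow> E d v \<Longrightarrow> v \<in> D \<union> {x, a, c}"
    and nc: "\<And>d. d \<in> D \<Longrightarrow> \<not> (E d x \<and> E d a)"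
    and dok: "\<And>d. d \<in> D \<Longrightarrow> deg_ok E V k d"
    and pre: "m \<in> path_lens E A x a" "A \<subseteq> V - {y}" "A \<inter> insert c D = {}"
    and tail: "r \<in> path_lens E S c y" "S \<subseteq> V" "S \<inter> (A \<union> D) = {}"
  shows False
proof -
  have Dx: "D \<subseteq> V - {x, y}" using D by auto
  have fin: "finite D" using D(2) finite_subset[OF _ finV] by blast
  obtain d1 where d1: "d1 \<in> D" "E d1 x \<or> E d1 a" using rootedD[OF D(1) Dx, of c] cl by blast
  have at: "\<exists>d\<in>D. E d c"
  proof (rule ccontr)
    assume no: "\<not> (\<exists>d\<in>D. E d c)"
    have cl': "v \<in> D \<union> {x, a}" if "d \<in> D" "v \<in> V" "E d v" for d v using cl[OF that] no that by auto
    show False by (rule reduce_x[OF D(1) Dx a(1,2) _ cl' dok, where ?v0.0 = c]) (use D c in auto)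
  qed
  have card: "card D + 2 < card V" by (rule card_plus3[of _ x a c]) (use D a c in auto)
  \<comment> \<open>The roots are \<open>c\<close> and the merged pair \<open>{x, a}\<close>; by
    \<open>nc\<close> the merging costs no degree. The paths start at \<open>c\<close> and are used
    backwards, so their common last vertex becomes the first one after \<open>x\<close> or
    \<open>a\<close>.\<close>
  have "\<exists>t'\<in>D. (\<exists>t\<in>{x, a}. E t' t) \<and> adm k (\<Union>u\<in>{c}. path_lens E (insert u D) u t')"
  proof (rule contract[OF _ D(1,3) card])
    show "\<exists>d\<in>D'. \<exists>v\<in>D \<union> {c} \<union> {x, a} - D' - {c'}. E d v"
      if "D' \<noteq> {}" "D' \<subseteq> D" "c' \<in> D - D'" for D' c'
      using rootedD[of D' c'] that Dx cl by blast
    show "k \<le> 1 \<or> k + 1 \<le> card (nb E D p) + (if \<exists>u\<in>{c}. E p u then 1 else 0) + (if \<exists>t\<in>{x, a}. E p t then 1 else 0)"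
      if p: "p \<in> D" for p
    proof -
      have "nb E V p \<subseteq> D \<union> {c, x, a}" using cl[OF p] by (auto simp: nb_def)
      from card_nb_three_le[OF this fin]
      have "card (nb E V p) \<le> card (nb E D p) + (if E p c then 1 else 0) + (if E p x then 1 else 0) + (if E p a then 1 else 0)" .
      then show ?thesis using nc[OF p] dok[OF p] unfolding deg_ok_def by (auto split: if_splits)
    qed
  qed (use at d1 D c in auto)
  then obtain w where w: "w \<in> D" "E w x \<or> E w a" "adm k (path_lens E (insert c D) c w)" by auto
  have xA: "x \<in> A" "a \<in> A" using path_lens_in[OF pre(1)] by auto
  show False
  proof (cases "E w x")
    case True
    have "adm k (path_lens E (insert x (insert c D)) x c)"
      by (rule adm_shift[OF w(3), where c = 1])
        (use path_lens_Cons[OF path_lens_rev[OF sym] E_sym[OF True]] Dx c in auto)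
    then show False
      by (rule finish[OF _ _ tail(1,2)]) (use Dx c tail(3) xA in auto)
  next
    case False
    then have wa: "E w a" using w by auto
    have 1: "Suc n \<in> path_lens E (insert a (insert c D)) a c" if "n \<in> path_lens E (insert c D) c w" for n
      using path_lens_Cons[OF path_lens_rev[OF sym that] E_sym[OF wa]] D(2) c(4) by auto
    have "adm k (path_lens E (A \<union> insert a (insert c D)) x c)"
      by (rule adm_shift[OF w(3), where c = "m + 1"])
        (use path_lens_join[OF pre(1) 1] pre(3) in \<open>auto simp: add.commute add.left_commute\<close>)
    then show False
      by (rule finish[OF _ _ tail(1,2)]) (use Dx a c tail(3) xA pre(2) in auto)
  qed
qed

text \<open>Otherwise \<open>y\<close> could be merged with a neighbour \<open>b\<close> without any
  loss of degree. The common last vertex of the paths is then adjacent to \<open>y\<close>, or it is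
  adjacent to \<open>b\<close>, and \<open>b\<close> becomes the penultimate vertex.\<close>

lemma y_triangle:
  assumes dok: "\<And>v. v \<in> V - {x, y} \<Longrightarrow> deg_ok E V k v"
  shows "\<exists>u\<in>V - {x}. \<exists>v\<in>V - {x}. E u y \<and> E v y \<and> E u v"
proof (rule ccontr)
  assume no': "\<not> ?thesis"
  have no: "\<not> (E u y \<and> E v y \<and> E u v)" if "u \<in> V - {x}" "v \<in> V - {x}" for u v
    using that no' by blast
  have "V - {x, y} \<noteq> {}" using nontriv by auto
  from rootedD[OF this, of x] obtain b where b: "b \<in> V" "b \<noteq> x" "b \<noteq> y" "E b y" by blast
  have "V - {x, y, b} \<noteq> {}"
  proof
    assume "V - {x, y, b} = {}"
    then have "nb E V b \<subseteq> {x, y}" by (auto simp: nb_def)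
    then have "card (nb E V b) \<le> card {x, y}" by (intro card_mono) auto
    then show False using dok[of b] b k_ge unfolding deg_ok_def by auto
  qed
  then obtain v0 where v0: "v0 \<in> V - {x, y, b}" by blast
  obtain P where P: "v0 \<in> P" "P \<subseteq> V - {x, y, b}" "conn_set E P"
      "\<And>p w. p \<in> P \<Longrightarrow> w \<in> V - {x, y, b} \<Longrightarrow> E p w \<Longrightarrow> w \<in> P"
    using component[OF sym v0] by metis
  have clP: "v \<in> P \<union> {x, y, b}" if "p \<in> P" "v \<in> V" "E p v" for p v using P(4) that by blast
  have Pn: "P \<noteq> {}" "P \<subseteq> V - {x, y}" "P \<subseteq> V" "finite P" using P(1,2) finite_subset[of P V] by auto
  have ax: "\<exists>p\<in>P. E p x"
  proof (rule ccontr)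
    assume nox: "\<not> (\<exists>p\<in>P. E p x)"
    have "v \<in> P \<union> {b, y}" if "p \<in> P" "v \<in> V" "E p v" for p v using clP[OF that] nox that by auto
    then show False by (rule reduce_y[OF Pn(1,2) b(1-3), rotated]) (use P(2) dok in auto)
  qed
  have ay: "\<exists>p\<in>P. \<exists>t\<in>{y, b}. E p t" using rootedD[OF Pn(1,2), of x] clP by blast
  have card: "card P + 2 < card V" by (rule card_plus3[of _ x y b]) (use Pn P(2) b in auto)
  have "\<exists>t'\<in>P. (\<exists>t\<in>{y, b}. E t' t) \<and> adm k (\<Union>u\<in>{x}. path_lens E (insert u P) u t')"
  proof (rule contract[OF Pn(3,1) P(3) card])
    show "\<exists>d\<in>D'. \<exists>v\<in>P \<union> {x} \<union> {y, b} - D' - {c'}. E d v"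
      if "D' \<noteq> {}" "D' \<subseteq> P" "c' \<in> P - D'" for D' c'
      using rootedD[of D' c'] that Pn(2) clP by blast
    show "k \<le> 1 \<or> k + 1 \<le> card (nb E P p) + (if \<exists>u\<in>{x}. E p u then 1 else 0) + (if \<exists>t\<in>{y, b}. E p t then 1 else 0)"
      if p: "p \<in> P" for p
    proof -
      have "nb E V p \<subseteq> P \<union> {x, y, b}" using clP[OF p] by (auto simp: nb_def)
      from card_nb_three_le[OF this Pn(4)]
      have "card (nb E V p) \<le> card (nb E P p) + (if E p x then 1 else 0) + (if E p y then 1 else 0) + (if E p b then 1 else 0)" .
      moreover have "\<not> (E p y \<and> E p b)" using no[of p b] p Pn(2) b by auto
      moreover have "deg_ok E V k p" using dok p Pn(2) by auto
      ultimately show ?thesis unfolding deg_ok_def by (auto split: if_splits)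
    qed
  qed (use ax ay P(2) b in auto)
  then obtain t' where t': "t' \<in> P" "E t' y \<or> E t' b" "adm k (path_lens E (insert x P) x t')" by auto
  show False
  proof (cases "E t' y")
    case True
    show False by (rule direct[OF _ True _ t'(3)]) (use t'(1) Pn in auto)
  next
    case False
    then have "E t' b" using t' by auto
    have "adm k (path_lens E (insert b (insert x P)) x b)"
      by (rule adm_shift[OF t'(3), where c = 1]) (use path_lens_snoc[of _ E "insert x P" x t' b] \<open>E t' b\<close> P(2) b in auto)
    then show False by (rule direct[OF b(1,4,2)]) (use Pn b in auto)
  qed
qed

text \<open>Everything beyond \<open>b\<close> would hang on \<open>b\<close> and
  \<open>y\<close>.\<close>

lemma x_degree_one:
  assumes dok: "\<And>v. v \<in> V - {x, y} \<Longrightarrow> deg_ok E V k v" and b: "nb E (V - {y}) x = {b}"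
  shows False
proof -
  have "b \<in> nb E (V - {y}) x" using b by simp
  then have bb: "b \<in> V" "b \<noteq> x" "b \<noteq> y" "E x b" by auto
  have only: "v = b" if "v \<in> V" "E x v" "v \<noteq> y" for v
  proof -
    have "v \<in> nb E (V - {y}) x" using that by simp
    then show ?thesis using b by simp
  qed
  have "V - {x, y, b} \<noteq> {}"
  proof
    assume "V - {x, y, b} = {}"
    then have "nb E V b \<subseteq> {x, y}" by (auto simp: nb_def)
    then have "card (nb E V b) \<le> card {x, y}" by (intro card_mono) auto
    then show False using dok[of b] bb k_ge unfolding deg_ok_def by auto
  qed
  then obtain v0 where v0: "v0 \<in> V - {x, y, b}" by blast
  obtain P where P: "v0 \<in> P" "P \<subseteq> V - {x, y, b}" "conn_set E P"
      "\<And>p w. p \<in> P \<Longrightarrow> w \<in> V - {x, y, b} \<Longrightarrow> E p w \<Longrightarrow> w \<in> P"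
    using component[OF sym v0] by metis
  have clP: "v \<in> P \<union> {b, y}" if "p \<in> P" "v \<in> V" "E p v" for p v
  proof -
    have "v \<noteq> x" using only[of p] that P(2) E_sym by auto
    then show ?thesis using P(4) that by blast
  qed
  show False
    by (rule reduce_y[OF _ _ bb(1-3) _ clP]) (use P(1,2) dok in auto)
qed

end

section \<open>The region beyond a structure\<close>

context minimal_unlinked
begin

text \<open>If a component of \<open>R\<close> touches both the target \<open>t\<close> and
  \<open>U\<close>, then \<open>structure_step\<close> applies to it, unless some part of it is
  attached only to one vertex \<open>c\<close> and to \<open>Q - U\<close>. If there is no such
  component, the component of \<open>p0\<close> is itself such a part, with \<open>c = t\<close>.
  All these parts are passed to \<open>hang\<close>, with a way from \<open>c\<close> to
  \<open>y\<close> that avoids them. For \<open>c = y\<close>, the set \<open>W\<close> also records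
  where the neighbours of \<open>y\<close> in \<open>R\<close> are.\<close>

lemma region_step:
  assumes Q: "Q \<subseteq> V - {y}" "x \<in> Q" "U \<subseteq> Q" "x \<notin> U"
    and R: "R \<subseteq> V - Q - {y}" "t \<notin> R" "t \<in> V - Q" and p0: "p0 \<in> R" "E p0 t"
    and cl: "\<And>p v. p \<in> R \<Longrightarrow> v \<in> V \<Longrightarrow> E p v \<Longrightarrow> v \<in> R \<union> {t} \<union> Q"
    and dok: "\<And>p. p \<in> R \<Longrightarrow> deg_ok E V k p"
    and loss: "\<And>p. p \<in> R \<Longrightarrow> card (nb E Q p) \<le> l + (if \<exists>u\<in>U. E p u then 1 else 0)"
    and mode: "s = 1 \<and> 1 \<le> l \<or> s = 2"
    and L: "\<And>u j. u \<in> U \<Longrightarrow> j \<le> l \<Longrightarrow> b + s * j \<in> path_lens E Q x u"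
    and tail: "t \<noteq> y \<Longrightarrow> \<exists>r S. r \<in> path_lens E S t y \<and> S \<subseteq> V - Q - R"
    and hang: "\<And>D c. D \<noteq> {} \<Longrightarrow> D \<subseteq> R \<Longrightarrow> conn_set E D \<Longrightarrow> c \<in> V - Q - D \<Longrightarrow>
        (\<And>d v. d \<in> D \<Longrightarrow> v \<in> V \<Longrightarrow> E d v \<Longrightarrow> v \<in> D \<union> {c} \<union> (Q - U)) \<Longrightarrow> \<exists>d\<in>D. E d c \<Longrightarrow>
        (c \<noteq> y \<Longrightarrow> \<exists>r S. r \<in> path_lens E S c y \<and> S \<subseteq> V - Q - D) \<Longrightarrow>
        (c = y \<Longrightarrow> t = y \<and> (\<exists>W. D \<subseteq> W \<and> W \<subseteq> R \<and> (\<forall>w\<in>W. \<forall>v\<in>V. E w v \<longrightarrow> v \<in> W \<union> {y} \<union> (Q - U)) \<and>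
           (\<forall>v\<in>R - W. \<not> E v y))) \<Longrightarrow> False"
  shows False
proof (cases "\<exists>P. P \<noteq> {} \<and> P \<subseteq> R \<and> conn_set E P \<and> (\<forall>p\<in>P. \<forall>w\<in>R. E p w \<longrightarrow> w \<in> P) \<and> (\<exists>p\<in>P. E p t) \<and> (\<exists>p\<in>P. \<exists>u\<in>U. E p u)")
  case True
  then obtain P where P: "P \<noteq> {}" "P \<subseteq> R" "conn_set E P" "\<forall>p\<in>P. \<forall>w\<in>R. E p w \<longrightarrow> w \<in> P"
    and at: "\<exists>p\<in>P. E p t" and aU: "\<exists>p\<in>P. \<exists>u\<in>U. E p u" by blast
  have clP: "v \<in> P \<union> {t} \<union> Q" if "p \<in> P" "v \<in> V" "E p v" for p v
    using cl[of p v] that P(2,4) by blast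
  have PV: "P \<subseteq> V" "P \<inter> Q = {}" "t \<notin> P" "t \<in> V" "t \<notin> Q" "Q \<subseteq> V" using P(2) R Q by auto
  have "\<exists>t'\<in>P. E t' t \<and> adm k (path_lens E (Q \<union> P) x t')"
  proof (rule structure_step[OF PV(6) Q(2-4) PV(1) P(1,3) PV(2,4,3,5) at aU clP])
    show False if D: "D \<noteq> {}" "D \<subseteq> P" "c \<in> P - D"
      and clD: "\<And>d v. d \<in> D \<Longrightarrow> v \<in> V \<Longrightarrow> E d v \<Longrightarrow> v \<in> D \<union> {c} \<union> (Q - U)" for D c
    proof -
      obtain d0 where d0: "d0 \<in> D" using D by auto
      obtain D1 where D1: "d0 \<in> D1" "D1 \<subseteq> D" "conn_set E D1" "\<And>p w. p \<in> D1 \<Longrightarrow> w \<in> D \<Longrightarrow> E p w \<Longrightarrow> w \<in> D1"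
        using component[OF sym d0] by metis
      have cl1: "v \<in> D1 \<union> {c} \<union> (Q - U)" if "d \<in> D1" "v \<in> V" "E d v" for d v
        using clD[of d v] D1(2) D1(4)[of d v] that by blast
      have D1P: "D1 \<noteq> {}" "D1 \<subseteq> P" "c \<notin> D1" "D1 \<subset> P" using D1(1,2) D by auto
      obtain d e where de: "d \<in> D1" "e \<in> P - D1" "E d e"
        using P(3) D1P(1,4) unfolding conn_set_def by blast
      have "e = c" using cl1[of d e] de PV by auto
      then have ac: "\<exists>d\<in>D1. E d c" using de by blast
      define S0 where "S0 = insert t P - D1"
      have cS: "c \<in> S0" using D D1P unfolding S0_def by auto
      obtain K where K: "c \<in> K" "K \<subseteq> S0" "conn_set E K" "\<And>p w. p \<in> K \<Longrightarrow> w \<in> S0 \<Longrightarrow> E p w \<Longrightarrow> w \<in> K"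
        using component[OF sym cS] by metis
      \<comment> \<open>Otherwise no edge would lead from \<open>K \<union> D1\<close> to the rest
        of \<open>insert t P\<close>, although \<open>P\<close> is connected and has an edge to
        \<open>t\<close>.\<close>
      have tK: "t \<in> K"
      proof (rule ccontr)
        assume tK: "t \<notin> K"
        have KP: "K \<union> D1 \<subseteq> P" "K \<union> D1 \<noteq> {}" using K(1,2) tK D1P unfolding S0_def by auto
        have inK: "v \<in> K \<union> D1" if "d \<in> K \<union> D1" "v \<in> insert t P" "E d v" for d v
        proof (cases "d \<in> D1")
          case True
          then have "v \<in> D1 \<union> {c} \<union> (Q - U)" using cl1[of d v] that PV by auto
          then show ?thesis using K(1) that PV by auto
        next
          case False
          then show ?thesis using K(4)[of d v] that unfolding S0_def by blast
        qed
        show False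
        proof (cases "K \<union> D1 = P")
          case True
          then show False using at inK[of _ t] tK D1P PV by blast
        next
          case False
          then obtain d e where "d \<in> K \<union> D1" "e \<in> P - (K \<union> D1)" "E d e"
            using P(3) KP unfolding conn_set_def by blast
          then show False using inK[of d e] by blast
        qed
      qed
      obtain n where n: "n \<in> path_lens E K c t" using conn_set_path[OF K(3,1) tK] .
      have KV: "K \<subseteq> V - Q - D1" "K \<subseteq> insert t R" using K(2) PV P(2) unfolding S0_def by auto
      show False
      proof (rule hang[OF D1P(1) _ D1(3) _ cl1 ac])
        show "\<exists>r S. r \<in> path_lens E S c y \<and> S \<subseteq> V - Q - D1"
        proof (cases "t = y")
          case True then show ?thesis using n KV by blast
        next
          case False
          obtain r S where rS: "r \<in> path_lens E S t y" "S \<subseteq> V - Q - R" using tail[OF False] by blast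
          have "n + r \<in> path_lens E (K \<union> S) c y"
            by (rule path_lens_join[OF n rS(1)]) (use rS(2) KV in auto)
          moreover have "K \<union> S \<subseteq> V - Q - D1" using rS(2) KV P(2) D1P by auto
          ultimately show ?thesis by blast
        qed
        show "t = y \<and> (\<exists>W. D1 \<subseteq> W \<and> W \<subseteq> R \<and> (\<forall>w\<in>W. \<forall>v\<in>V. E w v \<longrightarrow> v \<in> W \<union> {y} \<union> (Q - U)) \<and> (\<forall>v\<in>R - W. \<not> E v y))"
          if "c = y" using that D P(2) R by auto
      qed (use D1P D P(2) PV in auto)
    qed
    show "deg_ok E V k p" if "p \<in> P" for p using dok that P(2) by blast
    show "card (nb E Q p) \<le> l + (if \<exists>u\<in>U. E p u then 1 else 0)" if "p \<in> P" for p
      using loss that P(2) by blast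
  qed (use mode L in auto)
  then obtain t' where t': "t' \<in> P" "E t' t" "adm k (path_lens E (Q \<union> P) x t')" by blast
  show False
  proof (rule finish_at[OF t' Q(2)])
    show "\<exists>m S. m \<in> path_lens E S t y \<and> S \<subseteq> V \<and> S \<inter> (Q \<union> P) = {}" if "t \<noteq> y"
      using tail[OF that] P(2) by blast
  qed (use Q PV P(2) R in auto)
next
  case F: False
  \<comment> \<open>The union of the components of \<open>R\<close> that touch \<open>t\<close>. In
    the present case none of them touches \<open>U\<close>, and if \<open>t = y\<close> they contain
    every neighbour of \<open>y\<close> in \<open>R\<close>.\<close>
  define W where "W = {v \<in> R. \<exists>P. v \<in> P \<and> P \<subseteq> R \<and> conn_set E P \<and> (\<forall>p\<in>P. \<forall>w\<in>R. E p w \<longrightarrow> w \<in> P) \<and> (\<exists>p\<in>P. E p t)}"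
  obtain P where P: "p0 \<in> P" "P \<subseteq> R" "conn_set E P" "\<And>p w. p \<in> P \<Longrightarrow> w \<in> R \<Longrightarrow> E p w \<Longrightarrow> w \<in> P"
    using component[OF sym p0(1)] by metis
  have noU: "v \<in> P' \<union> {t} \<union> (Q - U)"
    if "P' \<subseteq> R" "conn_set E P'" "\<forall>p\<in>P'. \<forall>w\<in>R. E p w \<longrightarrow> w \<in> P'" "\<exists>p\<in>P'. E p t" "p \<in> P'" "v \<in> V" "E p v" for P' p v
  proof -
    have "v \<in> R \<union> {t} \<union> Q" using cl[of p v] that by blast
    moreover have "v \<notin> U" using F that by blast
    ultimately show ?thesis using that by blast
  qed
  have P4: "\<forall>p\<in>P. \<forall>w\<in>R. E p w \<longrightarrow> w \<in> P" using P(4) by blast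
  show False
  proof (rule hang[of P t])
    show "v \<in> P \<union> {t} \<union> (Q - U)" if "d \<in> P" "v \<in> V" "E d v" for d v
      using noU[OF P(2,3) P4 _ that] p0 P(1) by blast
    show "\<exists>r S. r \<in> path_lens E S t y \<and> S \<subseteq> V - Q - P" if "t \<noteq> y" using tail[OF that] P(2) by blast
    show "t = y \<and> (\<exists>W. P \<subseteq> W \<and> W \<subseteq> R \<and> (\<forall>w\<in>W. \<forall>v\<in>V. E w v \<longrightarrow> v \<in> W \<union> {y} \<union> (Q - U)) \<and> (\<forall>v\<in>R - W. \<not> E v y))"
      if ty: "t = y"
    proof (intro exI[of _ W] conjI ballI impI)
      show "t = y" by (rule ty)
      show "P \<subseteq> W" using P(1-3) P4 p0 unfolding W_def by blast
      show "W \<subseteq> R" unfolding W_def by blast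
      show "v \<in> W \<union> {y} \<union> (Q - U)" if w: "w \<in> W" "v \<in> V" "E w v" for w v
      proof -
        obtain P' where P': "w \<in> P'" "P' \<subseteq> R" "conn_set E P'" "\<forall>p\<in>P'. \<forall>w\<in>R. E p w \<longrightarrow> w \<in> P'" "\<exists>p\<in>P'. E p t"
          using w(1) unfolding W_def by blast
        have "v \<in> P' \<union> {t} \<union> (Q - U)" by (rule noU[OF P'(2-5,1) w(2,3)])
        moreover have "P' \<subseteq> W" using P' unfolding W_def by blast
        ultimately show ?thesis using ty by blast
      qed
      show "\<not> E v y" if v: "v \<in> R - W" for v
      proof
        assume "E v y"
        have vR: "v \<in> R" using v by blast
        obtain P' where P': "v \<in> P'" "P' \<subseteq> R" "conn_set E P'" "\<And>p w. p \<in> P' \<Longrightarrow> w \<in> R \<Longrightarrow> E p w \<Longrightarrow> w \<in> P'"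
          using component[OF sym vR] by metis
        then have "v \<in> W" using \<open>E v y\<close> ty vR unfolding W_def by blast
        then show False using v by blast
      qed
    qed
  qed (use P(1-3) p0 R in auto)
qed

end

subsection \<open>Cliques at the root\<close>

definition clique :: "('a \<Rightarrow> 'a \<Rightarrow> bool) \<Rightarrow> 'a set \<Rightarrow> bool" where
  "clique E Q \<longleftrightarrow> (\<forall>a\<in>Q. \<forall>b\<in>Q. a \<noteq> b \<longrightarrow> E a b)"

lemma clique_successively: "clique E Q \<Longrightarrow> distinct xs \<Longrightarrow> set xs \<subseteq> Q \<Longrightarrow> successively E xs"
proof (induction xs)
  case (Cons v xs)
  then show ?case by (cases xs) (auto simp: clique_def)
qed simp

lemma obtain_distinct_list:
  assumes "n \<le> card A"
  obtains xs where "distinct xs" "set xs \<subseteq> A" "length xs = n"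
proof -
  obtain B where B: "B \<subseteq> A" "card B = n" "finite B"
    using obtain_subset_with_card_n[OF assms] by metis
  obtain xs where "set xs = B" "distinct xs" using finite_distinct_list[OF B(3)] by blast
  then show ?thesis using that[of xs] B distinct_card by fastforce
qed

lemma clique_lens:
  assumes "clique E Q" "finite Q" "x \<in> Q" "u \<in> Q" "u \<noteq> x" "1 \<le> n" "n < card Q"
  shows "n \<in> path_lens E Q x u"
proof -
  have "card (Q - {x, u}) = card Q - 2" using assms by (subst card_Diff_subset) auto
  then have "n - 1 \<le> card (Q - {x, u})" using assms by simp
  then obtain xs where xs: "distinct xs" "set xs \<subseteq> Q - {x, u}" "length xs = n - 1"
    by (rule obtain_distinct_list)
  have "gpath E Q (x # xs @ [u])"
    unfolding gpath_def using xs assms clique_successively[OF assms(1), of "x # xs @ [u]"] by auto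
  from path_lensI[OF this, of n] show ?thesis using xs(3) assms(6) by simp
qed

context minimal_unlinked
begin

text \<open>The structure is a maximal clique at \<open>x\<close> that leaves a neighbour of
  \<open>y\<close> outside. A vertex that misses some vertex of \<open>Q\<close> has at most
  \<open>card Q - 1\<close> neighbours there; losing all but one of them is made up for by the path
  lengths 1 to \<open>card Q - 1\<close> in the clique. The degree hypothesis spares
  \<open>Q0\<close> because in \<open>small_target_triangle\<close> those vertices may lack a
  degree.\<close>

lemma clique_case:
  assumes Q0: "Q0 \<subseteq> V - {y}" "x \<in> Q0" "clique E Q0" "3 \<le> card Q0" and z: "z \<in> V - Q0" "E z y"
    and dok: "\<And>v. v \<in> V - Q0 - {y} \<Longrightarrow> deg_ok E V k v"
  shows False
proof -
  define F where "F = {Q. Q0 \<subseteq> Q \<and> Q \<subseteq> V - {y} \<and> clique E Q \<and> (\<exists>z\<in>V - Q. E z y)}"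
  have "finite F" by (rule finite_subset[of _ "Pow V"]) (auto simp: F_def)
  moreover have "Q0 \<in> F" using Q0 z unfolding F_def by blast
  ultimately obtain Q where QF: "Q \<in> F" and max: "\<forall>Q'\<in>F. Q \<subseteq> Q' \<longrightarrow> Q = Q'"
    using finite_has_maximal2[of F Q0] by blast
  have Q: "Q0 \<subseteq> Q" "Q \<subseteq> V - {y}" "clique E Q" "\<exists>z\<in>V - Q. E z y" using QF unfolding F_def by auto
  have finQ: "finite Q" using Q(2) finite_subset[OF _ finV] by blast
  have m3: "3 \<le> card Q" using Q0(4) card_mono[OF finQ Q(1)] by simp
  have xQ: "x \<in> Q" using Q0 Q by auto
  define U where "U = Q - {x}"
  have "card U = card Q - 1" unfolding U_def using xQ finQ by simp
  then obtain u0 where u0: "u0 \<in> U" using m3 by (cases "U = {}") auto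
  \<comment> \<open>By maximality, a vertex complete to \<open>Q\<close> stays outside only if
    adding it would swallow every neighbour of \<open>y\<close>.\<close>
  have bad: "z \<in> insert w Q" if "w \<in> V - Q - {y}" "\<forall>q\<in>Q. E w q" "z \<in> V" "E z y" for w z
  proof (rule ccontr)
    assume "z \<notin> insert w Q"
    moreover have "clique E (insert w Q)" using that(2) Q(3) E_sym unfolding clique_def by blast
    ultimately have "insert w Q \<in> F" using that Q unfolding F_def by blast
    then show False using max that(1) by blast
  qed
  \<comment> \<open>Used with target \<open>t = y\<close> if no outside vertex is complete to
    \<open>Q\<close>, and with \<open>t = w\<close> and the tail \<open>w y\<close> if
    \<open>w\<close> is such a vertex.\<close>
  have main: False
    if t: "t \<in> V - Q" "t = y \<or> E t y" and p0: "p0 \<in> V - Q - {y, t}" "E p0 t"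
      and ny: "t = y \<or> (\<forall>p\<in>V - Q - {y, t}. \<not> E p y)"
      and nb: "\<forall>p\<in>V - Q - {y, t}. \<exists>q\<in>Q. \<not> E p q" for t p0
  proof (rule region_step[where R = "V - Q - {y, t}" and Q = Q and U = U and t = t and ?p0.0 = p0 and l = "card Q - 2" and s = 1 and b = 1])
    show "v \<in> V - Q - {y, t} \<union> {t} \<union> Q" if "p \<in> V - Q - {y, t}" "v \<in> V" "E p v" for p v
      using that ny by auto
    show "deg_ok E V k p" if "p \<in> V - Q - {y, t}" for p using dok that Q(1) by blast
    show "card (nb E Q p) \<le> card Q - 2 + (if \<exists>u\<in>U. E p u then 1 else 0)" if p: "p \<in> V - Q - {y, t}" for p
    proof (cases "\<exists>u\<in>U. E p u")
      case True
      obtain q where "q \<in> Q" "\<not> E p q" using nb p by blast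
      then have "nb E Q p \<subseteq> Q - {q}" by (auto simp: nb_def)
      then have "card (nb E Q p) \<le> card (Q - {q})" by (rule card_mono[rotated]) (use finQ in auto)
      then show ?thesis using True \<open>q \<in> Q\<close> finQ m3 by simp
    next
      case False
      then have "nb E Q p \<subseteq> {x}" unfolding U_def by (auto simp: nb_def)
      then have "card (nb E Q p) \<le> card {x}" by (rule card_mono[rotated]) auto
      then show ?thesis using m3 False by simp
    qed
    show "1 + 1 * j \<in> path_lens E Q x u" if "u \<in> U" "j \<le> card Q - 2" for u j
      by (rule clique_lens[OF Q(3) finQ xQ]) (use that m3 in \<open>auto simp: U_def\<close>)
    show "\<exists>r S. r \<in> path_lens E S t y \<and> S \<subseteq> V - Q - (V - Q - {y, t})" if ty: "t \<noteq> y"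
    proof -
      have "E t y" using t ty by auto
      then have "1 \<in> path_lens E {t, y} t y"
        using path_lensI[of E "{t, y}" "[t, y]" 1] ty by (simp add: gpath_def)
      then show ?thesis using t Q(2) by (intro exI[of _ 1] exI[of _ "{t, y}"]) auto
    qed
    show False if D: "D \<noteq> {}" "D \<subseteq> V - Q - {y, t}" "c \<in> V - Q - D"
      and clD: "\<And>d v. d \<in> D \<Longrightarrow> v \<in> V \<Longrightarrow> E d v \<Longrightarrow> v \<in> D \<union> {c} \<union> (Q - U)" for D c
    proof (rule reduce_x[of D c])
      show "v \<in> D \<union> {x, c}" if "d \<in> D" "v \<in> V" "E d v" for d v
        using clD[OF that] unfolding U_def by auto
      show "deg_ok E V k d" if "d \<in> D" for d using dok that D Q(1) by blast
      show "u0 \<in> V - D - {x, c}" using u0 D Q(2) unfolding U_def by auto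
    qed (use D xQ in auto)
  qed (use Q xQ t p0 m3 in \<open>auto simp: U_def\<close>)
  show False
  proof (cases "\<exists>w\<in>V - Q - {y}. \<forall>q\<in>Q. E w q")
    case False
    obtain z where "z \<in> V - Q" "E z y" using Q(4) by blast
    moreover have "z \<noteq> y" using \<open>E z y\<close> by auto
    ultimately show False using main[of y z] False Q(2) by auto
  next
    case True
    then obtain w where w: "w \<in> V - Q - {y}" "\<forall>q\<in>Q. E w q" by blast
    have wy: "E w y" using bad[OF w] Q(4) by blast
    show False
    proof (cases "\<exists>p\<in>V - Q - {y, w}. E p w")
      case True
      then obtain p where p: "p \<in> V - Q - {y, w}" "E p w" by blast
      show False
      proof (rule main[of w p])
        show "w = y \<or> (\<forall>p\<in>V - Q - {y, w}. \<not> E p y)" using bad[OF w] by auto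
        show "\<forall>p\<in>V - Q - {y, w}. \<exists>q\<in>Q. \<not> E p q"
          using bad[OF _ _ _ wy] w(1) by auto
      qed (use w wy p in auto)
    next
      case False
      \<comment> \<open>All neighbours of \<open>w\<close> lie in \<open>Q\<close> or equal
        \<open>y\<close>, so its degree makes the clique \<open>insert w Q\<close> large enough to
        supply all \<open>k\<close> lengths.\<close>
      have "nb E V w \<subseteq> insert y Q"
      proof
        fix v assume "v \<in> nb E V w"
        then have "v \<in> V" "E v w" "v \<noteq> w" using E_sym by auto
        then show "v \<in> insert y Q" using False by blast
      qed
      then have "card (nb E V w) \<le> card (insert y Q)" by (rule card_mono[rotated]) (use finQ in auto)
      also have "\<dots> \<le> card Q + 1" using finQ by (simp add: card_insert_if)
      finally have "card (nb E V w) \<le> card Q + 1" .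
      moreover have "w \<in> V - Q0 - {y}" using w(1) Q(1) by blast
      ultimately have kQ: "k \<le> card Q" using dok[of w] k_ge unfolding deg_ok_def by auto
      have cl: "clique E (insert w Q)" using w(2) Q(3) E_sym unfolding clique_def by blast
      have "1 + 1 * i \<in> path_lens E (insert w Q) x w" if "i < k" for i
        by (rule clique_lens[OF cl]) (use finQ xQ w that kQ in auto)
      then have "adm k (path_lens E (insert w Q) x w)" unfolding adm_def by blast
      then show False by (rule direct[rotated 3]) (use w wy xQ Q(2) in auto)
    qed
  qed
qed

text \<open>By \<open>clique_case\<close>, any triangle at \<open>x\<close> avoiding
  \<open>y\<close> contains all neighbours of \<open>y\<close> other than \<open>x\<close>; so it
  consists of \<open>x\<close> and the two ends \<open>u\<close>, \<open>v\<close> of the edge from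
  \<open>y_triangle\<close>. Hence no further vertex sees both \<open>x\<close> and
  \<open>v\<close>, and these two are merged without loss. The paths start at \<open>u\<close> and
  are reversed.\<close>

lemma x_triangle:
  assumes dok: "\<And>v. v \<in> V - {x, y} \<Longrightarrow> deg_ok E V k v"
    and ab: "a \<in> V - {y}" "b \<in> V - {y}" "E x a" "E x b" "E a b"
  shows False
proof -
  have all: "z \<in> {a, b}" if "a \<in> V - {y}" "b \<in> V - {y}" "E x a" "E x b" "E a b" "z \<in> V - {x}" "E z y" for a b z
  proof (rule ccontr)
    assume "z \<notin> {a, b}"
    moreover have "x \<noteq> a" "x \<noteq> b" "a \<noteq> b" using that(3-5) by auto
    moreover from this have "card {x, a, b} = 3" by simp
    ultimately show False
      using clique_case[of "{x, a, b}" z] that dok E_sym by (auto simp: clique_def)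
  qed
  obtain u v where uv: "u \<in> V - {x}" "v \<in> V - {x}" "E u y" "E v y" "E u v" using y_triangle[OF dok] by blast
  have uvab: "{u, v} = {a, b}" using all[OF ab uv(1,3)] all[OF ab uv(2,4)] uv(5) by auto
  have xuv: "E x u" "E x v" "u \<noteq> v" "u \<noteq> y" "v \<noteq> y" using uvab ab uv by (auto simp: doubleton_eq_iff)
  have ny: "z \<in> {u, v}" if "z \<in> V - {x}" "E z y" for z using all[OF ab that] uvab by auto
  have no: "\<not> (E p x \<and> E p v)" if "p \<in> V - {x, y, u, v}" for p
    using all[of p v u] that uv xuv E_sym by auto
  show False
  proof (cases "V - {x, y, u, v} = {}")
    case True
    then have "nb E V u \<subseteq> {x, y, v}" by (auto simp: nb_def)
    then have "card (nb E V u) \<le> card {x, y, v}" by (rule card_mono[rotated]) auto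
    also have "\<dots> \<le> 3" by (simp add: card_insert_if)
    finally have "k \<le> 2" using dok[of u] uv xuv k_ge unfolding deg_ok_def by auto
    have cl: "clique E {x, u, v}" using xuv uv E_sym unfolding clique_def by auto
    have c3: "card {x, u, v} = 3" using xuv uv by auto
    have "1 + 1 * i \<in> path_lens E {x, u, v} x u" if "i < k" for i
      by (rule clique_lens[OF cl]) (use c3 that \<open>k \<le> 2\<close> uv in auto)
    then have "adm k (path_lens E {x, u, v} x u)" unfolding adm_def by blast
    then show False by (rule direct[rotated 3]) (use uv xuv in auto)
  next
    case False
    then obtain v0 where v0: "v0 \<in> V - {x, y, u, v}" by blast
    obtain P where P: "v0 \<in> P" "P \<subseteq> V - {x, y, u, v}" "conn_set E P"
      "\<And>p w. p \<in> P \<Longrightarrow> w \<in> V - {x, y, u, v} \<Longrightarrow> E p w \<Longrightarrow> w \<in> P"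
      using component[OF sym v0] by metis
    have clP: "w \<in> P \<union> {u, x, v}" if "p \<in> P" "w \<in> V" "E p w" for p w
    proof -
      have "w \<noteq> y" using ny[of p] that P(2) by auto
      then show ?thesis using P(4)[of p w] that by blast
    qed
    have Pn: "P \<noteq> {}" "P \<subseteq> V - {x, y}" "P \<subseteq> V" "finite P" using P(1,2) finite_subset[of P V] by auto
    have au: "\<exists>p\<in>P. E p u"
    proof (rule ccontr)
      assume nou: "\<not> (\<exists>p\<in>P. E p u)"
      have cl': "w \<in> P \<union> {x, v}" if "p \<in> P" "w \<in> V" "E p w" for p w using clP[OF that] nou that by auto
      show False by (rule reduce_x[OF Pn(1,2) _ _ _ cl', where ?v0.0 = u]) (use P(2) dok uv xuv in auto)
    qed
    have ax: "\<exists>p\<in>P. \<exists>t\<in>{x, v}. E p t" using rootedD[OF Pn(1,2), of u] clP by blast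
    have card: "card P + 2 < card V" by (rule card_plus3[of _ x u v]) (use Pn P(2) uv xuv in auto)
    have "\<exists>t'\<in>P. (\<exists>t\<in>{x, v}. E t' t) \<and> adm k (\<Union>u\<in>{u}. path_lens E (insert u P) u t')"
    proof (rule contract[OF Pn(3,1) P(3) card])
      show "\<exists>d\<in>D'. \<exists>w\<in>P \<union> {u} \<union> {x, v} - D' - {c'}. E d w"
        if "D' \<noteq> {}" "D' \<subseteq> P" "c' \<in> P - D'" for D' c'
        using rootedD[of D' c'] that Pn(2) clP by blast
      show "k \<le> 1 \<or> k + 1 \<le> card (nb E P p) + (if \<exists>u\<in>{u}. E p u then 1 else 0) + (if \<exists>t\<in>{x, v}. E p t then 1 else 0)"
        if p: "p \<in> P" for p
      proof -
        have "nb E V p \<subseteq> P \<union> {u, x, v}" using clP[OF p] by (auto simp: nb_def)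
        from card_nb_three_le[OF this Pn(4)]
        have "card (nb E V p) \<le> card (nb E P p) + (if E p u then 1 else 0) + (if E p x then 1 else 0) + (if E p v then 1 else 0)" .
        moreover have "\<not> (E p x \<and> E p v)" using no[of p] p P(2) by auto
        moreover have "deg_ok E V k p" using dok p Pn(2) by auto
        ultimately show ?thesis unfolding deg_ok_def by (auto split: if_splits)
      qed
    qed (use au ax P(2) uv xuv in auto)
    then obtain w where w: "w \<in> P" "E w x \<or> E w v" "adm k (path_lens E (insert u P) u w)" by auto
    have PV: "P \<subseteq> V - {x, y, u, v}" by (rule P(2))
    show False
    proof (cases "E w x")
      case True
      have "Suc n \<in> path_lens E (insert x (insert u P)) x u" if "n \<in> path_lens E (insert u P) u w" for n
        by (rule path_lens_Cons[of _ _ _ w]) (use path_lens_rev[OF sym that] True E_sym PV uv in auto)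
      then have "adm k (path_lens E (insert x (insert u P)) x u)"
        by (intro adm_shift[OF w(3), where c = 1]) auto
      then show False by (rule direct[rotated 3]) (use uv xuv PV in auto)
    next
      case False
      then have wv: "E v w" using w E_sym by auto
      have "n + 2 \<in> path_lens E (insert x (insert v (insert u P))) x u" if n: "n \<in> path_lens E (insert u P) u w" for n
      proof -
        have "Suc n \<in> path_lens E (insert v (insert u P)) v u"
          by (rule path_lens_Cons[of _ _ _ w]) (use path_lens_rev[OF sym n] wv PV xuv in auto)
        then have "Suc (Suc n) \<in> path_lens E (insert x (insert v (insert u P))) x u"
          by (rule path_lens_Cons) (use xuv PV uv in auto)
        then show ?thesis by simp
      qed
      then have "adm k (path_lens E (insert x (insert v (insert u P))) x u)"
        by (rule adm_shift[OF w(3)])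
      then show False by (rule direct[rotated 3]) (use uv xuv PV in auto)
    qed
  qed
qed

end

subsection \<open>Books near the root\<close>

lemma set_splice: "set (splice xs ys) = set xs \<union> set ys"
  by (induction xs ys rule: splice.induct) auto

lemma distinct_splice: "distinct xs \<Longrightarrow> distinct ys \<Longrightarrow> set xs \<inter> set ys = {} \<Longrightarrow> distinct (splice xs ys)"
  by (induction xs ys rule: splice.induct) (auto simp: set_splice)

lemma last_splice: "length bs \<le> length cs \<Longrightarrow> cs \<noteq> [] \<Longrightarrow> last (splice bs cs) = last cs"
proof (induction bs arbitrary: cs)
  case (Cons b bs)
  then obtain c cs' where cs: "cs = c # cs'" by (cases cs) auto
  then show ?case using Cons by (cases "cs' = []") auto
qed simp

text \<open>\<open>splice\<close> alternates between the lists and then appends what is left of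
  \<open>cs\<close>; only that remainder uses edges inside \<open>C\<close>.\<close>

lemma successively_splice:
  assumes "length bs \<le> length cs" "length bs = length cs \<or> clique E C" "distinct cs"
    "set cs \<subseteq> C" "set bs \<subseteq> B" "\<forall>b\<in>B. \<forall>c\<in>C. E b c \<and> E c b"
  shows "successively E (splice bs cs)"
  using assms
proof (induction bs arbitrary: cs)
  case Nil
  then show ?case using clique_successively[of E C cs] by (cases cs) auto
next
  case (Cons b bs)
  then obtain c cs' where cs: "cs = c # cs'" by (cases cs) auto
  have "successively E (splice bs cs')" using Cons cs by auto
  moreover have "E c (hd (splice bs cs'))" if "splice bs cs' \<noteq> []"
  proof (cases bs)
    case Nil
    then have "cs' \<noteq> []" using that by auto
    then have "clique E C" "hd cs' \<in> C" "c \<in> C" "c \<noteq> hd cs'" using Cons.prems cs Nil by (cases cs'; auto)+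
    then show ?thesis using Nil by (auto simp: clique_def)
  next
    case C2: (Cons b' bs')
    then show ?thesis using Cons.prems cs by auto
  qed
  ultimately show ?case using Cons.prems cs by (auto simp: successively_Cons)
qed

lemma alternating_lens:
  assumes "finite B" "finite C" "B \<inter> C = {}" "x \<notin> B \<union> C" "\<forall>b\<in>B. E x b" "\<forall>b\<in>B. \<forall>c\<in>C. E b c \<and> E c b"
    "1 \<le> p" "p \<le> card B" "p \<le> r" "r \<le> card C" "c \<in> C" "p = r \<or> clique E C"
  shows "p + r \<in> path_lens E (insert x (B \<union> C)) x c"
proof -
  obtain bs where bs: "distinct bs" "set bs \<subseteq> B" "length bs = p"
    using obtain_distinct_list[OF assms(8)] by blast
  have "r - 1 \<le> card (C - {c})" using assms by simp
  then obtain cs' where cs': "distinct cs'" "set cs' \<subseteq> C - {c}" "length cs' = r - 1"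
    by (rule obtain_distinct_list)
  define cs where "cs = cs' @ [c]"
  have cs: "distinct cs" "set cs \<subseteq> C" "length cs = r" "last cs = c" "cs \<noteq> []"
    using cs' assms unfolding cs_def by auto
  have "successively E (splice bs cs)"
    by (rule successively_splice[of _ _ _ C B]) (use assms bs cs in auto)
  moreover have "distinct (splice bs cs)"
    using bs cs assms(3) by (intro distinct_splice) auto
  moreover have "splice bs cs \<noteq> []" "hd (splice bs cs) \<in> B"
    using bs assms(7) by (cases bs; auto)+
  ultimately have "gpath E (insert x (B \<union> C)) (x # splice bs cs)"
    unfolding gpath_def using bs cs assms by (auto simp: successively_Cons set_splice)
  from path_lensI[OF this, of "p + r"] show ?thesis
    using bs cs assms last_splice[of bs cs] \<open>splice bs cs \<noteq> []\<close> by simp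
qed

text \<open>The path alternates between \<open>B\<close> and \<open>C\<close> as long as
  \<open>B\<close> and the length permit, using \<open>min (card B) (n div 2)\<close> vertices of
  \<open>B\<close>, and then continues inside the clique.\<close>

lemma book_lens:
  assumes "finite B" "finite C" "B \<inter> C = {}" "x \<notin> B \<union> C" "\<forall>b\<in>B. E x b" "\<forall>b\<in>B. \<forall>c\<in>C. E b c \<and> E c b"
    "clique E C" "B \<noteq> {}" "card B \<le> card C" "c \<in> C" "2 \<le> n" "n \<le> card B + card C"
  shows "n \<in> path_lens E (insert x (B \<union> C)) x c"
proof -
  define p where "p = min (card B) (n div 2)"
  have "1 \<le> card B" using assms by (simp add: Suc_leI card_gt_0_iff)
  then have "1 \<le> p" "p \<le> card B" "p \<le> n - p" "n - p \<le> card C" "p + (n - p) = n"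
    using assms unfolding p_def by (auto simp: min_def)
  then show ?thesis using alternating_lens[OF assms(1-6), of p "n - p" c] assms by auto
qed

context minimal_unlinked
begin

text \<open>The vertices \<open>x\<close>, \<open>a\<close>, \<open>y\<close> separate
  \<open>D\<close> from \<open>Z\<close>. Ignoring \<open>y\<close> on the side of \<open>Z\<close>
  and \<open>x\<close> on the side of \<open>D\<close> costs one degree on each side, so
  \<open>k - 1\<close> lengths lead from \<open>x\<close> to \<open>a\<close> and
  \<open>k - 1\<close> from \<open>a\<close> to a common neighbour of \<open>y\<close>. Their sums
  give \<open>2 * (k - 1) - 1\<close> lengths, which is enough from \<open>k = 3\<close> on.\<close>

lemma three_cut:
  assumes dok: "\<And>v. v \<in> V - {x, y} \<Longrightarrow> deg_ok E V k v" and a: "a \<in> V" "a \<noteq> x" "a \<noteq> y"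
    and D: "D \<noteq> {}" "D \<subseteq> V - {x, y, a}" "conn_set E D"
      "\<And>d v. d \<in> D \<Longrightarrow> v \<in> V \<Longrightarrow> E d v \<Longrightarrow> v \<in> D \<union> {x, a, y}"
    and Z: "Z \<noteq> {}" "Z \<subseteq> V - {x, y, a} - D"
      "\<And>d v. d \<in> Z \<Longrightarrow> v \<in> V \<Longrightarrow> E d v \<Longrightarrow> v \<in> Z \<union> {x, a, y}"
    and k: "3 \<le> k"
  shows False
proof -
  obtain z0 where z0: "z0 \<in> Z" using Z by auto
  obtain P where P: "z0 \<in> P" "P \<subseteq> Z" "conn_set E P" "\<And>p w. p \<in> P \<Longrightarrow> w \<in> Z \<Longrightarrow> E p w \<Longrightarrow> w \<in> P"
    using component[OF sym z0] by metis
  have clP: "v \<in> P \<union> {x, a, y}" if "p \<in> P" "v \<in> V" "E p v" for p v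
    using Z(3)[of p v] P(2,4) that by blast
  have Pn: "P \<noteq> {}" "P \<subseteq> V - {x, y}" "P \<subseteq> V" "finite P" "a \<notin> P" using P(1,2) Z(2) finite_subset[of P V] by auto
  have px: "\<exists>p\<in>P. \<exists>u\<in>{x}. E p u"
  proof (rule ccontr)
    assume no: "\<not> ?thesis"
    have cl': "v \<in> P \<union> {a, y}" if "p \<in> P" "v \<in> V" "E p v" for p v using clP[OF that] no that by auto
    show False by (rule reduce_y[OF Pn(1,2) a Pn(5) cl']) (use Pn dok in auto)
  qed
  have pa: "\<exists>p\<in>P. \<exists>t\<in>{a}. E p t"
  proof (rule ccontr)
    assume no: "\<not> ?thesis"
    have cl': "v \<in> P \<union> {x, y}" if "p \<in> P" "v \<in> V" "E p v" for p v using clP[OF that] no that by auto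
    show False by (rule reduce_x[OF Pn(1,2) xy(2) xy(4) _ cl', where ?v0.0 = a]) (use Pn dok a in auto)
  qed
  have card: "card P + 2 < card V" by (rule card_plus3[of _ x y a]) (use Pn a in auto)
  have "\<exists>t'\<in>P. (\<exists>t\<in>{a}. E t' t) \<and> adm (k - 1) (\<Union>u\<in>{x}. path_lens E (insert u P) u t')"
  proof (rule contract[OF Pn(3,1) P(3) card])
    show "\<exists>d\<in>D'. \<exists>v\<in>P \<union> {x} \<union> {a} - D' - {c'}. E d v"
      if D': "D' \<noteq> {}" "D' \<subseteq> P" "c' \<in> P - D'" for D' c'
    proof (rule ccontr)
      assume no: "\<not> ?thesis"
      have cl': "v \<in> D' \<union> {c', y}" if "p \<in> D'" "v \<in> V" "E p v" for p v using clP[of p v] D' no that by blast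
      show False by (rule reduce_y[OF D'(1) _ _ _ _ _ cl']) (use Pn D' dok in auto)
    qed
    show "k - 1 \<le> 1 \<or> k - 1 + 1 \<le> card (nb E P p) + (if \<exists>u\<in>{x}. E p u then 1 else 0) + (if \<exists>t\<in>{a}. E p t then 1 else 0)"
      if p: "p \<in> P" for p
    proof -
      have "nb E V p \<subseteq> P \<union> {x, a, y}" using clP[OF p] by (auto simp: nb_def)
      from card_nb_three_le[OF this Pn(4)]
      have "card (nb E V p) \<le> card (nb E P p) + (if E p x then 1 else 0) + (if E p a then 1 else 0) + (if E p y then 1 else 0)" .
      moreover have "deg_ok E V k p" using dok p Pn(2) by auto
      ultimately show ?thesis using k unfolding deg_ok_def by (auto split: if_splits)
    qed
  qed (use px pa Pn a in auto)
  then obtain t1 where t1: "t1 \<in> P" "E t1 a" "adm (k - 1) (path_lens E (insert x P) x t1)" by auto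
  have F1: "adm (k - 1) (path_lens E (insert a (insert x P)) x a)"
    by (rule adm_shift[OF t1(3), where c = 1])
      (use path_lens_snoc[of _ E "insert x P" x t1 a] t1 Pn a in auto)
  have Dn: "D \<subseteq> V - {x, y}" "D \<subseteq> V" "finite D" "a \<notin> D" using D(2) finite_subset[of D V] by auto
  have da: "\<exists>p\<in>D. \<exists>t\<in>{a}. E p t"
  proof (rule ccontr)
    assume no: "\<not> ?thesis"
    have cl': "v \<in> D \<union> {x, y}" if "p \<in> D" "v \<in> V" "E p v" for p v using D(4)[OF that] no that by auto
    show False by (rule reduce_x[OF D(1) Dn(1) xy(2) xy(4) _ cl', where ?v0.0 = a]) (use Dn dok a in auto)
  qed
  have dy: "\<exists>p\<in>D. \<exists>t\<in>{y}. E p t"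
  proof (rule ccontr)
    assume no: "\<not> ?thesis"
    have cl': "v \<in> D \<union> {x, a}" if "p \<in> D" "v \<in> V" "E p v" for p v using D(4)[OF that] no that by auto
    show False by (rule reduce_x[OF D(1) Dn(1) a(1,2) Dn(4) cl', where ?v0.0 = y]) (use Dn dok a in auto)
  qed
  have card2: "card D + 2 < card V" by (rule card_plus3[of _ x y a]) (use Dn a in auto)
  have "\<exists>t'\<in>D. (\<exists>t\<in>{y}. E t' t) \<and> adm (k - 1) (\<Union>u\<in>{a}. path_lens E (insert u D) u t')"
  proof (rule contract[OF Dn(2) D(1,3) card2])
    show "\<exists>d\<in>D'. \<exists>v\<in>D \<union> {a} \<union> {y} - D' - {c'}. E d v"
      if D': "D' \<noteq> {}" "D' \<subseteq> D" "c' \<in> D - D'" for D' c'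
    proof (rule ccontr)
      assume no: "\<not> ?thesis"
      have cl': "v \<in> D' \<union> {x, c'}" if "p \<in> D'" "v \<in> V" "E p v" for p v using D(4)[of p v] D' no that by blast
      show False by (rule reduce_x[OF D'(1) _ _ _ _ cl', where ?v0.0 = y]) (use Dn D' dok in auto)
    qed
    show "k - 1 \<le> 1 \<or> k - 1 + 1 \<le> card (nb E D p) + (if \<exists>u\<in>{a}. E p u then 1 else 0) + (if \<exists>t\<in>{y}. E p t then 1 else 0)"
      if p: "p \<in> D" for p
    proof -
      have "nb E V p \<subseteq> D \<union> {x, a, y}" using D(4)[OF p] by (auto simp: nb_def)
      from card_nb_three_le[OF this Dn(3)]
      have "card (nb E V p) \<le> card (nb E D p) + (if E p x then 1 else 0) + (if E p a then 1 else 0) + (if E p y then 1 else 0)" .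
      moreover have "deg_ok E V k p" using dok p Dn(1) by auto
      ultimately show ?thesis using k unfolding deg_ok_def by (auto split: if_splits)
    qed
  qed (use da dy Dn a in auto)
  then obtain t2 where t2: "t2 \<in> D" "E t2 y" "adm (k - 1) (path_lens E (insert a D) a t2)" by auto
  have dis: "insert a (insert x P) \<inter> insert a D \<subseteq> {a}" using P(2) Z(2) Dn by auto
  have "adm k (path_lens E (insert a (insert x P) \<union> insert a D) x t2)"
    by (rule adm_sum[OF F1 t2(3)]) (use k path_lens_join[OF _ _ dis] in auto)
  then show False by (rule direct[rotated 3]) (use t2 Dn Pn a in auto)
qed

end

lemma ex_max_measure:
  fixes f :: "'b \<Rightarrow> nat"
  assumes "finite S" "S \<noteq> {}"
  shows "\<exists>m\<in>S. \<forall>s\<in>S. f s \<le> f m"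
proof -
  have "Max (f ` S) \<in> f ` S" using assms by auto
  then obtain m where "m \<in> S" "f m = Max (f ` S)" by auto
  then show ?thesis using assms by (metis Max_ge finite_imageI imageI)
qed

context minimal_unlinked
begin

text \<open>No neighbour of \<open>y\<close> other than \<open>x\<close> lies outside the triangle,
  so no structure can be built on it at \<open>x\<close>. Instead \<open>y\<close> is deleted and
  the roots become \<open>c\<close> and \<open>x\<close>: the triangle is a clique at the root
  \<open>c\<close>, and a second neighbour \<open>z\<close> of \<open>x\<close> is the outside
  vertex that \<open>clique_case\<close> requires. Reversed, the paths end in \<open>c\<close>,
  which is adjacent to \<open>y\<close>.\<close>

lemma small_target_triangle:
  assumes dok: "\<And>v. v \<in> V - {x, y} \<Longrightarrow> deg_ok E V k v"
    and nt: "\<And>a b. a \<in> V - {y} \<Longrightarrow> b \<in> V - {y} \<Longrightarrow> E x a \<Longrightarrow> E x b \<Longrightarrow> \<not> E a b"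
    and t: "b \<in> V - {x, y}" "c \<in> V - {x, y}" "c' \<in> V - {x, y}" "E x b" "E b c" "E b c'" "E c c'"
    and cy: "E c y" and ny: "\<And>z. z \<in> V - {x} \<Longrightarrow> E z y \<Longrightarrow> z \<in> {b, c, c'}"
  shows False
proof -
  have ncx: "\<not> E x c" "\<not> E x c'" using nt[of b c] nt[of b c'] t by auto
  have ne: "b \<noteq> c" "b \<noteq> c'" "c \<noteq> c'" using t by auto
  have nbx: "nb E (V - {y}) x \<noteq> {b}" using x_degree_one[OF dok] by blast
  have "b \<in> nb E (V - {y}) x" using t by simp
  then obtain z where z: "z \<in> nb E (V - {y}) x" "z \<noteq> b" using nbx by blast
  have zz: "z \<in> V" "z \<noteq> y" "E z x" "z \<noteq> c" "z \<noteq> c'" "z \<noteq> x" using z(1) ncx E_sym by auto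
  have card: "card (V - {y}) < card V" by (rule card_Diff1_less[OF finV xy(2)])
  \<comment> \<open>If this failed, \<open>V - {y}\<close> would again satisfy the locale, being
    smaller than \<open>V\<close>; only vertices of the triangle can have lost an edge to
    \<open>y\<close>.\<close>
  have "linked E (V - {y}) c x k"
  proof (rule ccontr)
    assume nl: "\<not> linked E (V - {y}) c x k"
    interpret M: minimal_unlinked E "V - {y}" c x k
    proof unfold_locales
      show "linked E' V' x' y' k'" if "card V' < card (V - {y})" "symp E'" "irreflp E'" "rooted E' V' x' y'"
        "V' \<noteq> {x', y'}" "\<And>v. v \<in> V' - {x', y'} \<Longrightarrow> deg_ok E' V' k' v" for E' :: "'a \<Rightarrow> 'a \<Rightarrow> bool" and V' x' y' k'
        by (rule IH) (use that card in auto)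
      show "rooted E (V - {y}) c x" unfolding rooted_def
      proof (intro conjI allI impI)
        fix D c0 assume D: "D \<noteq> {}" "D \<subseteq> V - {y} - {c, x}"
        show "\<exists>d\<in>D. \<exists>v\<in>V - {y} - D - {c0}. E d v"
        proof (rule ccontr)
          assume no: "\<not> ?thesis"
          have "D \<subseteq> V - {x, y}" using D by auto
          from rootedD[OF D(1) this, of c0] obtain d v where dv: "d \<in> D" "v \<in> V - D - {c0}" "E d v" by blast
          then have "v = y" using no by blast
          then have "d \<in> {b, c'}" using ny[of d] dv D by auto
          then show False
          proof
            assume "d = b"
            have "x \<in> V - {y} - D" "c \<in> V - {y} - D" "x \<noteq> c" using D t by auto
            then have "x \<in> V - {y} - D - {c0} \<or> c \<in> V - {y} - D - {c0}" by auto
            then show False using no dv(1) \<open>d = b\<close> t E_sym by blast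
          next
            assume "d \<in> {c'}"
            then have dc: "c' \<in> D" using dv by auto
            have "c \<in> V - {y} - D" using D t by auto
            then have c0: "c0 = c" using no dc t E_sym by blast
            show False
            proof (cases "b \<in> D")
              case True
              have "x \<in> V - {y} - D - {c0}" using D t c0 by auto
              then show False using no True t E_sym by blast
            next
              case False
              then have "b \<in> V - {y} - D - {c0}" using t c0 ne by auto
              then show False using no dc t E_sym by blast
            qed
          qed
        qed
      qed (use t in auto)
    qed (use sym irrefl t nl ne in auto)
    show False
    proof (rule M.clique_case[of "{b, c, c'}" z])
      show "deg_ok E (V - {y}) k v" if v: "v \<in> V - {y} - {b, c, c'} - {x}" for v
      proof -
        have "\<not> E v y" using ny[of v] v by auto
        then have "nb E (V - {y}) v = nb E V v" by (auto simp: nb_def)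
        then show ?thesis using dok[of v] v unfolding deg_ok_def by auto
      qed
      show "clique E {b, c, c'}" using t E_sym unfolding clique_def by auto
    qed (use t zz z ne in auto)
  qed
  then obtain x' where x': "x' \<in> V - {y}" "E x' x" "x' \<noteq> c" "adm k (path_lens E (V - {y} - {x}) c x')"
    unfolding linked_def by blast
  have "Suc n \<in> path_lens E (insert x (V - {y} - {x})) x c" if "n \<in> path_lens E (V - {y} - {x}) c x'" for n
    by (rule path_lens_Cons[of _ _ _ x']) (use path_lens_rev[OF sym that] x' E_sym in auto)
  then have "adm k (path_lens E (insert x (V - {y} - {x})) x c)"
    by (intro adm_shift[OF x'(4), where c = 1]) auto
  then show False by (rule direct[rotated 3]) (use t cy in auto)
qed

text \<open>The structure is a book: an independent set \<open>B\<close> of neighbours of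
  \<open>x\<close>, completely joined to a clique \<open>C\<close>. Independence of \<open>B\<close>
  comes from \<open>x_triangle\<close>. The condition \<open>card B \<le> card C\<close> lets paths
  alternate, so that every length from 2 to \<open>card B + card C\<close> leads to each vertex of
  \<open>C\<close>.\<close>

lemma triangle_near_x:
  assumes dok: "\<And>v. v \<in> V - {x, y} \<Longrightarrow> deg_ok E V k v"
    and t: "b0 \<in> V - {x, y}" "c0 \<in> V - {x, y}" "c1 \<in> V - {x, y}" "E x b0" "E b0 c0" "E b0 c1" "E c0 c1"
  shows False
proof -
  have nt: "\<not> E a b" if "a \<in> V - {y}" "b \<in> V - {y}" "E x a" "E x b" for a b
    using x_triangle[OF dok that] by blast
  obtain u v where uv: "u \<in> V - {x}" "v \<in> V - {x}" "E u y" "E v y" "E u v" using y_triangle[OF dok] by blast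
  define valid where "valid = (\<lambda>(B, C). B \<subseteq> nb E (V - {y}) x \<and> B \<noteq> {} \<and> C \<subseteq> V - {x, y} \<and> clique E C \<and>
     (\<forall>b\<in>B. \<forall>c\<in>C. E b c) \<and> card B \<le> card C \<and> 2 \<le> card C \<and> (\<exists>z\<in>V - insert x (B \<union> C). E z y))"
  \<comment> \<open>The given triangle is a book unless it contains every neighbour of
    \<open>y\<close> other than \<open>x\<close>. In that case two of its vertices are adjacent to
    \<open>y\<close>, hence \<open>c0\<close> or \<open>c1\<close> is.\<close>
  have "\<exists>BC. valid BC"
  proof (rule ccontr)
    assume nv: "\<not> (\<exists>BC. valid BC)"
    have ny: "z \<in> {b0, c0, c1}" if "z \<in> V - {x}" "E z y" for z
    proof (rule ccontr)
      assume z: "z \<notin> {b0, c0, c1}"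
      have "c0 \<noteq> c1" using t by auto
      moreover have "z \<in> V - insert x ({b0} \<union> {c0, c1})" using z that by auto
      ultimately have "valid ({b0}, {c0, c1})" unfolding valid_def using t that E_sym
        by (auto simp: clique_def)
      then show False using nv by blast
    qed
    have "u \<in> {b0, c0, c1}" "v \<in> {b0, c0, c1}" "u \<noteq> v" using ny uv by auto
    then have "E c0 y \<or> E c1 y" using uv by auto
    then show False
    proof
      assume c: "E c0 y"
      show False by (rule small_target_triangle[OF _ _ t(1-7) c ny]) (use dok nt in auto)
    next
      assume c: "E c1 y"
      have ny': "z \<in> {b0, c1, c0}" if "z \<in> V - {x}" "E z y" for z using ny[OF that] by auto
      show False by (rule small_target_triangle[OF _ _ t(1,3,2,4,6,5) E_sym[OF t(7)] c ny']) (use dok nt in auto)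
    qed
  qed
  moreover have "finite {BC. valid BC}"
    by (rule finite_subset[of _ "Pow V \<times> Pow V"]) (auto simp: valid_def nb_def)
  ultimately obtain BC where BC: "valid BC" and max: "\<And>BC'. valid BC' \<Longrightarrow> card (fst BC') + card (snd BC') \<le> card (fst BC) + card (snd BC)"
    using ex_max_measure[of "{BC. valid BC}" "\<lambda>BC. card (fst BC) + card (snd BC)"] by blast
  obtain B C where BCe: "BC = (B, C)" by (cases BC)
  have B: "B \<subseteq> nb E (V - {y}) x" "B \<noteq> {}" and C: "C \<subseteq> V - {x, y}" "clique E C" and BC1: "\<forall>b\<in>B. \<forall>c\<in>C. E b c"
    and cBC: "card B \<le> card C" "2 \<le> card C" and zy: "\<exists>z\<in>V - insert x (B \<union> C). E z y"
    using BC unfolding BCe valid_def by auto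
  have maxBC: "card B' + card C' \<le> card B + card C" if "valid (B', C')" for B' C' using max[OF that] BCe by simp
  have BV: "B \<subseteq> V - {x, y}" "\<forall>b\<in>B. E x b" using B by auto
  have finB: "finite B" "finite C" using BV C finite_subset[OF _ finV] by blast+
  have notriB: "\<not> E w b" if "w \<in> V - {y}" "E x w" "b \<in> B" for w b using nt[of w b] that BV by auto
  have CNx: "\<not> E x c" if "c \<in> C" for c
  proof
    assume "E x c"
    obtain b where "b \<in> B" using B by blast
    then show False using notriB[of c b] BC1 that C \<open>E x c\<close> E_sym by blast
  qed
  have dis: "B \<inter> C = {}" "x \<notin> B \<union> C" using CNx BV C by auto
  have BC2: "\<forall>b\<in>B. \<forall>c\<in>C. E b c \<and> E c b" using BC1 E_sym by blast
  define Q where "Q = insert x (B \<union> C)"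
  have Q: "Q \<subseteq> V - {y}" "x \<in> Q" "C \<subseteq> Q" "x \<notin> C" "finite Q" using BV C dis finB unfolding Q_def by auto
  have QC: "Q - C = insert x B" using dis unfolding Q_def by auto
  have b1: "1 \<le> card B" using B finB by (simp add: Suc_leI card_gt_0_iff)
  obtain cc where cc: "cc \<in> C" using cBC by (cases "C = {}") auto
  define l where "l = card B + card C - 2"
  have l: "1 \<le> l" "l + 2 = card B + card C" using b1 cBC unfolding l_def by auto
  have nbQ: "card (nb E Q w) = (if E w x then 1 else 0) + card (nb E B w) + card (nb E C w)" for w
  proof -
    have "nb E Q w = (if E w x then {x} else {}) \<union> nb E B w \<union> nb E C w" unfolding Q_def by (auto simp: nb_def)
    moreover have "(if E w x then {x} else {}) \<inter> nb E B w = {}"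
      "((if E w x then {x} else {}) \<union> nb E B w) \<inter> nb E C w = {}" using dis by (auto simp: nb_def)
    ultimately show ?thesis using finB by (simp add: card_Un_disjoint)
  qed
  \<comment> \<open>The degree bound fails only for a vertex that could join \<open>C\<close>, or
    join a \<open>B\<close> with a single vertex. Maximality then puts all neighbours of
    \<open>y\<close> into \<open>insert w Q\<close>.\<close>
  have bad: "((\<not> E w x \<and> (\<forall>q\<in>B \<union> C. E w q)) \<or> (E w x \<and> card B = 1 \<and> (\<forall>q\<in>C. E w q))) \<and> (\<forall>z\<in>V. E z y \<longrightarrow> z \<in> insert w Q)"
    if w: "w \<in> V - Q - {y}" and f: "\<not> card (nb E Q w) \<le> l + (if \<exists>u\<in>C. E w u then 1 else 0)" for w
  proof -
    have le: "card (nb E B w) \<le> card B" "card (nb E C w) \<le> card C"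
      using finB by (auto intro!: card_mono simp: nb_def)
    have C0: "card (nb E C w) = 0" if "\<not> (\<exists>u\<in>C. E w u)"
    proof -
      have "nb E C w = {}" using that by (auto simp: nb_def)
      then show ?thesis by simp
    qed
    have Call: "\<forall>q\<in>C. E w q" if "card (nb E C w) = card C"
      using card_subset_eq[OF finB(2) _ that] by (auto simp: nb_def)
    have Ball: "\<forall>q\<in>B. E w q" if "card (nb E B w) = card B"
      using card_subset_eq[OF finB(1) _ that] by (auto simp: nb_def)
    show ?thesis
    proof (cases "E w x")
      case True
      have "nb E B w = {}" using notriB[of w] w E_sym[OF True] by (auto simp: nb_def)
      then have nbw: "card (nb E Q w) = 1 + card (nb E C w)" using nbQ[of w] True by simp
      have ex: "\<exists>u\<in>C. E w u"
      proof (rule ccontr)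
        assume "\<not> ?thesis"
        then show False using C0 f nbw l by simp
      qed
      then have cw: "card B = 1" "card (nb E C w) = card C" using f nbw l le b1 by auto
      have "valid (insert w B, C)" if "\<exists>z\<in>V. E z y \<and> z \<notin> insert w Q"
        unfolding valid_def using that B C BC1 Call[OF cw(2)] cw(1) cBC w E_sym[OF True] finB
        by (auto simp: Q_def card_insert_if)
      moreover have "\<not> valid (insert w B, C)"
        using maxBC[of "insert w B" C] w finB unfolding Q_def by auto
      ultimately show ?thesis using True cw Call[OF cw(2)] by blast
    next
      case False
      have nbw: "card (nb E Q w) = card (nb E B w) + card (nb E C w)" using nbQ[of w] False by simp
      have ex: "\<exists>u\<in>C. E w u"
      proof (rule ccontr)
        assume n: "\<not> ?thesis"
        then have "card B > l" using C0 f nbw l le by simp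
        then show False using l cBC by linarith
      qed
      then have cw: "card (nb E B w) = card B" "card (nb E C w) = card C" using f nbw l le by auto
      have all: "\<forall>q\<in>B \<union> C. E w q" using Call[OF cw(2)] Ball[OF cw(1)] by blast
      have "clique E (insert w C)" using C(2) all E_sym unfolding clique_def by blast
      then have "valid (B, insert w C)" if "\<exists>z\<in>V. E z y \<and> z \<notin> insert w Q"
        unfolding valid_def using that B C BC1 all cBC w finB E_sym
        by (auto simp: Q_def card_insert_if)
      moreover have "\<not> valid (B, insert w C)"
        using maxBC[of B "insert w C"] w finB unfolding Q_def by auto
      ultimately show ?thesis using False all by blast
    qed
  qed
  have lensC: "n \<in> path_lens E Q x c" if "c \<in> C" "2 \<le> n" "n \<le> card B + card C" for n c
    unfolding Q_def by (rule book_lens[OF finB dis BV(2) BC2 C(2) B(2) cBC(1)]) (use that in auto)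
  \<comment> \<open>Here \<open>b\<close> is entered from \<open>C\<close> at the very end, so
    another vertex of \<open>B\<close> has to come first; the shortest such path has length
    3.\<close>
  have lensB: "n \<in> path_lens E Q x b" if b: "b \<in> B" "2 \<le> card B" and n: "3 \<le> n" "n \<le> card B + card C" for n b
  proof -
    have cb: "card (B - {b}) = card B - 1" using b finB by simp
    have "1 \<le> card (B - {b})" using cb b(2) by simp
    then have ne: "B - {b} \<noteq> {}" by force
    have "n - 1 \<in> path_lens E (insert x (B - {b} \<union> C)) x cc"
      by (rule book_lens[OF _ finB(2) _ _ _ _ C(2) ne]) (use finB dis BV BC2 cb b n cBC cc in auto)
    then have "Suc (n - 1) \<in> path_lens E (insert b (insert x (B - {b} \<union> C))) x b"
      by (rule path_lens_snoc) (use BC2 cc b dis BV in auto)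
    then have "n \<in> path_lens E (insert b (insert x (B - {b} \<union> C))) x b" using n by simp
    then show ?thesis by (rule path_lens_mono) (use b in \<open>auto simp: Q_def\<close>)
  qed
  \<comment> \<open>A part that misses \<open>C\<close>. If \<open>B\<close> has two or more
    vertices, those with a neighbour in \<open>D\<close> replace \<open>C\<close> as the contracted
    set. If \<open>B\<close> is a single vertex \<open>b\<close>, the part is attached only to
    \<open>x\<close>, \<open>b\<close> and \<open>c\<close>, and is treated by
    \<open>merge_step\<close> or, for \<open>c = y\<close>, as one side of a three-vertex
    cut.\<close>
  have hang: False
    if D: "D \<noteq> {}" "D \<subseteq> V - Q - {y}" "conn_set E D" and c: "c \<in> V - Q - D"
      and clD: "\<And>d v. d \<in> D \<Longrightarrow> v \<in> V \<Longrightarrow> E d v \<Longrightarrow> v \<in> D \<union> {c} \<union> (Q - C)"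
      and ac: "\<exists>d\<in>D. E d c"
      and tail: "c \<noteq> y \<Longrightarrow> \<exists>r S. r \<in> path_lens E S c y \<and> S \<subseteq> V - Q - D"
      and W: "c = y \<Longrightarrow> \<exists>W. D \<subseteq> W \<and> W \<subseteq> V - Q - {y} \<and> (\<forall>w\<in>W. \<forall>v\<in>V. E w v \<longrightarrow> v \<in> W \<union> {y} \<union> (Q - C)) \<and>
           (\<forall>v\<in>V - Q - {y} - W. \<not> E v y)" for D c
  proof -
    have Dx: "D \<subseteq> V - {x, y}" "D \<subseteq> V" "D \<inter> Q = {}" "finite D" using D Q finite_subset[of D V] by auto
    have cc': "c \<in> V" "c \<noteq> x" "c \<notin> D" "c \<notin> Q" using c Q by auto
    have dokD: "deg_ok E V k d" if "d \<in> D" for d using dok that Dx by blast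
    have ccV: "cc \<in> V" "cc \<in> Q" "cc \<notin> D" "cc \<noteq> x" using cc Q Dx by auto
    have clD': "v \<in> D \<union> {x, c} \<union> B" if "d \<in> D" "v \<in> V" "E d v" for d v
      using clD[OF that] QC by auto
    show False
    proof (cases "\<exists>d\<in>D. \<exists>b\<in>B. E d b")
      case False
      have cl': "v \<in> D \<union> {x, c}" if "d \<in> D" "v \<in> V" "E d v" for d v using clD'[OF that] False that by blast
      show False by (rule reduce_x[OF D(1) Dx(1) cc'(1-3) cl' dokD, where ?v0.0 = cc]) (use ccV cc' in auto)
    next
      case aB: True
      show False
      proof (cases "2 \<le> card B")
        case b2: True
        define U where "U = {b \<in> B. \<exists>d\<in>D. E d b}"
        have UQ: "U \<subseteq> Q" "x \<notin> U" using dis unfolding U_def Q_def by auto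
        have "\<exists>t'\<in>D. E t' c \<and> adm k (path_lens E (Q \<union> D) x t')"
        proof (rule structure_step[where U = U and l = "card B + card C - 3" and s = 1 and b = 3])
          show "v \<in> D \<union> {c} \<union> Q" if "p \<in> D" "v \<in> V" "E p v" for p v using clD[OF that] by auto
          show False if D': "D' \<noteq> {}" "D' \<subseteq> D" "c' \<in> D - D'"
            and cl2: "\<And>d v. d \<in> D' \<Longrightarrow> v \<in> V \<Longrightarrow> E d v \<Longrightarrow> v \<in> D' \<union> {c'} \<union> (Q - U)" for D' c'
          proof -
            have cl': "v \<in> D' \<union> {x, c'}" if "d \<in> D'" "v \<in> V" "E d v" for d v
            proof -
              have "v \<in> D \<union> {x, c} \<union> B" using clD'[of d v] that D' by blast
              moreover have "v \<notin> B" using cl2[OF that] that D' Dx Q_def unfolding U_def by blast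
              ultimately show ?thesis using cl2[OF that] cc' Dx(3) by blast
            qed
            show False by (rule reduce_x[OF D'(1) _ _ _ _ cl', where ?v0.0 = cc])
              (use D' Dx ccV dokD in auto)
          qed
          show "card (nb E Q p) \<le> card B + card C - 3 + (if \<exists>u\<in>U. E p u then 1 else 0)" if p: "p \<in> D" for p
          proof -
            have "\<not> E p q" if q: "q \<in> C" for q
            proof
              assume "E p q"
              moreover have "q \<in> V" "q \<in> Q" "q \<notin> B" "q \<noteq> x" using q C Q(3) dis by auto
              ultimately show False using clD'[OF p, of q] cc'(4) Dx(3) by blast
            qed
            then have "nb E C p = {}" by (auto simp: nb_def)
            then have e: "card (nb E Q p) = (if E p x then 1 else 0) + card (nb E B p)" using nbQ[of p] by simp
            show ?thesis
            proof (cases "\<exists>b\<in>B. E p b")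
              case True
              then have "\<not> E p x" using notriB[of p] p Dx(1) E_sym by blast
              moreover have "card (nb E B p) \<le> card B" using finB by (auto intro!: card_mono simp: nb_def)
              moreover have "\<exists>u\<in>U. E p u" using True p unfolding U_def by blast
              ultimately show ?thesis using e b2 cBC by simp
            next
              case False
              then have "nb E B p = {}" by (auto simp: nb_def)
              then have "card (nb E Q p) \<le> 1" using e by simp
              moreover have "1 \<le> card B + card C - 3" using b2 cBC by linarith
              ultimately show ?thesis by linarith
            qed
          qed
          show "3 + 1 * j \<in> path_lens E Q x u" if "u \<in> U" "j \<le> card B + card C - 3" for u j
            by (rule lensB) (use that b2 cBC in \<open>auto simp: U_def\<close>)
          show "\<exists>p\<in>D. \<exists>u\<in>U. E p u" using aB unfolding U_def by blast
        qed (use Q UQ Dx D cc' ac dokD b2 cBC in auto)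
        then obtain t' where t': "t' \<in> D" "E t' c" "adm k (path_lens E (Q \<union> D) x t')" by blast
        show False
        proof (rule finish_at[OF t' Q(2)])
          show "\<exists>m S. m \<in> path_lens E S c y \<and> S \<subseteq> V \<and> S \<inter> (Q \<union> D) = {}" if "c \<noteq> y"
            using tail[OF that] by blast
        qed (use Q Dx cc' in auto)
      next
        case False
        then have "card B = 1" using b1 by simp
        then obtain b where b: "B = {b}" by (rule card_1_singletonE)
        have bV: "b \<in> V" "b \<noteq> x" "b \<noteq> y" "E x b" "b \<in> Q" using b BV Q_def by auto
        have Db: "D \<subseteq> V - {x, y, b}" using Dx bV by auto
        show False
        proof (cases "c = y")
          case cy: False
          obtain r S where rS: "r \<in> path_lens E S c y" "S \<subseteq> V - Q - D" using tail[OF cy] by blast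
          have pre: "1 \<in> path_lens E {x, b} x b"
            using path_lensI[of E "{x, b}" "[x, b]" 1] bV by (simp add: gpath_def)
          show False
          proof (rule merge_step[OF bV(1-3) D(1) Db D(3) cc'(1,3,2) _ cy _ _ _ pre _ _ rS(1)])
            show "v \<in> D \<union> {x, b, c}" if "d \<in> D" "v \<in> V" "E d v" for d v using clD'[OF that] b by auto
            show "\<not> (E d x \<and> E d b)" if "d \<in> D" for d using notriB[of d b] that Dx(1) b E_sym by blast
          qed (use rS cc' bV Q(1,2) Dx dokD in auto)
        next
          case cy: True
          obtain W where W: "D \<subseteq> W" "W \<subseteq> V - Q - {y}" "\<forall>w\<in>W. \<forall>v\<in>V. E w v \<longrightarrow> v \<in> W \<union> {y} \<union> (Q - C)"
            "\<forall>v\<in>V - Q - {y} - W. \<not> E v y" using W[OF cy] by blast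
          \<comment> \<open>The other side of the cut \<open>{x, b, y}\<close>; it contains all of
            \<open>C\<close>, as \<open>W\<close> is disjoint from the book.\<close>
          define Z where "Z = V - {x, y, b} - W"
          have Z: "cc \<in> Z" "Z \<subseteq> V - {x, y, b}" "Z \<subseteq> V - {x, y}" "b \<notin> Z"
            using cc ccV W(2) b dis C unfolding Z_def by auto
          have clZ: "v \<in> Z \<union> {x, b, y}" if "d \<in> Z" "v \<in> V" "E d v" for d v
          proof (rule ccontr)
            assume n: "v \<notin> Z \<union> {x, b, y}"
            then have "v \<in> W" using that unfolding Z_def by auto
            then have "d \<in> W \<union> {y} \<union> (Q - C)" using W(3) that E_sym unfolding Z_def by blast
            then show False using that(1) QC b unfolding Z_def by auto
          qed
          show False
          proof (cases "\<exists>z\<in>Z. E z y")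
            case no: False
            have cl': "v \<in> Z \<union> {x, b}" if "d \<in> Z" "v \<in> V" "E d v" for d v using clZ[OF that] no that by auto
            have dk: "deg_ok E V k d" if "d \<in> Z" for d using dok that Z(3) by blast
            have "Z \<noteq> {}" using Z(1) by blast
            show False by (rule reduce_x[OF \<open>Z \<noteq> {}\<close> Z(3) bV(1,2) Z(4) cl' dk, where ?v0.0 = y])
              (use Z bV in auto)
          next
            case True
            then obtain z where z: "z \<in> Z" "E z y" by blast
            show False
            proof (cases "3 \<le> k")
              case k3: True
              show False
              proof (rule three_cut[OF dok bV(1-3) D(1) Db D(3) _ _ _ clZ k3])
                show "v \<in> D \<union> {x, b, y}" if "d \<in> D" "v \<in> V" "E d v" for d v using clD'[OF that] b cy by auto
                show "Z \<noteq> {}" using Z by blast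
                show "Z \<subseteq> V - {x, y, b} - D" using Z W(1) unfolding Z_def by auto
              qed
            next
              case k2: False
              \<comment> \<open>Outside the book the neighbours of \<open>y\<close> in the region
                lie in \<open>W\<close>, so \<open>z\<close> belongs to the book. For
                \<open>k = 2\<close> the lengths 2 and 3 suffice.\<close>
              have "z \<in> C" using z W(4) Z(2) b unfolding Q_def Z_def by auto
              have "2 + 1 * i \<in> path_lens E Q x z" if "i < k" for i
                by (rule lensC[OF \<open>z \<in> C\<close>]) (use that k2 b1 cBC in auto)
              then have "adm k (path_lens E Q x z)" unfolding adm_def by blast
              then show False by (rule direct[rotated 3]) (use z Z Q in auto)
            qed
          qed
        qed
      qed
    qed
  qed
  have main: False
    if t: "t \<in> V - Q" "t = y \<or> E t y" and p0: "p0 \<in> V - Q - {y, t}" "E p0 t"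
      and ny: "t = y \<or> (\<forall>p\<in>V - Q - {y, t}. \<not> E p y)"
      and nb: "\<And>p. p \<in> V - Q - {y, t} \<Longrightarrow> card (nb E Q p) \<le> l + (if \<exists>u\<in>C. E p u then 1 else 0)" for t p0
  proof (rule region_step[where R = "V - Q - {y, t}" and Q = Q and U = C and t = t and ?p0.0 = p0 and l = l and s = 1 and b = 2])
    show "v \<in> V - Q - {y, t} \<union> {t} \<union> Q" if "p \<in> V - Q - {y, t}" "v \<in> V" "E p v" for p v
      using that ny by auto
    show "deg_ok E V k p" if "p \<in> V - Q - {y, t}" for p using dok that Q(2) by blast
    show "card (nb E Q p) \<le> l + (if \<exists>u\<in>C. E p u then 1 else 0)" if "p \<in> V - Q - {y, t}" for p by (rule nb[OF that])
    show "2 + 1 * j \<in> path_lens E Q x u" if "u \<in> C" "j \<le> l" for u j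
      by (rule lensC) (use that l in auto)
    show "\<exists>r S. r \<in> path_lens E S t y \<and> S \<subseteq> V - Q - (V - Q - {y, t})" if ty: "t \<noteq> y"
    proof -
      have "E t y" using t ty by auto
      then have "1 \<in> path_lens E {t, y} t y"
        using path_lensI[of E "{t, y}" "[t, y]" 1] ty by (simp add: gpath_def)
      then show ?thesis using t Q(1) by (intro exI[of _ 1] exI[of _ "{t, y}"]) auto
    qed
    show False if D: "D \<noteq> {}" "D \<subseteq> V - Q - {y, t}" "conn_set E D" "c \<in> V - Q - D"
      and clD: "\<And>d v. d \<in> D \<Longrightarrow> v \<in> V \<Longrightarrow> E d v \<Longrightarrow> v \<in> D \<union> {c} \<union> (Q - C)"
      and ac: "\<exists>d\<in>D. E d c"
      and tail: "c \<noteq> y \<Longrightarrow> \<exists>r S. r \<in> path_lens E S c y \<and> S \<subseteq> V - Q - D"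
      and W: "c = y \<Longrightarrow> t = y \<and> (\<exists>W. D \<subseteq> W \<and> W \<subseteq> V - Q - {y, t} \<and> (\<forall>w\<in>W. \<forall>v\<in>V. E w v \<longrightarrow> v \<in> W \<union> {y} \<union> (Q - C)) \<and>
           (\<forall>v\<in>V - Q - {y, t} - W. \<not> E v y))" for D c
    proof (rule hang[OF D(1) _ D(3,4) clD ac tail])
      show "D \<subseteq> V - Q - {y}" using D by auto
      show "\<exists>W. D \<subseteq> W \<and> W \<subseteq> V - Q - {y} \<and> (\<forall>w\<in>W. \<forall>v\<in>V. E w v \<longrightarrow> v \<in> W \<union> {y} \<union> (Q - C)) \<and>
           (\<forall>v\<in>V - Q - {y} - W. \<not> E v y)" if cy: "c = y"
      proof -
        have ty: "t = y" using W[OF cy] by blast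
        show ?thesis using W[OF cy] unfolding ty insert_absorb2 by (rule conjunct2)
      qed
    qed
  qed (use Q t p0 l in auto)
  show False
  proof (cases "\<exists>w\<in>V - Q - {y}. \<not> card (nb E Q w) \<le> l + (if \<exists>u\<in>C. E w u then 1 else 0)")
    case False
    obtain z where "z \<in> V - Q" "E z y" using zy unfolding Q_def by blast
    moreover have "z \<noteq> y" using \<open>E z y\<close> by auto
    ultimately show False using main[of y z] False Q(1) by auto
  next
    case True
    then obtain w where w: "w \<in> V - Q - {y}" "\<not> card (nb E Q w) \<le> l + (if \<exists>u\<in>C. E w u then 1 else 0)" by blast
    have wy: "E w y" using bad[OF w] zy unfolding Q_def by blast
    have yw: "z \<in> insert w Q" if "z \<in> V" "E z y" for z using bad[OF w] that by blast
    have wV: "w \<in> V" "w \<notin> Q" "w \<noteq> x" "w \<noteq> y" using w Q by auto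
    show False
    proof (cases "\<exists>p\<in>V - Q - {y, w}. E p w")
      case True
      then obtain p where p: "p \<in> V - Q - {y, w}" "E p w" by blast
      show False
      proof (rule main[of w p])
        show "w = y \<or> (\<forall>p\<in>V - Q - {y, w}. \<not> E p y)" using yw by blast
        show "card (nb E Q p) \<le> l + (if \<exists>u\<in>C. E p u then 1 else 0)" if p: "p \<in> V - Q - {y, w}" for p
        proof (rule ccontr)
          assume "\<not> ?thesis"
          then have "w \<in> insert p Q" using bad[of p] p wV wy by blast
          then show False using p wV by auto
        qed
      qed (use w wy p in auto)
    next
      case noP: False
      have nbw: "v \<in> insert y Q" if "v \<in> V" "E w v" for v
      proof -
        have "v \<noteq> w" "E v w" using that E_sym by auto
        then show ?thesis using noP that by blast
      qed
      have dw: "k + 1 \<le> card (nb E V w)" using dok[of w] wV k_ge unfolding deg_ok_def by auto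
      have "(\<not> E w x \<and> (\<forall>q\<in>B \<union> C. E w q)) \<or> (E w x \<and> card B = 1 \<and> (\<forall>q\<in>C. E w q))"
        using bad[OF w] by blast
      then show False
      proof
        assume wi: "\<not> E w x \<and> (\<forall>q\<in>B \<union> C. E w q)"
        have "nb E V w \<subseteq> insert y (B \<union> C)" using nbw wi unfolding Q_def by (auto simp: nb_def)
        then have "card (nb E V w) \<le> card (insert y (B \<union> C))" by (rule card_mono[rotated]) (use finB in auto)
        also have "\<dots> \<le> Suc (card (B \<union> C))" using finB by (simp add: card_insert_if)
        also have "\<dots> = Suc (card B + card C)" using finB dis by (simp add: card_Un_disjoint)
        finally have kk: "k \<le> card B + card C" using dw by simp
        have cw: "card (insert w C) = Suc (card C)" using finB wV unfolding Q_def by simp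
        have "clique E (insert w C)" using C(2) wi E_sym unfolding clique_def by blast
        then have "2 + 1 * i \<in> path_lens E (insert x (B \<union> insert w C)) x w" if "i < k" for i
          by (intro book_lens) (use that kk cw finB dis BV BC2 wi wV B cBC E_sym in \<open>auto simp: Q_def\<close>)
        then have "adm k (path_lens E (insert x (B \<union> insert w C)) x w)" unfolding adm_def by blast
        then show False by (rule direct[rotated 3]) (use wV wy BV C in auto)
      next
        assume wi: "E w x \<and> card B = 1 \<and> (\<forall>q\<in>C. E w q)"
        then obtain b where b: "B = {b}" using card_1_singletonE by blast
        have bw: "\<not> E w b" using notriB[of w b] wV wi b E_sym by blast
        have "nb E V w \<subseteq> insert x (insert y C)" using nbw bw b unfolding Q_def by (auto simp: nb_def)
        then have "card (nb E V w) \<le> card (insert x (insert y C))" by (rule card_mono[rotated]) (use finB in auto)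
        also have "\<dots> \<le> Suc (Suc (card C))" using finB by (simp add: card_insert_if)
        finally have kk: "k \<le> card C + 1" using dw by simp
        \<comment> \<open>Since \<open>b\<close> and \<open>w\<close> are not adjacent, the edge
          \<open>u v\<close> of the triangle at \<open>y\<close> has an end in \<open>C\<close>.
          That end is the common penultimate vertex, and \<open>{b, w}\<close> takes the place of
          \<open>B\<close>.\<close>
        have "u \<in> insert w Q" "v \<in> insert w Q" using yw uv by auto
        then have "u \<in> C \<or> v \<in> C" using uv b bw E_sym unfolding Q_def by auto
        then obtain c where c: "c \<in> C" "E c y" using uv by blast
        have wb: "w \<noteq> b" "card {b, w} = 2" using wV b unfolding Q_def by auto
        have "2 + 1 * i \<in> path_lens E (insert x ({b, w} \<union> C)) x c" if "i < k" for i
          by (rule book_lens[OF _ _ _ _ _ _ C(2)])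
            (use that kk wb finB dis BV BC2 wi wV b c cBC E_sym in \<open>auto simp: Q_def\<close>)
        then have "adm k (path_lens E (insert x ({b, w} \<union> C)) x c)" unfolding adm_def by blast
        then show False by (rule direct[rotated 3]) (use wV c BV C b in auto)
      qed
    qed
  qed
qed

end

subsection \<open>Complete bipartite graphs at the root\<close>

lemma bip_lens_same:
  assumes "finite A" "finite U" "x \<in> A" "A \<inter> U = {}" "\<forall>a\<in>A. \<forall>u\<in>U. E a u \<and> E u a"
    "a \<in> A" "a \<noteq> x" "1 \<le> j" "j < card A" "j \<le> card U"
  shows "2 * j \<in> path_lens E (A \<union> U) x a"
proof -
  have "j + j \<in> path_lens E (insert x (U \<union> (A - {x}))) x a"
    by (rule alternating_lens) (use assms in auto)
  moreover have "insert x (U \<union> (A - {x})) = A \<union> U" using assms by auto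
  ultimately show ?thesis by (simp add: mult_2)
qed

lemma bip_lens:
  assumes "finite A" "finite U" "x \<in> A" "A \<inter> U = {}" "\<forall>a\<in>A. \<forall>u\<in>U. E a u \<and> E u a"
    "u \<in> U" "card A \<le> card U" "j < card A"
  shows "1 + 2 * j \<in> path_lens E (A \<union> U) x u"
proof (cases "j = 0")
  case True
  have "gpath E (A \<union> U) [x, u]" using assms by (auto simp: gpath_def)
  from path_lensI[OF this, of 1] show ?thesis using True by simp
next
  case False
  have "card (A - {x}) = card A - 1" using assms by simp
  then have "A - {x} \<noteq> {}" using False assms(8) by force
  then obtain a where a: "a \<in> A" "a \<noteq> x" by blast
  have "2 * j \<in> path_lens E (A \<union> (U - {u})) x a"
    by (rule bip_lens_same) (use assms a False in auto)
  then have "Suc (2 * j) \<in> path_lens E (insert u (A \<union> (U - {u}))) x u"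
    by (rule path_lens_snoc) (use assms a in auto)
  moreover have "insert u (A \<union> (U - {u})) = A \<union> U" using assms by auto
  ultimately show ?thesis by simp
qed

context minimal_unlinked
begin

text \<open>With triangles near \<open>x\<close> excluded, the structure is complete bipartite:
  \<open>x\<close> lies in \<open>A\<close>, and \<open>B\<close> consists of all common neighbours
  of \<open>A\<close> other than \<open>y\<close>. A vertex outside, other than \<open>y\<close>,
  never sees both sides. Its loss is at most \<open>card A - 1\<close> if it sees only
  \<open>A\<close>, since it misses a vertex of \<open>A\<close>; if it sees \<open>B\<close>, at
  most \<open>card A\<close> edges are affected and one survives. The lengths in the structure have
  step 2.\<close>

lemma biclique_case:
  assumes dok: "\<And>v. v \<in> V - {x, y} \<Longrightarrow> deg_ok E V k v"
  shows False
proof -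
  have nt: "\<not> E a b" if "a \<in> V - {y}" "b \<in> V - {y}" "E x a" "E x b" for a b
    using x_triangle[OF dok that] by blast
  have nt2: "\<not> E c d" if "b \<in> V - {x, y}" "c \<in> V - {x, y}" "d \<in> V - {x, y}" "E x b" "E b c" "E b d" for b c d
    using triangle_near_x[OF dok that] by blast
  obtain u v where uv: "u \<in> V - {x}" "v \<in> V - {x}" "E u y" "E v y" "E u v" using y_triangle[OF dok] by blast
  define Bs where "Bs = (\<lambda>A. {b \<in> V - {y} - A. \<forall>a\<in>A. E a b})"
  define valid where "valid = (\<lambda>A. x \<in> A \<and> A \<subseteq> V - {y} \<and> card A \<le> card (Bs A) \<and> (\<exists>z\<in>V - (A \<union> Bs A). E z y))"
  have finBs: "finite (Bs A)" for A unfolding Bs_def by auto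
  \<comment> \<open>The triangle at \<open>y\<close> supplies the outside neighbour of
    \<open>y\<close>: its two other vertices are adjacent, so they are not both neighbours of
    \<open>x\<close>.\<close>
  have "valid {x}"
  proof -
    have "V - {x, y} \<noteq> {}" using nontriv by auto
    from rootedD[OF this, of y] obtain d where "d \<in> V - {x, y}" "E d x" by blast
    then have "d \<in> Bs {x}" using E_sym unfolding Bs_def by auto
    then have "1 \<le> card (Bs {x})" using finBs by (metis One_nat_def Suc_leI card_gt_0_iff empty_iff)
    moreover have "u \<noteq> y" "v \<noteq> y" using uv by auto
    then have "\<exists>z\<in>V - ({x} \<union> Bs {x}). E z y" using nt[of u v] uv unfolding Bs_def by auto
    ultimately show ?thesis unfolding valid_def by auto
  qed
  moreover have "finite {A. valid A}" by (rule finite_subset[of _ "Pow V"]) (auto simp: valid_def)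
  ultimately obtain A where va: "valid A" and max: "\<And>A'. valid A' \<Longrightarrow> card A' \<le> card A"
    using ex_max_measure[of "{A. valid A}" card] by blast
  define B where "B = Bs A"
  have A: "x \<in> A" "A \<subseteq> V - {y}" and cAB: "card A \<le> card B" and zy: "\<exists>z\<in>V - (A \<union> B). E z y"
    using va unfolding valid_def B_def by auto
  have B: "B \<subseteq> V - {y}" "A \<inter> B = {}" and AB: "\<forall>a\<in>A. \<forall>b\<in>B. E a b \<and> E b a"
    using E_sym unfolding B_def Bs_def by auto
  have inB: "w \<in> B" if "w \<in> V - {y} - A" "\<forall>a\<in>A. E a w" for w using that unfolding B_def Bs_def by auto
  have fin: "finite A" "finite B" using A B finite_subset[OF _ finV] by blast+
  have xB: "E x b" if "b \<in> B" for b using AB A that by blast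
  have Bx: "B \<subseteq> V - {x, y}" using B A by auto
  have s1: "1 \<le> card A" using A fin by (metis One_nat_def Suc_leI card_gt_0_iff empty_iff)
  have Bindep: "\<not> E b b'" if "b \<in> B" "b' \<in> B" for b b' using nt[of b b'] that xB B by blast
  have f1: "\<exists>a\<in>A. \<not> E w a" if "w \<in> V - (A \<union> B) - {y}" for w
    using inB[of w] that E_sym by blast
  have f1c: "card (nb E A w) \<le> card A - 1" if w: "w \<in> V - (A \<union> B) - {y}" for w
  proof -
    obtain a where a: "a \<in> A" "\<not> E w a" using f1[OF w] by blast
    then have "nb E A w \<subseteq> A - {a}" by (auto simp: nb_def)
    then have "card (nb E A w) \<le> card (A - {a})" by (rule card_mono[rotated]) (use fin in auto)
    then show ?thesis using a fin by simp
  qed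
  have f2: "\<not> (E w a \<and> E w b)" if w: "w \<in> V - (A \<union> B) - {y}" and ab: "a \<in> A" "b \<in> B" for w a b
  proof (cases "a = x")
    case True
    then show ?thesis using nt[of w b] w ab xB[of b] B E_sym by blast
  next
    case False
    have "b \<in> V - {x, y}" "a \<in> V - {x, y}" "w \<in> V - {x, y}" using w ab Bx A False by auto
    then show ?thesis using nt2[of b a w] xB[OF ab(2)] AB ab E_sym by blast
  qed
  \<comment> \<open>The common neighbours of \<open>insert w A\<close> are the neighbours of
    \<open>w\<close> in \<open>B\<close>. If there are more than \<open>card A\<close> of them, only
    the condition on \<open>y\<close> can prevent the larger structure.\<close>
  have bad: "\<forall>z\<in>V. E z y \<longrightarrow> z \<in> insert w (A \<union> B)"
    if w: "w \<in> V - (A \<union> B) - {y}" and c: "\<not> card (nb E B w) \<le> card A" for w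
  proof (rule ccontr)
    assume n: "\<not> ?thesis"
    have e: "Bs (insert w A) = nb E B w" using w unfolding B_def Bs_def by (auto simp: nb_def)
    have "valid (insert w A)" unfolding valid_def e using n w A c fin by (auto simp: nb_def)
    then show False using max[of "insert w A"] w fin by auto
  qed
  \<comment> \<open>\<open>U\<close> will be \<open>B\<close>, or \<open>B\<close> without one
    vertex that serves as target. For \<open>card A \<ge> 3\<close> the vertices of
    \<open>A - {x}\<close> with a neighbour in \<open>D\<close> are contracted, reached by even
    lengths. For \<open>A = {x, a}\<close> the part is attached only to \<open>x\<close>,
    \<open>a\<close> and \<open>c\<close>, as in the case of a book with a single vertex
    \<open>b\<close>.\<close>
  have hang: False
    if U: "U \<subseteq> B" "card A \<le> card U"
      and D: "D \<noteq> {}" "D \<subseteq> V - (A \<union> B) - {y}" "conn_set E D" and c: "c \<in> V - (A \<union> U) - D"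
      and clD: "\<And>d v. d \<in> D \<Longrightarrow> v \<in> V \<Longrightarrow> E d v \<Longrightarrow> v \<in> D \<union> {c} \<union> A"
      and ac: "\<exists>d\<in>D. E d c"
      and tail: "c \<noteq> y \<Longrightarrow> \<exists>r S. r \<in> path_lens E S c y \<and> S \<subseteq> V - (A \<union> U) - D"
      and W: "c = y \<Longrightarrow> \<exists>W. D \<subseteq> W \<and> W \<subseteq> V - (A \<union> B) - {y} \<and> (\<forall>w\<in>W. \<forall>v\<in>V. E w v \<longrightarrow> v \<in> W \<union> {y} \<union> A) \<and>
           (\<forall>v\<in>V - (A \<union> B) - {y} - W. \<not> E v y)" for U D c
  proof -
    have Dx: "D \<subseteq> V - {x, y}" "D \<subseteq> V" "D \<inter> (A \<union> B) = {}" "finite D" using D A finite_subset[of D V] by auto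
    have cc': "c \<in> V" "c \<noteq> x" "c \<notin> D" "c \<notin> A" "c \<notin> U" using c A by auto
    have dokD: "deg_ok E V k d" if "d \<in> D" for d using dok that Dx by blast
    have finU: "finite U" using U fin finite_subset by blast
    have AU: "\<forall>a\<in>A. \<forall>u\<in>U. E a u \<and> E u a" "A \<inter> U = {}" using AB B U by blast+
    obtain u0 where u0: "u0 \<in> U" using U(2) s1 by (cases "U = {}") auto
    have u0V: "u0 \<in> V" "u0 \<notin> D" "u0 \<noteq> x" "u0 \<noteq> c" "u0 \<notin> A" "u0 \<noteq> y" using u0 U Bx Dx c B by auto
    show False
    proof (cases "\<exists>d\<in>D. \<exists>a\<in>A - {x}. E d a")
      case False
      have cl': "v \<in> D \<union> {x, c}" if "d \<in> D" "v \<in> V" "E d v" for d v using clD[OF that] False that by blast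
      show False by (rule reduce_x[OF D(1) Dx(1) cc'(1-3) cl' dokD, where ?v0.0 = u0]) (use u0V in auto)
    next
      case aA: True
      show False
      proof (cases "3 \<le> card A")
        case s3: True
        define T where "T = {a \<in> A - {x}. \<exists>d\<in>D. E d a}"
        have "\<exists>t'\<in>D. E t' c \<and> adm k (path_lens E ((A \<union> U) \<union> D) x t')"
        proof (rule structure_step[where U = T and l = "card A - 2" and s = 2 and b = 2])
          show "v \<in> D \<union> {c} \<union> (A \<union> U)" if "p \<in> D" "v \<in> V" "E p v" for p v using clD[OF that] by auto
          show False if D': "D' \<noteq> {}" "D' \<subseteq> D" "c' \<in> D - D'"
            and cl2: "\<And>d v. d \<in> D' \<Longrightarrow> v \<in> V \<Longrightarrow> E d v \<Longrightarrow> v \<in> D' \<union> {c'} \<union> ((A \<union> U) - T)" for D' c'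
          proof -
            have cl': "v \<in> D' \<union> {x, c'}" if d: "d \<in> D'" "v \<in> V" "E d v" for d v
            proof -
              have "v \<in> D \<union> {c} \<union> A" using clD[of d v] d D' by blast
              moreover have "v \<in> A \<Longrightarrow> v \<noteq> x \<Longrightarrow> v \<in> T" using d D' unfolding T_def by blast
              ultimately show ?thesis using cl2[OF d] cc' Dx(3) U(1) by blast
            qed
            show False by (rule reduce_x[OF D'(1) _ _ _ _ cl', where ?v0.0 = u0])
              (use D' Dx u0V dokD in auto)
          qed
          show "card (nb E (A \<union> U) p) \<le> card A - 2 + (if \<exists>u\<in>T. E p u then 1 else 0)" if p: "p \<in> D" for p
          proof -
            have "\<not> E p q" if "q \<in> U" for q
              using clD[OF p, of q] that U Bx B cc' Dx(3) by blast
            then have e: "nb E (A \<union> U) p = nb E A p" by (auto simp: nb_def)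
            show ?thesis
            proof (cases "\<exists>u\<in>T. E p u")
              case True
              have "p \<in> V - (A \<union> B) - {y}" using p D(2) by blast
              then have "card (nb E A p) \<le> card A - 1" by (rule f1c)
              then show ?thesis using e True s3 by simp
            next
              case False
              then have "nb E A p \<subseteq> {x}" using p unfolding T_def by (auto simp: nb_def)
              then have "card (nb E A p) \<le> card {x}" by (rule card_mono[rotated]) auto
              then show ?thesis using e s3 by simp
            qed
          qed
          show "2 + 2 * j \<in> path_lens E (A \<union> U) x a" if a: "a \<in> T" "j \<le> card A - 2" for a j
          proof -
            have "2 * (Suc j) \<in> path_lens E (A \<union> U) x a"
              by (rule bip_lens_same[OF fin(1) finU A(1) AU(2,1)]) (use a s3 U in \<open>auto simp: T_def\<close>)
            then show ?thesis by simp
          qed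
          show "\<exists>p\<in>D. \<exists>a\<in>T. E p a" using aA unfolding T_def by blast
        qed (use A B U Dx D cc' ac dokD in \<open>auto simp: T_def\<close>)
        then obtain t' where t': "t' \<in> D" "E t' c" "adm k (path_lens E ((A \<union> U) \<union> D) x t')" by blast
        show False
        proof (rule finish_at[OF t'])
          show "\<exists>m S. m \<in> path_lens E S c y \<and> S \<subseteq> V \<and> S \<inter> ((A \<union> U) \<union> D) = {}" if "c \<noteq> y"
            using tail[OF that] by blast
        qed (use A B U Dx D cc' in auto)
      next
        case False
        obtain a where a: "a \<in> A" "a \<noteq> x" using aA by blast
        have "card {x, a} \<le> card A" by (rule card_mono) (use a A fin in auto)
        then have s2: "card A = 2" using a False by auto
        have Axa: "A = {x, a}" by (rule card_subset_eq[symmetric]) (use a A fin s2 in auto)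
        have aV: "a \<in> V" "a \<noteq> x" "a \<noteq> y" using a A by auto
        have Da: "D \<subseteq> V - {x, y, a}" using Dx a by auto
        show False
        proof (cases "c = y")
          case cy: False
          obtain r S where rS: "r \<in> path_lens E S c y" "S \<subseteq> V - (A \<union> U) - D" using tail[OF cy] by blast
          have "gpath E {x, u0, a} [x, u0, a]" using u0 a A(1) AU u0V by (auto simp: gpath_def)
          from path_lensI[OF this, of 2] have pre: "2 \<in> path_lens E {x, u0, a} x a" by simp
          show False
          proof (rule merge_step[OF aV D(1) Da D(3) cc'(1,3,2) _ cy _ _ _ pre _ _ rS(1)])
            show "v \<in> D \<union> {x, a, c}" if "d \<in> D" "v \<in> V" "E d v" for d v using clD[OF that] Axa by auto
            show "\<not> (E d x \<and> E d a)" if "d \<in> D" for d using f1[of d] that D(2) Axa by blast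
          qed (use rS cc' aV a A(1) u0 u0V Dx dokD in auto)
        next
          case cy: True
          obtain W where W: "D \<subseteq> W" "W \<subseteq> V - (A \<union> B) - {y}" "\<forall>w\<in>W. \<forall>v\<in>V. E w v \<longrightarrow> v \<in> W \<union> {y} \<union> A"
            "\<forall>v\<in>V - (A \<union> B) - {y} - W. \<not> E v y" using W[OF cy] by blast
          define Z where "Z = V - {x, y, a} - W"
          have u0B: "u0 \<in> B" using u0 U by blast
          have Z: "u0 \<in> Z" "Z \<subseteq> V - {x, y, a}" "Z \<subseteq> V - {x, y}" "a \<notin> Z"
            using u0V u0B W(2) Axa unfolding Z_def by auto
          have clZ: "v \<in> Z \<union> {x, a, y}" if "d \<in> Z" "v \<in> V" "E d v" for d v
          proof (rule ccontr)
            assume n: "v \<notin> Z \<union> {x, a, y}"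
            then have "v \<in> W" using that unfolding Z_def by auto
            then have "d \<in> W \<union> {y} \<union> A" using W(3) that E_sym unfolding Z_def by blast
            then show False using that(1) Axa unfolding Z_def by auto
          qed
          show False
          proof (cases "\<exists>z\<in>Z. E z y")
            case no: False
            have cl': "v \<in> Z \<union> {x, a}" if "d \<in> Z" "v \<in> V" "E d v" for d v using clZ[OF that] no that by auto
            have dk: "deg_ok E V k d" if "d \<in> Z" for d using dok that Z(3) by blast
            have "Z \<noteq> {}" using Z(1) by blast
            show False by (rule reduce_x[OF \<open>Z \<noteq> {}\<close> Z(3) aV(1,2) Z(4) cl' dk, where ?v0.0 = y])
              (use Z aV in auto)
          next
            case True
            then obtain z where z: "z \<in> Z" "E z y" by blast
            show False
            proof (cases "3 \<le> k")
              case k3: True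
              show False
              proof (rule three_cut[OF dok aV D(1) Da D(3) _ _ _ clZ k3])
                show "v \<in> D \<union> {x, a, y}" if "d \<in> D" "v \<in> V" "E d v" for d v using clD[OF that] Axa cy by auto
                show "Z \<noteq> {}" using Z by blast
                show "Z \<subseteq> V - {x, y, a} - D" using Z W(1) unfolding Z_def by auto
              qed
            next
              case k2: False
              have zB: "z \<in> B" using z W(4) Z(2) Axa unfolding Z_def by auto
              have "1 + 2 * i \<in> path_lens E (A \<union> B) x z" if "i < k" for i
                by (rule bip_lens[OF fin A(1) B(2) AB zB cAB]) (use that k2 s2 in auto)
              then have "adm k (path_lens E (A \<union> B) x z)" unfolding adm_def by blast
              then show False by (rule direct[rotated 3]) (use z Z A B in auto)
            qed
          qed
        qed
      qed
    qed
  qed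
  have main: False
    if U: "U \<subseteq> B" "card A \<le> card U" and t: "t \<in> V - (A \<union> U)" and R: "R \<subseteq> V - (A \<union> B) - {y}" "t \<notin> R"
      and p0: "p0 \<in> R" "E p0 t"
      and cl: "\<And>p v. p \<in> R \<Longrightarrow> v \<in> V \<Longrightarrow> E p v \<Longrightarrow> v \<in> R \<union> {t} \<union> (A \<union> U)"
      and nbd: "\<And>p. p \<in> R \<Longrightarrow> card (nb E B p) \<le> card A"
      and tail: "t \<noteq> y \<Longrightarrow> \<exists>r S. r \<in> path_lens E S t y \<and> S \<subseteq> V - (A \<union> U) - R"
      and ty: "t = y \<Longrightarrow> R = V - (A \<union> B) - {y}" for U t R p0
  proof -
    have finU: "finite U" using U fin finite_subset by blast
    have AU: "\<forall>a\<in>A. \<forall>u\<in>U. E a u \<and> E u a" "A \<inter> U = {}" "A \<union> U - U = A" using AB B U by blast+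
    show False
    proof (rule region_step[where R = R and Q = "A \<union> U" and U = U and t = t and ?p0.0 = p0 and l = "card A - 1" and s = 2 and b = 1])
      show "v \<in> R \<union> {t} \<union> (A \<union> U)" if "p \<in> R" "v \<in> V" "E p v" for p v by (rule cl[OF that])
      show "deg_ok E V k p" if "p \<in> R" for p using dok that R A(1) by blast
      show "card (nb E (A \<union> U) p) \<le> card A - 1 + (if \<exists>u\<in>U. E p u then 1 else 0)" if p: "p \<in> R" for p
      proof -
        have pR: "p \<in> V - (A \<union> B) - {y}" using p R by blast
        show ?thesis
        proof (cases "\<exists>u\<in>U. E p u")
          case True
          then have "nb E (A \<union> U) p \<subseteq> nb E B p" using f2[OF pR] U(1) by (auto simp: nb_def)
          then have "card (nb E (A \<union> U) p) \<le> card (nb E B p)" by (rule card_mono[rotated]) (use fin in auto)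
          then show ?thesis using nbd[OF p] True s1 by simp
        next
          case False
          then have "nb E (A \<union> U) p = nb E A p" by (auto simp: nb_def)
          then show ?thesis using f1c[OF pR] by simp
        qed
      qed
      show "1 + 2 * j \<in> path_lens E (A \<union> U) x u" if "u \<in> U" "j \<le> card A - 1" for u j
        by (rule bip_lens[OF fin(1) finU A(1) AU(2,1) that(1) U(2)]) (use that s1 in auto)
      show "\<exists>r S. r \<in> path_lens E S t y \<and> S \<subseteq> V - (A \<union> U) - R" if "t \<noteq> y" by (rule tail[OF that])
      show False if D: "D \<noteq> {}" "D \<subseteq> R" "conn_set E D" "c \<in> V - (A \<union> U) - D"
        and clD: "\<And>d v. d \<in> D \<Longrightarrow> v \<in> V \<Longrightarrow> E d v \<Longrightarrow> v \<in> D \<union> {c} \<union> (A \<union> U - U)"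
        and ac: "\<exists>d\<in>D. E d c"
        and tail: "c \<noteq> y \<Longrightarrow> \<exists>r S. r \<in> path_lens E S c y \<and> S \<subseteq> V - (A \<union> U) - D"
        and W: "c = y \<Longrightarrow> t = y \<and> (\<exists>W. D \<subseteq> W \<and> W \<subseteq> R \<and> (\<forall>w\<in>W. \<forall>v\<in>V. E w v \<longrightarrow> v \<in> W \<union> {y} \<union> (A \<union> U - U)) \<and>
             (\<forall>v\<in>R - W. \<not> E v y))" for D c
      proof (rule hang[OF U D(1) _ D(3,4) _ ac tail])
        show "D \<subseteq> V - (A \<union> B) - {y}" using D R by auto
        show "v \<in> D \<union> {c} \<union> A" if "d \<in> D" "v \<in> V" "E d v" for d v using clD[OF that] AU(3) by simp
        show "\<exists>W. D \<subseteq> W \<and> W \<subseteq> V - (A \<union> B) - {y} \<and> (\<forall>w\<in>W. \<forall>v\<in>V. E w v \<longrightarrow> v \<in> W \<union> {y} \<union> A) \<and>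
           (\<forall>v\<in>V - (A \<union> B) - {y} - W. \<not> E v y)" if cy: "c = y"
        proof -
          have "t = y" using W[OF cy] by blast
          then have Re: "R = V - (A \<union> B) - {y}" by (rule ty)
          show ?thesis using W[OF cy] unfolding AU(3) Re by (rule conjunct2)
        qed
      qed
    qed (use U A B AU t R p0 in auto)
  qed
  show False
  proof (cases "\<exists>w\<in>V - (A \<union> B) - {y}. \<not> card (nb E B w) \<le> card A")
    case False
    obtain z where z: "z \<in> V - (A \<union> B)" "E z y" using zy by blast
    have "z \<noteq> y" using z by auto
    show False
      by (rule main[of B y "V - (A \<union> B) - {y}" z]) (use z \<open>z \<noteq> y\<close> False A B cAB in auto)
  next
    case True
    then obtain w where w: "w \<in> V - (A \<union> B) - {y}" "\<not> card (nb E B w) \<le> card A" by blast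
    have yw: "z \<in> insert w (A \<union> B)" if "z \<in> V" "E z y" for z using bad[OF w] that by blast
    have wy: "E w y" using yw zy by blast
    have wV: "w \<in> V" "w \<notin> A" "w \<notin> B" "w \<noteq> x" "w \<noteq> y" using w A by auto
    define R where "R = V - (A \<union> B) - {y, w}"
    have nbd: "card (nb E B p) \<le> card A" if p: "p \<in> R" for p
    proof (rule ccontr)
      assume "\<not> ?thesis"
      then have "w \<in> insert p (A \<union> B)" using bad[of p] p wV wy unfolding R_def by blast
      then show False using p wV unfolding R_def by auto
    qed
    have noy: "\<not> E p y" if "p \<in> R" for p using yw[of p] that unfolding R_def by blast
    have py: "1 \<in> path_lens E {w, y} w y" using path_lensI[of E "{w, y}" "[w, y]" 1] wy wV by (simp add: gpath_def)
    show False
    proof (cases "\<exists>p\<in>R. E p w")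
      case True
      then obtain p where p: "p \<in> R" "E p w" by blast
      show False
      proof (rule main[of B w R p])
        show "v \<in> R \<union> {w} \<union> (A \<union> B)" if "p \<in> R" "v \<in> V" "E p v" for p v
          using that noy unfolding R_def by auto
        show "\<exists>r S. r \<in> path_lens E S w y \<and> S \<subseteq> V - (A \<union> B) - R"
          using py wV A B unfolding R_def by (intro exI[of _ 1] exI[of _ "{w, y}"]) auto
      qed (use p nbd wV cAB in \<open>auto simp: R_def\<close>)
    next
      case noP: False
      \<comment> \<open>As \<open>w\<close> has no neighbour in the region, a neighbour
        \<open>b\<close> of \<open>w\<close> in \<open>B\<close> becomes the target, with tail
        \<open>b w y\<close>. The set \<open>B - {b}\<close> is still as large as \<open>A\<close>,
        because \<open>w\<close> has more than \<open>card A\<close> neighbours in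
        \<open>B\<close>.\<close>
      have "nb E B w \<noteq> {}" using w(2) by force
      then obtain b where b: "b \<in> B" "E w b" by auto
      have bV: "b \<in> V" "b \<noteq> x" "b \<noteq> y" "b \<notin> A" "b \<noteq> w" using b Bx B wV by auto
      define B2 where "B2 = nb E B w"
      have B2: "card A < card B2" "B2 \<subseteq> B" "b \<in> B2" "finite B2" using w(2) b fin unfolding B2_def by (auto simp: nb_def)
      have cB2: "card B2 \<le> card B" using B2 fin by (simp add: card_mono)
      show False
      proof (cases "\<exists>p\<in>R. E p b")
        case True
        then obtain p where p: "p \<in> R" "E p b" by blast
        show False
        proof (rule main[of "B - {b}" b R p])
          show "card A \<le> card (B - {b})" using B2 cB2 b fin by simp
          show "v \<in> R \<union> {b} \<union> (A \<union> (B - {b}))" if "p \<in> R" "v \<in> V" "E p v" for p v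
            using that noy noP unfolding R_def by auto
          have "gpath E {b, w, y} [b, w, y]" using b bV wy wV E_sym by (auto simp: gpath_def)
          from path_lensI[OF this, of 2] have "2 \<in> path_lens E {b, w, y} b y" by simp
          then show "\<exists>r S. r \<in> path_lens E S b y \<and> S \<subseteq> V - (A \<union> (B - {b})) - R"
            using wV bV A B b unfolding R_def by (intro exI[of _ 2] exI[of _ "{b, w, y}"]) auto
        qed (use p nbd bV b in \<open>auto simp: R_def\<close>)
      next
        case noB: False
        have nbb: "v \<in> A \<union> {y, w}" if "v \<in> V" "E b v" for v
        proof (rule ccontr)
          assume n: "v \<notin> A \<union> {y, w}"
          have "v \<notin> B" using Bindep[of b v] b that by blast
          then have "v \<in> R" using n that unfolding R_def by auto
          then show False using noB that E_sym by blast
        qed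
        have db: "k + 1 \<le> card (nb E V b)" using dok[of b] bV k_ge unfolding deg_ok_def by auto
        show False
        \<comment> \<open>The neighbours of \<open>b\<close> are confined to \<open>A\<close>,
          \<open>y\<close> and \<open>w\<close>, which bounds \<open>k\<close> by the size of
          \<open>A\<close>. If \<open>b\<close> is adjacent to \<open>y\<close>, adding
          \<open>w\<close> to \<open>A\<close> yields enough paths to \<open>b\<close>; otherwise
          paths to \<open>b\<close> are prolonged to \<open>w\<close>.\<close>
        proof (cases "E b y")
          case True
          have "nb E V b \<subseteq> A \<union> {y, w}" using nbb by (auto simp: nb_def)
          then have "card (nb E V b) \<le> card (A \<union> {y, w})" by (rule card_mono[rotated]) (use fin in auto)
          also have "\<dots> \<le> card A + card {y, w}" by (rule card_Un_le)
          also have "card {y, w} = 2" using wV by simp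
          finally have kk: "k \<le> card A + 1" using db by simp
          have cw: "card (insert w A) = Suc (card A)" using fin wV by simp
          have "1 + 2 * i \<in> path_lens E (insert w A \<union> B2) x b" if "i < k" for i
          proof (rule bip_lens)
            show "\<forall>a\<in>insert w A. \<forall>u\<in>B2. E a u \<and> E u a"
              using AB B2(2) E_sym unfolding B2_def by auto
          qed (use fin B2 A B wV cw kk that in auto)
          then have "adm k (path_lens E (insert w A \<union> B2) x b)" unfolding adm_def by blast
          then show False by (rule direct[rotated 3]) (use bV True wV A B B2 in auto)
        next
          case False
          have "nb E V b \<subseteq> insert w A" using nbb False by (auto simp: nb_def)
          then have "card (nb E V b) \<le> card (insert w A)" by (rule card_mono[rotated]) (use fin in auto)
          then have kk: "k \<le> card A" using db wV fin by simp
          have 1: "1 + 2 * i \<in> path_lens E (A \<union> B) x b" if "i < k" for i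
            by (rule bip_lens[OF fin A(1) B(2) AB b(1) cAB]) (use that kk in auto)
          have "2 + 2 * i \<in> path_lens E (insert w (A \<union> B)) x w" if "i < k" for i
            using path_lens_snoc[OF 1[OF that], of w] b wV E_sym by auto
          then have "adm k (path_lens E (insert w (A \<union> B)) x w)" unfolding adm_def by blast
          then show False by (rule direct[rotated 3]) (use wV wy A B in auto)
        qed
      qed
    qed
  qed
qed

end

text \<open>\<open>biclique_case\<close> already rests on the exclusion of cliques and books, so it
  alone refutes a minimal counterexample.\<close>

theorem rooted_linked:
  fixes E :: "'a \<Rightarrow> 'a \<Rightarrow> bool"
  assumes "symp E" "irreflp E" "rooted E V x y" "V \<noteq> {x, y}" "\<And>v. v \<in> V - {x, y} \<Longrightarrow> deg_ok E V k v"
  shows "linked E V x y k"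
  using assms
proof (induction "card V" arbitrary: E V x y k rule: less_induct)
  case less
  show ?case
  proof (rule ccontr)
    assume n: "\<not> linked E V x y k"
    interpret minimal_unlinked E V x y k
    proof unfold_locales
      show "linked E' V' x' y' k'" if "card V' < card V" "symp E'" "irreflp E'" "rooted E' V' x' y'"
        "V' \<noteq> {x', y'}" "\<And>v. v \<in> V' - {x', y'} \<Longrightarrow> deg_ok E' V' k' v" for E' :: "'a \<Rightarrow> 'a \<Rightarrow> bool" and V' x' y' k'
        using less.hyps[OF that] .
    qed (use less.prems n in auto)
    show False using biclique_case less.prems(5) by blast
  qed
qed

subsection \<open>Cycles through triangles\<close>

definition cycle_len :: "('a \<Rightarrow> 'a \<Rightarrow> bool) \<Rightarrow> 'a set \<Rightarrow> nat \<Rightarrow> bool" where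
  "cycle_len E V n \<longleftrightarrow> 3 \<le> n \<and> (\<exists>xs. gpath E V xs \<and> E (last xs) (hd xs) \<and> length xs = n)"

definition consec :: "nat \<Rightarrow> nat set \<Rightarrow> bool" where
  "consec k S \<longleftrightarrow> (\<exists>l. \<forall>i<k. l + i \<in> S)"

lemma cycle_len_mono: "cycle_len E S n \<Longrightarrow> S \<subseteq> T \<Longrightarrow> cycle_len E T n"
  unfolding cycle_len_def gpath_def by blast

text \<open>The bound on \<open>m + n\<close> excludes going back and forth along one edge.\<close>

lemma cycle_join:
  assumes "m \<in> path_lens E S a b" "n \<in> path_lens E T b a" "S \<inter> T \<subseteq> {a, b}" "a \<noteq> b" "3 \<le> m + n"
  shows "cycle_len E (S \<union> T) (m + n)"
proof -
  obtain xs where xs: "gpath E S xs" "hd xs = a" "last xs = b" "length xs = Suc m"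
    using assms(1) by (rule path_lensE)
  obtain ys where ys: "gpath E T ys" "hd ys = b" "last ys = a" "length ys = Suc n"
    using assms(2) by (rule path_lensE)
  obtain zs where zs: "ys = b # zs @ [a]"
  proof -
    obtain ys1 where 1: "ys = b # ys1" using ys(1,2) unfolding gpath_def by (cases ys) auto
    have "ys1 \<noteq> []" using 1 ys(3) assms(4) by auto
    then have "ys1 = butlast ys1 @ [a]" using 1 ys(3) by (metis append_butlast_last_id last_ConsR)
    then show ?thesis using 1 that by metis
  qed
  have xn: "xs \<noteq> []" using xs(1) unfolding gpath_def by simp
  have dis: "set xs \<inter> set zs = {}" using xs(1) ys(1) zs assms(3) unfolding gpath_def by auto
  have suc: "successively E (b # zs @ [a])" using ys(1) zs unfolding gpath_def by simp
  have "gpath E (S \<union> T) (xs @ zs)"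
    using xs ys zs dis suc xn unfolding gpath_def
    by (auto simp: successively_append_iff successively_Cons split: if_splits)
  moreover have "E (last (xs @ zs)) (hd (xs @ zs))"
    using suc xs xn by (cases "zs = []") (auto simp: successively_Cons successively_append_iff)
  moreover have "length (xs @ zs) = m + n" using xs(4) ys(4) zs by simp
  ultimately show ?thesis using assms(5) unfolding cycle_len_def by blast
qed

text \<open>The sums fill \<open>c + l\<close> consecutive values for difference 1 and
  \<open>2 * c - 1 + l\<close> for difference 2; these are the two bounds on \<open>k\<close>.
  Unlike for paths, the final lengths must have difference 1.\<close>

lemma consec_interval:
  assumes "adm c L" "1 \<le> c" "1 \<le> l" "k \<le> c + l" "k + 1 \<le> 2 * c + l"
    and M: "\<And>n j. n \<in> L \<Longrightarrow> j \<le> l \<Longrightarrow> n + (b + j) \<in> M"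
  shows "consec k M"
proof -
  obtain a d where d: "d = 1 \<or> d = 2" and L: "\<And>i. i < c \<Longrightarrow> a + d * i \<in> L"
    using assms(1) unfolding adm_def by auto
  have "a + b + i \<in> M" if i: "i < k" for i
  proof (cases "d = 1")
    case True
    define p where "p = min i (c - 1)"
    have "p < c" "i - p \<le> l" "p \<le> i" using assms(2,4) i unfolding p_def by auto
    then show ?thesis using M[OF L[of p], of "i - p"] True by (simp add: algebra_simps)
  next
    case False
    then have d2: "d = 2" using d by simp
    define p where "p = min (i div 2) (c - 1)"
    have "p < c" using assms(2) unfolding p_def by auto
    moreover have "i - 2 * p \<le> l" using assms(2,3,5) i unfolding p_def by (auto simp: min_def)
    moreover have "2 * p \<le> i" unfolding p_def by auto
    ultimately show ?thesis using M[OF L[of p], of "i - 2 * p"] d2 by (simp add: algebra_simps)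
  qed
  then show ?thesis unfolding consec_def by blast
qed

text \<open>\<open>contract_roots\<close> with the path theorem in place of the induction
  hypothesis, so the size bound becomes harmless.\<close>

lemma contracted_paths:
  fixes E :: "'a \<Rightarrow> 'a \<Rightarrow> bool"
  assumes "symp E" "irreflp E" "finite P" "P \<noteq> {}" "conn_set E P"
    "U \<inter> P = {}" "T \<inter> P = {}" "U \<inter> T = {}"
    and aU: "\<exists>p\<in>P. \<exists>u\<in>U. E p u" and aT: "\<exists>p\<in>P. \<exists>t\<in>T. E p t"
    and nohang: "\<And>D c. D \<noteq> {} \<Longrightarrow> D \<subseteq> P \<Longrightarrow> c \<in> P - D \<Longrightarrow> \<exists>d\<in>D. \<exists>v\<in>P \<union> U \<union> T - D - {c}. E d v"
    and deg: "\<And>p. p \<in> P \<Longrightarrow> k \<le> 1 \<or> k + 1 \<le> card (nb E P p) +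
        (if \<exists>u\<in>U. E p u then 1 else 0) + (if \<exists>t\<in>T. E p t then 1 else 0)"
  shows "\<exists>t'\<in>P. (\<exists>t\<in>T. E t' t) \<and> adm k (\<Union>u\<in>U. path_lens E (insert u P) u t')"
proof -
  obtain p u where pu: "p \<in> P" "u \<in> U" "E p u" using aU by blast
  obtain p' t where pt: "p' \<in> P" "t \<in> T" "E p' t" using aT by blast
  have c: "card P + 2 < card P + 3" by simp
  show ?thesis
    by (rule contract_roots[OF rooted_linked assms(1-5) c assms(6-8) pu pt nohang deg]) blast+
qed

text \<open>\<open>con3\<close> is 3-connectivity in the form in which it is applied: at most two
  vertices never cut off a set; \<open>a = b\<close> is allowed.\<close>

locale tricon =
  fixes E :: "'a \<Rightarrow> 'a \<Rightarrow> bool" and V :: "'a set" and k :: nat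
  assumes sym: "symp E" and irrefl: "irreflp E" and finV: "finite V"
    and con3: "\<And>D a b. D \<noteq> {} \<Longrightarrow> D \<subseteq> V - {a, b} \<Longrightarrow> V - D - {a, b} \<noteq> {} \<Longrightarrow> \<exists>d\<in>D. \<exists>v\<in>V - D - {a, b}. E d v"
    and mindeg: "\<And>v. v \<in> V \<Longrightarrow> k \<le> card (nb E V v)" and k6: "6 \<le> k"
begin

lemma E_sym: "E a b \<Longrightarrow> E b a" using sym by (rule sympD)

lemma E_irrefl [simp]: "\<not> E a a" using irrefl by (rule irreflpD)

text \<open>A small dense subgraph is split into \<open>X\<close> and \<open>Y\<close>, the two
  roots over a component \<open>P\<close> of the rest. The \<open>c\<close> lengths through
  \<open>P\<close> are closed up by \<open>l + 1\<close> consecutive lengths inside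
  \<open>X \<union> Y\<close>. Of the neighbours of \<open>p\<close> in \<open>X \<union> Y\<close>
  one per part survives the contraction; comparing what is left of the degree \<open>k\<close> with
  the demand \<open>c + 1\<close> gives \<open>deg\<close>.\<close>

lemma split_consec:
  assumes X: "X \<subseteq> V" "Y \<subseteq> V" "X \<inter> Y = {}" and P: "P \<subseteq> V - (X \<union> Y)" "P \<noteq> {}" "conn_set E P"
    "\<And>p w. p \<in> P \<Longrightarrow> w \<in> V - (X \<union> Y) \<Longrightarrow> E p w \<Longrightarrow> w \<in> P"
    and aX: "\<exists>p\<in>P. \<exists>u\<in>X. E p u" and aY: "\<exists>p\<in>P. \<exists>u\<in>Y. E p u" and two: "\<And>c. \<exists>q\<in>X \<union> Y. q \<noteq> c"
    and deg: "\<And>p. p \<in> P \<Longrightarrow> c \<le> 1 \<or> c + 1 + card (nb E (X \<union> Y) p) \<le> k +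
        (if \<exists>u\<in>X. E p u then 1 else 0) + (if \<exists>t\<in>Y. E p t then 1 else 0)"
    and arith: "1 \<le> c" "1 \<le> l" "k \<le> c + l" "k + 1 \<le> 2 * c + l"
    and close: "\<And>a b j. a \<in> X \<Longrightarrow> b \<in> Y \<Longrightarrow> j \<le> l \<Longrightarrow> 1 + j \<in> path_lens E (X \<union> Y) b a"
  shows "consec k {n. cycle_len E V n}"
proof -
  have finP: "finite P" "finite (X \<union> Y)" using P X finV by (auto intro: finite_subset)
  have "\<exists>t'\<in>P. (\<exists>t\<in>Y. E t' t) \<and> adm c (\<Union>u\<in>X. path_lens E (insert u P) u t')"
  proof (rule contracted_paths[OF sym irrefl finP(1) P(2,3) _ _ X(3) aX aY])
    show "\<exists>d\<in>D. \<exists>v\<in>P \<union> X \<union> Y - D - {e}. E d v" if D: "D \<noteq> {}" "D \<subseteq> P" "e \<in> P - D" for D e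
    proof -
      obtain q where "q \<in> X \<union> Y" "q \<noteq> e" using two by blast
      then have "V - D - {e, e} \<noteq> {}" using X P D by blast
      then have "\<exists>d\<in>D. \<exists>v\<in>V - D - {e, e}. E d v" using con3[of D e e] D P by blast
      then obtain d v where "d \<in> D" "v \<in> V - D - {e}" "E d v" by blast
      then show ?thesis using P(4)[of d v] D by blast
    qed
    show "c \<le> 1 \<or> c + 1 \<le> card (nb E P p) + (if \<exists>u\<in>X. E p u then 1 else 0) + (if \<exists>t\<in>Y. E p t then 1 else 0)"
      if p: "p \<in> P" for p
    proof -
      have "nb E V p = nb E P p \<union> nb E (X \<union> Y) p"
      proof
        show "nb E V p \<subseteq> nb E P p \<union> nb E (X \<union> Y) p" using P(4)[OF p] unfolding nb_def by blast
        show "nb E P p \<union> nb E (X \<union> Y) p \<subseteq> nb E V p" using P(1) X unfolding nb_def by blast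
      qed
      moreover have "nb E P p \<inter> nb E (X \<union> Y) p = {}" using P(1) unfolding nb_def by blast
      ultimately have "card (nb E V p) = card (nb E P p) + card (nb E (X \<union> Y) p)"
        using finP by (simp add: card_Un_disjoint)
      moreover have "k \<le> card (nb E V p)" using mindeg p P(1) by blast
      ultimately show ?thesis using deg[OF p] by linarith
    qed
  qed (use P(1) in auto)
  then obtain t' b where t': "t' \<in> P" "b \<in> Y" "E t' b" and a: "adm c (\<Union>u\<in>X. path_lens E (insert u P) u t')"
    by blast
  show ?thesis
  \<comment> \<open>The shift 2 counts the edge from \<open>t'\<close> to \<open>b\<close> and the 1
    in the closing length \<open>1 + j\<close>.\<close>
  proof (rule consec_interval[OF a arith, of 2])
    fix n j assume n: "n \<in> (\<Union>u\<in>X. path_lens E (insert u P) u t')" and j: "j \<le> l"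
    obtain u where u: "u \<in> X" "n \<in> path_lens E (insert u P) u t'" using n by blast
    have bu: "b \<notin> insert u P" "u \<noteq> b" using t'(2) u(1) P(1) X by auto
    have 1: "Suc n \<in> path_lens E (insert b (insert u P)) u b"
      by (rule path_lens_snoc[OF u(2) t'(3) bu(1)])
    have "n \<noteq> 0"
    proof
      assume "n = 0"
      then obtain xs where "hd xs = u" "last xs = t'" "length xs = Suc 0" using u(2) by (auto elim: path_lensE)
      then have "u = t'" by (cases xs) auto
      then show False using u(1) t'(1) P(1) by blast
    qed
    then have "cycle_len E (insert b (insert u P) \<union> (X \<union> Y)) (Suc n + (1 + j))"
      by (intro cycle_join[OF 1 close[OF u(1) t'(2) j]]) (use P(1) bu in auto)
    then have "cycle_len E V (Suc n + (1 + j))" by (rule cycle_len_mono) (use P(1) X u t' in auto)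
    then show "n + (2 + j) \<in> {n. cycle_len E V n}" by simp
  qed
qed

lemma clique_consec:
  assumes Q: "clique E Q" "Q \<subseteq> V" "k + 2 \<le> card Q"
  shows "consec k {n. cycle_len E V n}"
  unfolding consec_def
proof (intro exI[of _ 3] allI impI)
  fix i assume i: "i < k"
  have "3 + i \<le> card Q" using i Q by simp
  then obtain xs where xs: "distinct xs" "set xs \<subseteq> Q" "length xs = 3 + i" by (rule obtain_distinct_list)
  have ne: "xs \<noteq> []" using xs by auto
  have "hd xs \<noteq> last xs"
  proof -
    obtain z zs where z: "xs = z # zs" using ne by (cases xs) auto
    then have "zs \<noteq> []" using xs(3) by auto
    with z show ?thesis using xs(1) last_in_set[of zs] by auto
  qed
  moreover have "hd xs \<in> Q" "last xs \<in> Q" using xs(2) hd_in_set[OF ne] last_in_set[OF ne] by auto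
  ultimately have "E (last xs) (hd xs)" using Q(1) unfolding clique_def by metis
  then show "3 + i \<in> {n. cycle_len E V n}"
    using xs ne clique_successively[OF Q(1) xs(1,2)] Q(2) unfolding cycle_len_def gpath_def
    by (intro CollectI conjI exI[of _ xs]) auto
qed

text \<open>A maximal clique \<open>Q\<close> offers closing lengths 1 to \<open>card Q - 1\<close>,
  so \<open>c = k + 2 - card Q\<close> and \<open>l = card Q - 2\<close> add up to \<open>k\<close>.
  If \<open>Q\<close> is all of \<open>V\<close>, minimum degree and the failure of
  \<open>k + 2 \<le> card Q\<close> leave only the excluded complete graph.\<close>

lemma K4_consec:
  assumes Q0: "clique E Q0" "Q0 \<subseteq> V" "4 \<le> card Q0" and nK: "\<not> (clique E V \<and> card V = k + 1)"
  shows "consec k {n. cycle_len E V n}"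
proof -
  define F where "F = {Q. Q0 \<subseteq> Q \<and> Q \<subseteq> V \<and> clique E Q}"
  have "finite F" by (rule finite_subset[of _ "Pow V"]) (auto simp: F_def finV)
  moreover have "Q0 \<in> F" using Q0 unfolding F_def by blast
  ultimately obtain Q where QF: "Q \<in> F" and max: "\<forall>Q'\<in>F. Q \<subseteq> Q' \<longrightarrow> Q = Q'"
    using finite_has_maximal2[of F Q0] by blast
  have Q: "Q0 \<subseteq> Q" "Q \<subseteq> V" "clique E Q" using QF unfolding F_def by auto
  have finQ: "finite Q" using Q(2) finV finite_subset by blast
  have m4: "4 \<le> card Q" using Q0(3) card_mono[OF finQ Q(1)] by simp
  have bad: "\<exists>q\<in>Q. \<not> E w q" if "w \<in> V - Q" for w
  proof (rule ccontr)
    assume "\<not> ?thesis"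
    then have "clique E (insert w Q)" using Q(3) E_sym unfolding clique_def by blast
    then have "insert w Q \<in> F" using that Q unfolding F_def by blast
    then show False using max that by blast
  qed
  show ?thesis
  proof (cases "k + 2 \<le> card Q")
    case True then show ?thesis using clique_consec Q by blast
  next
    case m: False
    have "V - Q \<noteq> {}"
    proof
      assume "V - Q = {}"
      then have VQ: "V = Q" using Q by auto
      obtain v where v: "v \<in> V" using m4 VQ by (cases "Q = {}") auto
      have "nb E V v \<subseteq> V - {v}" by (auto simp: nb_def)
      then have "card (nb E V v) \<le> card (V - {v})" by (rule card_mono[rotated]) (use finV in auto)
      then have "k \<le> card V - 1" using mindeg[OF v] v finV by simp
      then show False using nK m VQ Q m4 by auto
    qed
    then obtain v0 where v0: "v0 \<in> V - Q" by blast
    obtain P where P: "v0 \<in> P" "P \<subseteq> V - Q" "conn_set E P" "\<And>p w. p \<in> P \<Longrightarrow> w \<in> V - Q \<Longrightarrow> E p w \<Longrightarrow> w \<in> P"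
      using component[OF sym v0] by metis
    have Pne: "P \<noteq> {}" using P by auto
    have att: "\<exists>d\<in>P. \<exists>q\<in>Q - {a, b}. E d q" if "a \<in> Q" "b \<in> Q" for a b
    proof -
      have "card (Q - {a, b}) \<ge> card Q - card {a, b}" by (rule diff_card_le_card_Diff) simp
      moreover have "card {a, b} \<le> 2" by (simp add: card_insert_if)
      ultimately have "Q - {a, b} \<noteq> {}" using m4 by (metis card.empty diff_is_0_eq le_zero_eq le_trans numeral_le_iff semiring_norm(68) semiring_norm(69) semiring_norm(71))
      then have "V - P - {a, b} \<noteq> {}" using Q P by blast
      then have "\<exists>d\<in>P. \<exists>v\<in>V - P - {a, b}. E d v" using con3[of P a b] P that Q by blast
      then obtain d v where "d \<in> P" "v \<in> V - P - {a, b}" "E d v" by blast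
      then show ?thesis using P(4)[of d v] by blast
    qed
    obtain q0 where q0: "q0 \<in> Q" using m4 by (cases "Q = {}") auto
    obtain d1 where d1: "d1 \<in> Q" "\<exists>d\<in>P. E d d1" using att[OF q0 q0] by blast
    obtain d2 where d2: "d2 \<in> Q" "d2 \<noteq> d1" "\<exists>d\<in>P. E d d2" using att[OF d1(1) d1(1)] by blast
    obtain e where e: "e \<in> Q" "e \<noteq> d1" "e \<noteq> d2" using att[OF d1(1) d2(1)] by blast
    \<comment> \<open>Two vertices are put into \<open>X\<close> so that a vertex seeing only
      \<open>Y\<close> has at most \<open>card Q - 2\<close> neighbours in \<open>Q\<close>. The
      vertices \<open>d1\<close> and \<open>d2\<close> ensure that \<open>P\<close> is attached to
      both parts.\<close>
    define X where "X = {d1, e}"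
    define Y where "Y = Q - X"
    have XY: "X \<union> Y = Q" "X \<inter> Y = {}" "d1 \<in> X" "d2 \<in> Y" "X \<subseteq> Q" "Y \<subseteq> Q" unfolding X_def Y_def using d1 d2 e by auto
    have cX: "card X = 2" using e unfolding X_def by simp
    have cY: "card Y = card Q - 2" unfolding Y_def using cX XY finQ by (simp add: card_Diff_subset finite_subset)
    have fXY: "finite X" "finite Y" using finQ XY finite_subset by blast+
    show ?thesis
    proof (rule split_consec[of X Y P "k + 2 - card Q" "card Q - 2"])
      show "\<exists>p\<in>P. \<exists>u\<in>X. E p u" "\<exists>p\<in>P. \<exists>u\<in>Y. E p u" using d1 d2 XY by blast+
      show "w \<in> P" if "p \<in> P" "w \<in> V - (X \<union> Y)" "E p w" for p w using P(4)[of p w] that XY by blast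
      show "\<exists>q\<in>X \<union> Y. q \<noteq> c" for c using d1 d2 XY(1) by metis
      show "k + 2 - card Q \<le> 1 \<or> k + 2 - card Q + 1 + card (nb E (X \<union> Y) p) \<le> k +
        (if \<exists>u\<in>X. E p u then 1 else 0) + (if \<exists>t\<in>Y. E p t then 1 else 0)" if p: "p \<in> P" for p
      proof -
        have sp: "card (nb E (X \<union> Y) p) = card (nb E X p) + card (nb E Y p)"
        proof -
          have "nb E (X \<union> Y) p = nb E X p \<union> nb E Y p" "nb E X p \<inter> nb E Y p = {}" using XY(2) by (auto simp: nb_def)
          then show ?thesis using fXY by (simp add: card_Un_disjoint)
        qed
        obtain q where q: "q \<in> Q" "\<not> E p q" using bad[of p] p P(2) by blast
        then have "nb E (X \<union> Y) p \<subseteq> Q - {q}" using XY(1) by (auto simp: nb_def)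
        then have "card (nb E (X \<union> Y) p) \<le> card (Q - {q})" by (rule card_mono[rotated]) (use finQ in auto)
        then have tot: "card (nb E (X \<union> Y) p) \<le> card Q - 1" using q finQ by simp
        have le: "card (nb E X p) \<le> 2" "card (nb E Y p) \<le> card Q - 2"
          using card_mono[of X "nb E X p"] card_mono[of Y "nb E Y p"] fXY cX cY by (auto simp: nb_def)
        have z: "card (nb E X p) = 0" if "\<not> (\<exists>u\<in>X. E p u)"
        proof - have "nb E X p = {}" using that by (auto simp: nb_def) then show ?thesis by simp qed
        have z': "card (nb E Y p) = 0" if "\<not> (\<exists>u\<in>Y. E p u)"
        proof - have "nb E Y p = {}" using that by (auto simp: nb_def) then show ?thesis by simp qed
        show ?thesis using sp tot le z z' m4 m by (auto split: if_splits)
      qed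
      show "1 + j \<in> path_lens E (X \<union> Y) b a" if "a \<in> X" "b \<in> Y" "j \<le> card Q - 2" for a b j
        unfolding XY(1) by (rule clique_lens[OF Q(3) finQ]) (use that XY m4 in auto)
    qed (use XY Q P Pne m m4 in auto)
  qed
qed

text \<open>Cliques with four vertices are covered by \<open>K4_consec\<close>. If \<open>u\<close>
  and \<open>v\<close> have a common neighbour \<open>w\<close> besides \<open>x\<close>, the
  diamond is split into \<open>{x, w}\<close> and \<open>{u, v}\<close>, between which there are
  paths of lengths 1, 2 and 3. Otherwise no outside vertex sees both \<open>u\<close> and
  \<open>v\<close>, so splitting the triangle loses nothing beyond the contraction, and lengths 1
  and 2 suffice.\<close>

lemma triangle_consec:
  assumes t: "x \<in> V" "u \<in> V" "v \<in> V" "E x u" "E x v" "E u v" and nK: "\<not> (clique E V \<and> card V = k + 1)"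
  shows "consec k {n. cycle_len E V n}"
proof (cases "\<exists>Q. clique E Q \<and> Q \<subseteq> V \<and> 4 \<le> card Q")
  case True then show ?thesis using K4_consec nK by blast
next
  case no: False
  have ne: "x \<noteq> u" "x \<noteq> v" "u \<noteq> v" using t by auto
  have nK4: False if "p \<in> V" "E p x" "E p u" "E p v" for p
  proof -
    have "p \<noteq> x" "p \<noteq> u" "p \<noteq> v" using that by auto
    then have "card {p, x, u, v} = 4" using ne by simp
    moreover have "clique E {p, x, u, v}" using that t E_sym unfolding clique_def by auto
    ultimately show False using no t that(1) by (metis empty_subsetI insert_subset order_refl)
  qed
  have big: "V - S \<noteq> {}" if "card S \<le> 4" "finite S" for S
  proof
    assume "V - S = {}"
    then have "nb E V x \<subseteq> S" by (auto simp: nb_def)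
    then have "card (nb E V x) \<le> card S" using that by (simp add: card_mono)
    then show False using mindeg[OF t(1)] k6 that by simp
  qed
  show ?thesis
  proof (cases "\<exists>w\<in>V. w \<noteq> x \<and> E w u \<and> E w v")
    case True
    then obtain w where w: "w \<in> V" "w \<noteq> x" "E w u" "E w v" by blast
    have wn: "w \<noteq> u" "w \<noteq> v" using w by auto
    define X where "X = {x, w}"
    define Y where "Y = {u, v}"
    have XY: "X \<inter> Y = {}" "X \<subseteq> V" "Y \<subseteq> V" "finite X" "finite Y" unfolding X_def Y_def using ne wn t w by auto
    have "card (X \<union> Y) \<le> 4" unfolding X_def Y_def by (simp add: card_insert_if)
    then obtain v0 where v0: "v0 \<in> V - (X \<union> Y)" using big[of "X \<union> Y"] XY by auto
    obtain P where P: "v0 \<in> P" "P \<subseteq> V - (X \<union> Y)" "conn_set E P" "\<And>p w. p \<in> P \<Longrightarrow> w \<in> V - (X \<union> Y) \<Longrightarrow> E p w \<Longrightarrow> w \<in> P"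
      using component[OF sym v0] by metis
    have aY: "\<exists>p\<in>P. \<exists>t\<in>Y. E p t"
    proof -
      have "\<exists>d\<in>P. \<exists>z\<in>V - P - {x, w}. E d z" by (rule con3) (use P(1,2) XY t ne wn in \<open>auto simp: X_def Y_def\<close>)
      then show ?thesis using P(4) unfolding X_def by blast
    qed
    have aX: "\<exists>p\<in>P. \<exists>t\<in>X. E p t"
    proof -
      have "\<exists>d\<in>P. \<exists>z\<in>V - P - {u, v}. E d z" by (rule con3) (use P(1,2) XY t ne wn in \<open>auto simp: X_def Y_def\<close>)
      then show ?thesis using P(4) unfolding Y_def by blast
    qed
    show ?thesis
    proof (rule split_consec[OF XY(2,3,1) P(2) _ P(3,4) aX aY, where c = "k - 2" and l = 2])
      show "\<exists>q\<in>X \<union> Y. q \<noteq> c" for c using ne unfolding X_def Y_def by auto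
      show "k - 2 \<le> 1 \<or> k - 2 + 1 + card (nb E (X \<union> Y) p) \<le> k +
        (if \<exists>u\<in>X. E p u then 1 else 0) + (if \<exists>t\<in>Y. E p t then 1 else 0)" if p: "p \<in> P" for p
      proof -
        have pV: "p \<in> V" using p P(2) by auto
        have n: "\<not> (E p x \<and> E p u \<and> E p v)" using nK4[OF pV] by blast
        have "nb E (X \<union> Y) p = (if E p x then {x} else {}) \<union> (if E p w then {w} else {}) \<union> (if E p u then {u} else {}) \<union> (if E p v then {v} else {})"
          unfolding X_def Y_def by (auto simp: nb_def)
        then have "card (nb E (X \<union> Y) p) = (if E p x then 1 else 0) + (if E p w then 1 else 0) + (if E p u then 1 else 0) + (if E p v then 1 else 0)"
          using ne wn w(2) by auto
        then show ?thesis using n k6 unfolding X_def Y_def by auto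
      qed
      show "1 + j \<in> path_lens E (X \<union> Y) b a" if ab: "a \<in> X" "b \<in> Y" and j: "j \<le> 2" for a b j
      proof -
        define a' where "a' = (if a = x then w else x)"
        define b' where "b' = (if b = u then v else u)"
        have 1: "X = {a, a'}" "Y = {b, b'}" "a \<noteq> a'" "b \<noteq> b'" "a \<noteq> b" "a \<noteq> b'" "a' \<noteq> b" "a' \<noteq> b'"
          using ab w(2) ne wn unfolding X_def Y_def a'_def b'_def by auto
        have 2: "E a b" "E a' b" "E a b'" "E a' b'" "E b b'" "E b a" "E b a'" "E b' a" "E b' a'"
          using ab t w E_sym unfolding X_def Y_def a'_def b'_def by auto
        have "gpath E (X \<union> Y) [b, a]" "gpath E (X \<union> Y) [b, b', a]" "gpath E (X \<union> Y) [b, a', b', a]"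
          using 1 2 unfolding gpath_def by auto
        then have "1 \<in> path_lens E (X \<union> Y) b a" "2 \<in> path_lens E (X \<union> Y) b a" "3 \<in> path_lens E (X \<union> Y) b a"
          using path_lensI[of E "X \<union> Y" "[b, a]" 1] path_lensI[of E "X \<union> Y" "[b, b', a]" 2] path_lensI[of E "X \<union> Y" "[b, a', b', a]" 3] by auto
        moreover have "j = 0 \<or> j = 1 \<or> j = 2" using j by auto
        ultimately show ?thesis by (auto simp: numeral_2_eq_2 numeral_3_eq_3)
      qed
    qed (use P(1) k6 in auto)
  next
    case False
    define X where "X = {x}"
    define Y where "Y = {u, v}"
    have XY: "X \<inter> Y = {}" "X \<subseteq> V" "Y \<subseteq> V" "finite X" "finite Y" unfolding X_def Y_def using ne t by auto
    have "card (X \<union> Y) \<le> 4" unfolding X_def Y_def by (simp add: card_insert_if)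
    then obtain v0 where v0: "v0 \<in> V - (X \<union> Y)" using big[of "X \<union> Y"] XY by auto
    obtain P where P: "v0 \<in> P" "P \<subseteq> V - (X \<union> Y)" "conn_set E P" "\<And>p w. p \<in> P \<Longrightarrow> w \<in> V - (X \<union> Y) \<Longrightarrow> E p w \<Longrightarrow> w \<in> P"
      using component[OF sym v0] by metis
    have aY: "\<exists>p\<in>P. \<exists>t\<in>Y. E p t"
    proof -
      have "\<exists>d\<in>P. \<exists>z\<in>V - P - {x, x}. E d z" by (rule con3) (use P(1,2) XY t ne in \<open>auto simp: X_def Y_def\<close>)
      then show ?thesis using P(4) unfolding X_def by blast
    qed
    have aX: "\<exists>p\<in>P. \<exists>t\<in>X. E p t"
    proof -
      have "\<exists>d\<in>P. \<exists>z\<in>V - P - {u, v}. E d z" by (rule con3) (use P(1,2) XY t ne in \<open>auto simp: X_def Y_def\<close>)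
      then show ?thesis using P(4) unfolding Y_def by blast
    qed
    show ?thesis
    proof (rule split_consec[OF XY(2,3,1) P(2) _ P(3,4) aX aY, where c = "k - 1" and l = 1])
      show "\<exists>q\<in>X \<union> Y. q \<noteq> c" for c using ne unfolding X_def Y_def by auto
      show "k - 1 \<le> 1 \<or> k - 1 + 1 + card (nb E (X \<union> Y) p) \<le> k +
        (if \<exists>u\<in>X. E p u then 1 else 0) + (if \<exists>t\<in>Y. E p t then 1 else 0)" if p: "p \<in> P" for p
      proof -
        have n: "\<not> (E p u \<and> E p v)" using False p P(2) XY(2) unfolding X_def by blast
        have "nb E (X \<union> Y) p = (if E p x then {x} else {}) \<union> (if E p u then {u} else {}) \<union> (if E p v then {v} else {})"
          unfolding X_def Y_def by (auto simp: nb_def)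
        then have "card (nb E (X \<union> Y) p) = (if E p x then 1 else 0) + (if E p u then 1 else 0) + (if E p v then 1 else 0)"
          using ne by auto
        then show ?thesis using n k6 unfolding X_def Y_def by auto
      qed
      show "1 + j \<in> path_lens E (X \<union> Y) b a" if ab: "a \<in> X" "b \<in> Y" and j: "j \<le> 1" for a b j
      proof -
        have "clique E (X \<union> Y)" using t E_sym unfolding X_def Y_def clique_def by auto
        moreover have "card (X \<union> Y) = 3" using ne unfolding X_def Y_def by simp
        ultimately show ?thesis by (intro clique_lens) (use ab j XY in auto)
      qed
    qed (use P(1) k6 in auto)
  qed
qed

end

subsection \<open>Odd cycles\<close>

text \<open>Cycles are indexed periodically by the integers, so that arcs are images of integer intervals.\<close>

definition ocyc :: "('a \<Rightarrow> 'a \<Rightarrow> bool) \<Rightarrow> int \<Rightarrow> (int \<Rightarrow> 'a) \<Rightarrow> bool" where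
  "ocyc E n w \<longleftrightarrow> 3 \<le> n \<and> (\<forall>i. w (i + n) = w i) \<and> (\<forall>i j. w i = w j \<longrightarrow> i mod n = j mod n) \<and>
     (\<forall>i. E (w i) (w (i + 1)))"

lemma ocyc_of_list:
  assumes "gpath E V xs" "E (last xs) (hd xs)" "length xs = m" "3 \<le> m"
  obtains w where "ocyc E (int m) w" "range w = set xs"
proof -
  define w where "w = (\<lambda>i. xs ! nat (i mod int m))"
  have m0: "0 < int m" using assms by simp
  have r: "nat (i mod int m) < m" for i using m0 by (simp add: nat_less_iff)
  have 1: "w (i + int m) = w i" for i unfolding w_def by simp
  have 2: "i mod int m = j mod int m" if "w i = w j" for i j
  proof -
    have "distinct xs" using assms(1) unfolding gpath_def by simp
    then have "nat (i mod int m) = nat (j mod int m)"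
      using that r[of i] r[of j] assms(3) unfolding w_def by (simp add: nth_eq_iff_index_eq)
    moreover have "0 \<le> i mod int m" "0 \<le> j mod int m" using m0 by auto
    ultimately show ?thesis by linarith
  qed
  have 3: "E (w i) (w (i + 1))" for i
  proof (cases "nat (i mod int m) + 1 < m")
    case True
    have nn: "0 \<le> i mod int m" using m0 by simp
    have lt: "i mod int m + 1 < int m" using True nn by linarith
    have "(i + 1) mod int m = (i mod int m + 1) mod int m" by (simp add: mod_add_left_eq)
    also have "\<dots> = i mod int m + 1" by (rule mod_pos_pos_trivial) (use nn lt in auto)
    finally have "(i + 1) mod int m = i mod int m + 1" .
    moreover note nn
    ultimately have e: "nat ((i + 1) mod int m) = Suc (nat (i mod int m))" by simp
    have "successively E xs" using assms(1) unfolding gpath_def by simp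
    from successively_nth[OF this, of "nat (i mod int m)"] True assms(3)
    show ?thesis unfolding w_def e by simp
  next
    case False
    then have "nat (i mod int m) = m - 1" using r[of i] by simp
    moreover have "0 \<le> i mod int m" using m0 by simp
    ultimately have im: "i mod int m = int m - 1" using assms(4) by linarith
    have "(i + 1) mod int m = (i mod int m + 1) mod int m" by (simp add: mod_add_left_eq)
    also have "\<dots> = 0" unfolding im by simp
    finally have "w (i + 1) = hd xs" unfolding w_def using assms(3,4) by (cases xs) auto
    moreover have "nat (i mod int m) = length xs - 1" using \<open>nat (i mod int m) = m - 1\<close> assms(3) by simp
    then have "w i = last xs" unfolding w_def using assms(3,4) by (metis last_conv_nth list.size(3) not_numeral_le_zero)
    ultimately show ?thesis using assms(2) by simp
  qed
  have "range w = set xs"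
  proof
    show "range w \<subseteq> set xs" unfolding w_def using r assms(3) by auto
    show "set xs \<subseteq> range w"
    proof
      fix v assume "v \<in> set xs"
      then obtain i where "i < m" "v = xs ! i" using assms(3) by (auto simp: in_set_conv_nth)
      then have "v = w (int i)" unfolding w_def by simp
      then show "v \<in> range w" by blast
    qed
  qed
  moreover have "ocyc E (int m) w" unfolding ocyc_def
    using assms(4) by (intro conjI allI impI 1 2 3) simp_all
  ultimately show ?thesis using that by blast
qed

lemma ocyc_mod: "ocyc E n w \<Longrightarrow> w (i mod n) = w i"
proof -
  assume o: "ocyc E n w"
  have per: "w (i + n * int m) = w i" for i m
  proof (induction m)
    case (Suc m)
    have "w (i + n * int (Suc m)) = w ((i + n * int m) + n)" by (simp add: algebra_simps)
    then show ?case using Suc o unfolding ocyc_def by metis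
  qed simp
  show ?thesis
  proof (cases "0 \<le> i div n")
    case True
    then show ?thesis using per[of "i mod n" "nat (i div n)"] by simp
  next
    case False
    have "i + n * (- (i div n)) = i mod n" using minus_mult_div_eq_mod[of i n] by simp
    then show ?thesis using per[of i "nat (- (i div n))"] False by (simp only: int_nat_eq) simp
  qed
qed

lemma ocyc_arc:
  assumes o: "ocyc E n w" and d: "0 \<le> d" "d < n"
  shows "nat d \<in> path_lens E (w ` {i..i + d}) (w i) (w (i + d))"
proof -
  define xs where "xs = map w [i..i + d]"
  have len: "length xs = Suc (nat d)" unfolding xs_def using d by simp
  have inj: "inj_on w {i..i + d}"
  proof (rule inj_onI)
    fix s t assume st: "s \<in> {i..i + d}" "t \<in> {i..i + d}" "w s = w t"
    then have "s mod n = t mod n" using o unfolding ocyc_def by blast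
    then have "n dvd s - t" by (simp add: mod_eq_dvd_iff)
    moreover have "\<bar>s - t\<bar> < n" using st d by auto
    ultimately show "s = t" using dvd_imp_le_int[of "s - t" n] by (cases "s = t") auto
  qed
  have "distinct xs" unfolding xs_def using inj by (simp add: distinct_map)
  moreover have "successively E xs"
    unfolding xs_def successively_conv_nth
  proof (intro allI impI)
    fix j assume j: "Suc j < length (map w [i..i + d])"
    then have "i + int j \<le> i + d" "i + int (Suc j) \<le> i + d" by auto
    then have "map w [i..i + d] ! j = w (i + int j)" "map w [i..i + d] ! Suc j = w (i + int j + 1)"
      using j by (auto simp: nth_upto ac_simps)
    then show "E (map w [i..i + d] ! j) (map w [i..i + d] ! Suc j)" using o unfolding ocyc_def by simp
  qed
  ultimately have g: "gpath E (w ` {i..i + d}) xs" unfolding gpath_def using len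
    by (auto simp: xs_def)
  have ne: "[i..i + d] \<noteq> []" using d by simp
  have "hd xs = w i" unfolding xs_def using d by (simp add: hd_map upto.simps)
  moreover have "last xs = w (i + d)" unfolding xs_def using d ne by (simp add: last_map upto_rec2)
  ultimately show ?thesis using path_lensI[OF g len] by simp
qed

lemma ocyc_arcs:
  assumes o: "ocyc E n w" "symp E" and d: "0 \<le> d" "d < n"
  shows "nat d \<in> path_lens E (range w) (w i) (w (i + d))" "nat d \<in> path_lens E (range w) (w (i + d)) (w i)"
proof -
  show 1: "nat d \<in> path_lens E (range w) (w i) (w (i + d))"
    using ocyc_arc[OF o(1) d] by (rule path_lens_mono) auto
  show "nat d \<in> path_lens E (range w) (w (i + d)) (w i)" by (rule path_lens_rev[OF o(2) 1])
qed

lemma colour_path: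
  assumes "\<forall>a\<in>S. \<forall>b\<in>S. E a b \<longrightarrow> f a \<noteq> (f b :: bool)" "n \<in> path_lens E S a b"
  shows "(f a = f b) = even n"
proof -
  obtain xs where xs: "gpath E S xs" "hd xs = a" "last xs = b" "length xs = Suc n"
    using assms(2) by (rule path_lensE)
  from xs show ?thesis
  proof (induction xs arbitrary: a n)
    case (Cons v xs)
    show ?case
    proof (cases "xs = []")
      case True then show ?thesis using Cons by simp
    next
      case False
      then obtain m where m: "n = Suc m" "length xs = Suc m" using Cons.prems(4) by (cases xs) auto
      have g: "gpath E S xs" "E v (hd xs)" "v \<in> S" "hd xs \<in> S"
        using Cons.prems(1) False hd_in_set[OF False] unfolding gpath_def by (auto simp: successively_Cons)
      have "(f (hd xs) = f b) = even m" by (rule Cons.IH[OF g(1) refl]) (use Cons.prems False m in auto)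
      moreover have "f v \<noteq> f (hd xs)" using assms(1) g by blast
      ultimately show ?thesis using Cons.prems(2) m(1) by auto
    qed
  qed (simp add: gpath_def)
qed

lemma conn_setD:
  assumes "conn_set E S" "D \<noteq> {}" "D \<subseteq> S" "D \<noteq> S"
  obtains d v where "d \<in> D" "v \<in> S" "v \<notin> D" "E d v"
  using assms unfolding conn_set_def by blast

lemma conn_set_Un:
  assumes sym: "symp E" and A: "conn_set E A" "a \<in> A" and B: "conn_set E B" "b \<in> B" and ab: "a = b \<or> E a b"
  shows "conn_set E (A \<union> B)"
  unfolding conn_set_def
proof (intro allI impI)
  fix D assume D: "D \<noteq> {}" "D \<subset> A \<union> B"
  have split: "\<exists>d\<in>D. \<exists>e\<in>A \<union> B - D. E d e" if X: "conn_set E X" "X \<subseteq> A \<union> B" "D \<inter> X \<noteq> {}" "D \<inter> X \<noteq> X" for X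
  proof -
    obtain d v where "d \<in> D \<inter> X" "v \<in> X" "v \<notin> D \<inter> X" "E d v" using conn_setD[OF X(1,3) _ X(4)] by blast
    then show ?thesis using X(2) by blast
  qed
  consider "D \<inter> A \<noteq> {}" "D \<inter> A \<noteq> A" | "D \<inter> B \<noteq> {}" "D \<inter> B \<noteq> B" | "a \<in> D" "b \<notin> D" | "a \<notin> D" "b \<in> D"
    using D A(2) B(2) by blast
  then show "\<exists>d\<in>D. \<exists>e\<in>A \<union> B - D. E d e"
  proof cases
    case 1 then show ?thesis using split[OF A(1)] by blast
  next
    case 2 then show ?thesis using split[OF B(1)] by blast
  next
    case 3 then show ?thesis using ab B(2) by blast
  next
    case 4 then show ?thesis using ab A(2) sympD[OF sym, of a b] by blast
  qed
qed

lemma conn_set_singleton: "conn_set E {v}" unfolding conn_set_def by blast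

text \<open>A maximal connected 2-coloured subset is everything: if a new vertex \<open>z\<close>
  had neighbours of both colours in \<open>K\<close>, a path in \<open>K\<close> between two of them
  would have odd length and close an odd cycle through \<open>z\<close>.\<close>

lemma bip_colour_conn:
  assumes sym: "symp E" and irr: "irreflp E" and S: "finite S" "conn_set E S" "S \<noteq> {}" and no: "\<And>m. odd m \<Longrightarrow> \<not> cycle_len E S m"
  shows "\<exists>f :: 'a \<Rightarrow> bool. \<forall>a\<in>S. \<forall>b\<in>S. E a b \<longrightarrow> f a \<noteq> f b"
proof -
  define good where "good = (\<lambda>K. K \<subseteq> S \<and> K \<noteq> {} \<and> conn_set E K \<and> (\<exists>f :: 'a \<Rightarrow> bool. \<forall>a\<in>K. \<forall>b\<in>K. E a b \<longrightarrow> f a \<noteq> f b))"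
  obtain r where r: "r \<in> S" using S by blast
  have "good {r}" unfolding good_def conn_set_def using r irr by (auto dest: irreflpD)
  moreover have "finite {K. good K}" by (rule finite_subset[of _ "Pow S"]) (auto simp: good_def S)
  ultimately obtain K where K: "good K" and max: "\<forall>K'\<in>{K. good K}. K \<subseteq> K' \<longrightarrow> K = K'"
    using finite_has_maximal2[of "{K. good K}" "{r}"] by blast
  obtain f :: "'a \<Rightarrow> bool" where f: "\<forall>a\<in>K. \<forall>b\<in>K. E a b \<longrightarrow> f a \<noteq> f b" using K unfolding good_def by blast
  have KS: "K \<subseteq> S" "K \<noteq> {}" "conn_set E K" using K unfolding good_def by auto
  have "K = S"
  proof (rule ccontr)
    assume "K \<noteq> S"
    then obtain d z where dz: "d \<in> K" "z \<in> S - K" "E d z"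
      using conn_setD[OF S(2) KS(2,1)] by blast
    have same: "f a = f d" if a: "a \<in> K" "E a z" for a
    proof (rule ccontr)
      assume ne: "f a \<noteq> f d"
      obtain n where n: "n \<in> path_lens E K a d" using conn_set_path[OF KS(3) a(1) dz(1)] .
      have on: "odd n" using colour_path[OF f n] ne by simp
      have ad: "a \<noteq> d" using ne by auto
      have "gpath E {d, z, a} [d, z, a]" using dz a ad sympD[OF sym a(2)] by (auto simp: gpath_def)
      from path_lensI[OF this, of 2] have 2: "2 \<in> path_lens E {d, z, a} d a" by simp
      have "cycle_len E (K \<union> {d, z, a}) (n + 2)"
        by (rule cycle_join[OF n 2]) (use dz ad on in \<open>auto elim: oddE\<close>)
      then have "cycle_len E S (n + 2)" by (rule cycle_len_mono) (use KS dz a in auto)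
      then show False using no on by simp
    qed
    have "good (insert z K)" unfolding good_def
    proof (intro conjI)
      show "conn_set E (insert z K)"
        using conn_set_Un[OF sym KS(3) dz(1) conn_set_singleton[of E z], of z] dz(3) by simp
      show "\<exists>f :: 'a \<Rightarrow> bool. \<forall>a\<in>insert z K. \<forall>b\<in>insert z K. E a b \<longrightarrow> f a \<noteq> f b"
      proof (intro exI[of _ "f(z := \<not> f d)"] ballI impI)
        fix a b assume ab: "a \<in> insert z K" "b \<in> insert z K" "E a b"
        have "a \<noteq> b" using ab irr by (auto dest: irreflpD)
        then show "(f(z := \<not> f d)) a \<noteq> (f(z := \<not> f d)) b"
          using ab f same[of a] same[of b] sympD[OF sym ab(3)] dz(2) by auto
      qed
    qed (use KS dz in auto)
    then show False using max dz by blast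
  qed
  then show ?thesis using f by blast
qed

text \<open>Both paths stay in the component of \<open>a\<close>, which has a 2-colouring.\<close>

lemma no_odd_cycle_parity:
  assumes sym: "symp E" and irr: "irreflp E" and S: "finite S" and no: "\<And>m. odd m \<Longrightarrow> \<not> cycle_len E S m"
    and p: "p \<in> path_lens E S a b" and q: "q \<in> path_lens E S a b"
  shows "even p = even q"
proof -
  have a: "a \<in> S" using path_lens_in[OF p] by simp
  obtain K where K: "a \<in> K" "K \<subseteq> S" "conn_set E K" "\<And>p w. p \<in> K \<Longrightarrow> w \<in> S \<Longrightarrow> E p w \<Longrightarrow> w \<in> K"
    using component[OF sym a] by metis
  have stay: "set xs \<subseteq> K" if "gpath E S xs" "hd xs \<in> K" for xs
    using that
  proof (induction xs)
    case (Cons v xs)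
    show ?case
    proof (cases "xs = []")
      case False
      then have g: "gpath E S xs" "E v (hd xs)" "hd xs \<in> S"
        using Cons.prems(1) hd_in_set[OF False] unfolding gpath_def by (auto simp: successively_Cons)
      then have "hd xs \<in> K" using K(4)[of v "hd xs"] Cons.prems(2) by simp
      then show ?thesis using Cons.IH[OF g(1)] Cons.prems(2) by simp
    qed (use Cons.prems in simp)
  qed simp
  have inK: "r \<in> path_lens E K a b" if r: "r \<in> path_lens E S a b" for r
  proof -
    obtain xs where xs: "gpath E S xs" "hd xs = a" "last xs = b" "length xs = Suc r"
      using r by (rule path_lensE)
    then have "gpath E K xs" using stay[OF xs(1)] K(1) unfolding gpath_def by auto
    from path_lensI[OF this xs(4)] xs show ?thesis by simp
  qed
  have nK: "\<not> cycle_len E K m" if "odd m" for m using no[OF that] cycle_len_mono[OF _ K(2)] by blast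
  obtain f :: "'a \<Rightarrow> bool" where f: "\<forall>a\<in>K. \<forall>b\<in>K. E a b \<longrightarrow> f a \<noteq> f b"
    using bip_colour_conn[OF sym irr finite_subset[OF K(2) S] K(3) _ nK] K(1) by blast
  show ?thesis using colour_path[OF f inK[OF p]] colour_path[OF f inK[OF q]] by simp
qed

lemma ocyc_cong:
  assumes "ocyc E n w" "i mod n = j mod n" shows "w i = w j"
  using ocyc_mod[OF assms(1), of i] ocyc_mod[OF assms(1), of j] assms(2) by simp

lemma ocyc_inj:
  assumes o: "ocyc E n w" and "w s = w t" "\<bar>s - t\<bar> < n" shows "s = t"
proof -
  have "s mod n = t mod n" using o assms(2) unfolding ocyc_def by blast
  then have "n dvd s - t" by (simp add: mod_eq_dvd_iff)
  then show ?thesis using assms(3) dvd_imp_le_int[of "s - t" n] by (cases "s = t") auto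
qed

lemma ocyc_offset:
  assumes o: "ocyc E n w" and "v \<in> range w"
  obtains d where "0 \<le> d" "d < n" "v = w (i + d)"
proof -
  obtain j where j: "v = w j" using assms(2) by blast
  have n: "0 < n" using o unfolding ocyc_def by simp
  have "(i + (j - i) mod n) mod n = j mod n" by (simp add: mod_add_right_eq)
  then have "v = w (i + (j - i) mod n)" using ocyc_cong[OF o] j by metis
  then show ?thesis using n by (intro that[of "(j - i) mod n"]) auto
qed

lemma edge_path: "E a b \<Longrightarrow> a \<noteq> b \<Longrightarrow> 1 \<in> path_lens E {a, b} a b"
  using path_lensI[of E "{a, b}" "[a, b]" 1] by (auto simp: gpath_def)

text \<open>A chord together with the even one of its two arcs is an odd cycle missing a vertex of
  the other arc. That it is shorter serves the choice of a shortest odd cycle; the missed vertex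
  \<open>e\<close> serves the maximality of \<open>D\<close>.\<close>

lemma ocyc_chord:
  assumes sym: "symp E" and irr: "irreflp E" and o: "ocyc E n w" "odd n" and e: "E (w i) v" "v \<in> range w" "v \<noteq> w (i + 1)" "v \<noteq> w (i - 1)"
  obtains m e where "odd m" "int m < n" "e \<in> range w" "cycle_len E (range w - {e}) m"
proof -
  note witness = that
  have half: thesis if d: "2 \<le> d" "d \<le> n - 2" "even d" "E (w (s + d)) (w s)" for s d
  proof -
    have ne: "w (s + d) \<noteq> w s" using ocyc_inj[OF o(1), of "s + d" s] d by auto
    have 1: "nat d \<in> path_lens E (w ` {s..s + d}) (w s) (w (s + d))" using ocyc_arc[OF o(1)] d by simp
    have ns: "{w (s + d), w s} \<subseteq> w ` {s..s + d}" using d by auto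
    have "cycle_len E (w ` {s..s + d} \<union> {w (s + d), w s}) (nat d + 1)"
      by (rule cycle_join[OF 1 edge_path[of E, OF d(4) ne]]) (use d ne in auto)
    moreover have "w (s + d + 1) \<notin> w ` {s..s + d}"
    proof
      assume "w (s + d + 1) \<in> w ` {s..s + d}"
      then obtain t where "t \<in> {s..s + d}" "w (s + d + 1) = w t" by blast
      then show False using ocyc_inj[OF o(1), of "s + d + 1" t] d by auto
    qed
    ultimately have "cycle_len E (range w - {w (s + d + 1)}) (nat d + 1)"
      using ns by (elim cycle_len_mono) blast
    then show thesis by (intro witness[of "nat d + 1" "w (s + d + 1)"]) (use d in \<open>auto simp: even_nat_iff\<close>)
  qed
  obtain d where d: "0 \<le> d" "d < n" "v = w (i + d)" using ocyc_offset[OF o(1) e(2)] by metis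
  have per: "w (j + n) = w j" for j using o unfolding ocyc_def by blast
  have "d \<noteq> 0" using e(1) d irr by (auto dest: irreflpD)
  moreover have "d \<noteq> 1" using e(3) d by auto
  moreover have "d \<noteq> n - 1" using e(4) d per[of "i - 1"] by (auto simp: algebra_simps)
  ultimately have dd: "2 \<le> d" "d \<le> n - 2" using d by auto
  show ?thesis
  proof (cases "even d")
    case True
    then show ?thesis using half[OF dd True, of i] sympD[OF sym e(1)] d by simp
  next
    case False
    then have "even (n - d)" using o(2) by simp
    moreover have "E (w (i + d + (n - d))) (w (i + d))" using e(1) d per[of i] by simp
    ultimately show ?thesis using half[of "n - d" "i + d"] dd by simp
  qed
qed

lemma conn_set_attach:
  assumes sym: "symp E" and K: "conn_set E K" and X: "\<And>x. x \<in> X \<Longrightarrow> \<exists>a\<in>K. E x a"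
  shows "conn_set E (K \<union> X)"
  unfolding conn_set_def
proof (intro allI impI)
  fix D assume D: "D \<noteq> {}" "D \<subset> K \<union> X"
  consider "D \<inter> K \<noteq> {}" "D \<inter> K \<noteq> K" | "D \<inter> K = {}" | "K \<subseteq> D" by blast
  then show "\<exists>d\<in>D. \<exists>e\<in>K \<union> X - D. E d e"
  proof cases
    case 1
    then obtain d v where "d \<in> D \<inter> K" "v \<in> K" "v \<notin> D \<inter> K" "E d v" using conn_setD[OF K 1(1) _ 1(2)] by blast
    then show ?thesis by blast
  next
    case 2
    then obtain d where d: "d \<in> D" "d \<in> X" using D by blast
    then obtain a where "a \<in> K" "E d a" using X by blast
    then show ?thesis using d 2 by blast
  next
    case 3
    then obtain v where v: "v \<in> X" "v \<notin> D" using D by blast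
    then obtain a where "a \<in> K" "E v a" using X by blast
    then show ?thesis using v 3 sympD[OF sym, of v a] by blast
  qed
qed

lemma cycle_len_ocyc:
  assumes "cycle_len E S m"
  obtains w where "ocyc E (int m) w" "range w \<subseteq> S" "cycle_len E (range w) m"
proof -
  obtain xs where xs: "3 \<le> m" "gpath E S xs" "E (last xs) (hd xs)" "length xs = m"
    using assms unfolding cycle_len_def by blast
  obtain w where w: "ocyc E (int m) w" "range w = set xs" using ocyc_of_list[OF xs(2-4,1)] .
  have "gpath E (range w) xs" using xs(2) w(2) unfolding gpath_def by simp
  then show ?thesis using that w xs unfolding cycle_len_def gpath_def by blast
qed

section \<open>The extremal odd cycle and its complement\<close>

context tricon begin

lemma conn_V: "conn_set E V"
  unfolding conn_set_def
proof (intro allI impI)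
  fix D assume D: "D \<noteq> {}" "D \<subset> V"
  then obtain a where a: "a \<in> V - D" by blast
  show "\<exists>d\<in>D. \<exists>e\<in>V - D. E d e"
  proof (cases "V - D = {a}")
    case True
    have "nb E V a \<noteq> {}" using mindeg[of a] a k6 by auto
    then obtain b where "b \<in> V" "E a b" by auto
    then show ?thesis using True a E_sym[of a b] by (cases "b = a") auto
  next
    case False
    then have "V - D - {a, a} \<noteq> {}" using a by blast
    then show ?thesis using con3[of D a a] D a by blast
  qed
qed

text \<open>A chord of a shortest odd cycle would produce a shorter one, and in a spanning cycle the
  minimum degree forces a chord. The missed vertex is the first candidate for
  \<open>D\<close>.\<close>

lemma odd_cycle_missing_vertex:
  assumes nonbip: "\<not> (\<exists>f :: 'a \<Rightarrow> bool. \<forall>a\<in>V. \<forall>b\<in>V. E a b \<longrightarrow> f a \<noteq> f b)"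
  obtains m r where "odd m" "r \<in> V" "cycle_len E (V - {r}) m"
proof -
  have "V \<noteq> {}" using nonbip by auto
  then have ex: "\<exists>m. odd m \<and> cycle_len E V m"
    using bip_colour_conn[OF sym irrefl finV conn_V] nonbip by blast
  define m where "m = (LEAST m. odd m \<and> cycle_len E V m)"
  have m: "odd m" "cycle_len E V m" using LeastI_ex[OF ex] unfolding m_def by auto
  have least: "m \<le> j" if "odd j" "cycle_len E V j" for j unfolding m_def by (rule Least_le) (use that in simp)
  obtain w where w: "ocyc E (int m) w" "range w \<subseteq> V" "cycle_len E (range w) m" using cycle_len_ocyc[OF m(2)] .
  show ?thesis
  proof (cases "range w = V")
    case False
    then obtain r where "r \<in> V" "r \<notin> range w" using w by blast
    then show ?thesis using that[of m r] m(1) cycle_len_mono[OF w(3), of "V - {r}"] w(2) by blast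
  next
    case True
    have "\<not> nb E V (w 0) \<subseteq> {w 1, w (-1)}"
    proof
      assume "nb E V (w 0) \<subseteq> {w 1, w (-1)}"
      then have "card (nb E V (w 0)) \<le> 2" using card_mono[of "{w 1, w (-1)}" "nb E V (w 0)"] card_insert_le_m1[of 2 "{w (-1)}" "w 1"] by simp
      then show False using mindeg[of "w 0"] True k6 by auto
    qed
    then obtain v where "v \<in> nb E V (w 0)" "v \<noteq> w 1" "v \<noteq> w (-1)" by blast
    then have v: "v \<in> V" "E (w 0) v" "v \<noteq> w 1" "v \<noteq> w (-1)" by simp_all
    obtain j e where j: "odd j" "int j < int m" "e \<in> range w" "cycle_len E (range w - {e}) j"
      using ocyc_chord[OF sym irrefl w(1) _ v(2)] v m(1) True by auto
    have "cycle_len E V j" by (rule cycle_len_mono[OF j(4)]) (use w(2) in blast)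
    then show ?thesis using least[OF j(1)] j(2) by simp
  qed
qed

text \<open>Let \<open>N\<close> be the set of neighbours of \<open>D\<close> outside
  \<open>D\<close>. By maximality, every odd cycle outside \<open>D\<close> passes through all of
  \<open>N\<close>. A component \<open>Z\<close> beyond \<open>N\<close> would be attached to three
  vertices of \<open>N\<close>, by 3-connectivity; they lie on the cycle, and parity rules this out.
  A chord would give an odd cycle missing a vertex of \<open>N\<close>.\<close>

lemma extremal_odd_cycle:
  assumes nonbip: "\<not> (\<exists>f :: 'a \<Rightarrow> bool. \<forall>a\<in>V. \<forall>b\<in>V. E a b \<longrightarrow> f a \<noteq> f b)"
  obtains D n w where "D \<subseteq> V" "conn_set E D" "ocyc E n w" "odd n" "range w = V - D"
    "\<And>i. \<exists>d\<in>D. E d (w i)" "\<And>i v. E (w i) v \<Longrightarrow> v \<in> range w \<Longrightarrow> v = w (i + 1) \<or> v = w (i - 1)"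
    "\<And>D' m. D' \<subseteq> V \<Longrightarrow> conn_set E D' \<Longrightarrow> odd m \<Longrightarrow> cycle_len E (V - D') m \<Longrightarrow> card D' \<le> card D"
proof -
  define ok where "ok = (\<lambda>D. D \<subseteq> V \<and> conn_set E D \<and> (\<exists>m. odd m \<and> cycle_len E (V - D) m))"
  obtain m r where mr: "odd m" "r \<in> V" "cycle_len E (V - {r}) m" using odd_cycle_missing_vertex[OF nonbip] .
  have okr: "ok {r}" unfolding ok_def using mr conn_set_singleton[of E r] by blast
  have "finite {D. ok D}" by (rule finite_subset[of _ "Pow V"]) (auto simp: ok_def finV)
  moreover have "{D. ok D} \<noteq> {}" using okr by blast
  ultimately obtain D where D: "ok D" and max: "\<And>D'. ok D' \<Longrightarrow> card D' \<le> card D"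
  proof -
    assume fin: "finite {D. ok D}" and ne: "{D. ok D} \<noteq> {}"
    have "Max (card ` {D. ok D}) \<in> card ` {D. ok D}" using fin ne by (intro Max_in) auto
    then obtain D where D: "ok D" "card D = Max (card ` {D. ok D})" by auto
    have "card D' \<le> card D" if "ok D'" for D' unfolding D(2) by (rule Max_ge) (use fin that in auto)
    then show thesis using that D(1) by blast
  qed
  have DV: "D \<subseteq> V" "conn_set E D" using D unfolding ok_def by auto
  have finD: "finite D" using DV finV by (auto intro: finite_subset)
  have "1 \<le> card D" using max[OF okr] by simp
  then have Dne: "D \<noteq> {}" by auto
  obtain m where m: "odd m" "cycle_len E (V - D) m" using D unfolding ok_def by blast
  obtain w where w: "ocyc E (int m) w" "range w \<subseteq> V - D" "cycle_len E (range w) m" using cycle_len_ocyc[OF m(2)] .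
  have maxi: "card D' \<le> card D" if "D' \<subseteq> V" "conn_set E D'" "odd j" "cycle_len E (V - D') j" for D' j
    using max that unfolding ok_def by blast
  define N where "N = {e \<in> V - D. \<exists>d\<in>D. E d e}"
  have NF: "N \<subseteq> V - D" unfolding N_def by blast
  \<comment> \<open>Otherwise \<open>D\<close> could absorb \<open>e\<close>.\<close>
  have noN: "\<not> cycle_len E (V - D - {e}) j" if e: "e \<in> N" and j: "odd j" for e j
  proof
    assume c: "cycle_len E (V - D - {e}) j"
    obtain d where d: "d \<in> D" "E d e" "e \<in> V" "e \<notin> D" using e unfolding N_def by blast
    have "conn_set E (D \<union> {e})" using conn_set_Un[OF sym DV(2) d(1) conn_set_singleton[of E e]] d(2) by blast
    moreover have "V - (D \<union> {e}) = V - D - {e}" by blast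
    ultimately have "card (D \<union> {e}) \<le> card D" using maxi[of "D \<union> {e}" j] j c DV(1) d(3) by simp
    then show False using d(4) finD by simp
  qed
  have Nw: "N \<subseteq> range w"
  proof
    fix e assume e: "e \<in> N"
    show "e \<in> range w"
    proof (rule ccontr)
      assume "e \<notin> range w"
      then have "cycle_len E (V - D - {e}) m" using w(2) by (intro cycle_len_mono[OF w(3)]) blast
      then show False using noN[OF e m(1)] by blast
    qed
  qed
  have F: "V - D \<subseteq> N"
  proof (rule ccontr)
    assume "\<not> V - D \<subseteq> N"
    then obtain z where z: "z \<in> V - D - N" by blast
    obtain Z where Z: "z \<in> Z" "Z \<subseteq> V - D - N" "conn_set E Z" and clZ: "\<And>p v. p \<in> Z \<Longrightarrow> v \<in> V - D - N \<Longrightarrow> E p v \<Longrightarrow> v \<in> Z"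
      using component[OF sym z] by metis
    have out: "v \<in> N" if "p \<in> Z" "v \<in> V" "v \<notin> Z" "E p v" for p v
    proof -
      have "v \<notin> D" using that Z(2) E_sym[OF that(4)] unfolding N_def by blast
      then show ?thesis using clZ[OF that(1) _ that(4)] that by blast
    qed
    define NZ where "NZ = {e \<in> N. \<exists>p\<in>Z. E e p}"
    have more: "\<exists>e\<in>NZ. e \<noteq> a \<and> e \<noteq> b" if ab: "a \<in> NZ" "b \<in> NZ" for a b
    proof -
      have 1: "Z \<subseteq> V - {a, b}" using Z ab unfolding NZ_def by blast
      obtain d where "d \<in> D" using Dne by blast
      then have 2: "V - Z - {a, b} \<noteq> {}" using Z ab DV NF unfolding NZ_def by blast
      have "Z \<noteq> {}" using Z by blast
      then obtain p v where "p \<in> Z" "v \<in> V - Z - {a, b}" "E p v" using con3[OF _ 1 2] by blast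
      then show ?thesis using out[of p v] E_sym[of p v] unfolding NZ_def by blast
    qed
    have "Z \<noteq> {}" "Z \<subseteq> V" "Z \<noteq> V" using Z Dne DV by auto
    then obtain p v where "p \<in> Z" "v \<in> V" "v \<notin> Z" "E p v" using conn_setD[OF conn_V, of Z] by metis
    then have "v \<in> NZ" using out[of p v] E_sym[of p v] unfolding NZ_def by blast
    then obtain e1 e2 e3 where e: "e1 \<in> NZ" "e2 \<in> NZ" "e3 \<in> NZ" "e2 \<noteq> e1" "e3 \<noteq> e1" "e3 \<noteq> e2"
      using more by metis
    have via: "Suc (Suc p) \<in> path_lens E (V - D - {c}) a b"
      if a: "a \<in> N" "u \<in> Z" "E a u" and b: "b \<in> N" "v \<in> Z" "E b v" and c: "c \<in> N" "a \<noteq> b" "c \<noteq> a" "c \<noteq> b"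
        and p: "p \<in> path_lens E Z u v" for a b c u v p
    proof -
      have "a \<notin> Z" "b \<notin> Z" using Z a b by auto
      then have "Suc p \<in> path_lens E (insert a Z) a v" using path_lens_Cons[of _ E Z u v a, OF p a(3)] by blast
      then have "Suc (Suc p) \<in> path_lens E (insert b (insert a Z)) a b"
        by (rule path_lens_snoc[of _ E _ a v b, OF _ E_sym[OF b(3)]]) (use \<open>b \<notin> Z\<close> c in auto)
      then show ?thesis by (rule path_lens_mono) (use Z(2) NF a b c in blast)
    qed
    have arc: "nat (t - s) \<in> path_lens E (V - D - {w r}) (w s) (w t)" if "s \<le> t" "t < r" "r < s + int m" for s t r
    proof -
      have "w r \<notin> w ` {s..t}"
      proof
        assume "w r \<in> w ` {s..t}"
        then obtain x where "x \<in> {s..t}" "w r = w x" by blast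
        then show False using ocyc_inj[OF w(1), of r x] that by auto
      qed
      moreover have "nat (t - s) \<in> path_lens E (w ` {s..t}) (w s) (w t)"
        using ocyc_arc[OF w(1), of "t - s" s] that by simp
      ultimately show ?thesis using w(2) by (elim path_lens_mono) blast
    qed
    \<comment> \<open>Between two of the three vertices, an arc and a detour through
      \<open>Z\<close> both avoid the third, so by \<open>noN\<close> their parities agree. The
      three arcs add up to the odd number \<open>m\<close>, while the three connections inside
      \<open>Z\<close> form a closed walk in a bipartite graph.\<close>
    have key: False if e: "w i \<in> NZ" "w (i + s) \<in> NZ" "w (i + t) \<in> NZ" and st: "0 < s" "s < t" "t < int m" for i s t
    proof -
      obtain z1 z2 z3 where zs: "z1 \<in> Z" "E (w i) z1" "z2 \<in> Z" "E (w (i + s)) z2" "z3 \<in> Z" "E (w (i + t)) z3"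
        using e unfolding NZ_def by blast
      have eN: "w i \<in> N" "w (i + s) \<in> N" "w (i + t) \<in> N" using e unfolding NZ_def by auto
      have ne: "w i \<noteq> w (i + s)" "w i \<noteq> w (i + t)" "w (i + s) \<noteq> w (i + t)"
        using ocyc_inj[OF w(1), of i "i + s"] ocyc_inj[OF w(1), of i "i + t"] ocyc_inj[OF w(1), of "i + s" "i + t"] st by auto
      obtain p where p: "p \<in> path_lens E Z z1 z2" using conn_set_path[OF Z(3) zs(1,3)] .
      obtain q where q: "q \<in> path_lens E Z z2 z3" using conn_set_path[OF Z(3) zs(3,5)] .
      obtain r where r: "r \<in> path_lens E Z z3 z1" using conn_set_path[OF Z(3) zs(5,1)] .
      have per: "w (i + int m) = w i" using w(1) unfolding ocyc_def by blast
      have par: "even a = even b" if "e \<in> N" "a \<in> path_lens E (V - D - {e}) u v" "b \<in> path_lens E (V - D - {e}) u v" for a b e u v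
        by (rule no_odd_cycle_parity[OF sym irrefl _ noN[OF that(1)] that(2,3)]) (use finV in auto)
      have 1: "even (nat s) = even p"
        using par[OF eN(3) arc[of i "i + s" "i + t"] via[OF eN(1) zs(1,2) eN(2) zs(3,4) eN(3) _ _ _ p]] ne st by auto
      have 2: "even (nat (t - s)) = even q"
        using par[OF eN(1) _ via[OF eN(2) zs(3,4) eN(3) zs(5,6) eN(1) _ _ _ q]] arc[of "i + s" "i + t" "i + int m"] per ne st by auto
      have "w (i + s + int m) = w (i + s)" using w(1) unfolding ocyc_def by blast
      then have 3: "even (nat (int m - t)) = even r"
        using par[OF eN(2) _ via[OF eN(3) zs(5,6) eN(1) zs(1,2) eN(2) _ _ _ r]] arc[of "i + t" "i + int m" "i + s + int m"] per ne st by auto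
      have noZ: "\<not> cycle_len E Z j" if "odd j" for j
      proof
        assume "cycle_len E Z j"
        then have "cycle_len E (V - D - {w i}) j" by (rule cycle_len_mono) (use Z(2) eN in blast)
        then show False using noN[OF eN(1) that] by blast
      qed
      obtain f :: "'a \<Rightarrow> bool" where f: "\<forall>a\<in>Z. \<forall>b\<in>Z. E a b \<longrightarrow> f a \<noteq> f b"
        using bip_colour_conn[OF sym irrefl _ Z(3) _ noZ] Z finV by (metis finite_Diff finite_subset empty_iff)
      have "even (p + q + r)" using colour_path[OF f p] colour_path[OF f q] colour_path[OF f r] by auto
      moreover have "m = nat s + nat (t - s) + nat (int m - t)" using st by linarith
      ultimately show False using 1 2 3 m(1) by (metis even_add)
    qed
    have eN: "e1 \<in> range w" "e2 \<in> range w" "e3 \<in> range w" using e Nw unfolding NZ_def by auto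
    obtain i where i: "e1 = w i" using eN by blast
    obtain s where s: "0 \<le> s" "s < int m" "e2 = w (i + s)" using ocyc_offset[OF w(1) eN(2)] by metis
    obtain t where t: "0 \<le> t" "t < int m" "e3 = w (i + t)" using ocyc_offset[OF w(1) eN(3)] by metis
    have "s \<noteq> 0" "t \<noteq> 0" "s \<noteq> t" using e(4-6) i s(3) t(3) by auto
    then show False using key[of i s t] key[of i t s] e(1-3) i s t by (cases "s < t") auto
  qed
  have rw: "range w = V - D" using w(2) Nw F by blast
  show ?thesis
  proof (rule that[OF DV w(1) _ rw])
    show "\<exists>d\<in>D. E d (w i)" for i using F rw unfolding N_def by blast
    show "v = w (i + 1) \<or> v = w (i - 1)" if ch: "E (w i) v" "v \<in> range w" for i v
    proof (rule ccontr)
      assume "\<not> (v = w (i + 1) \<or> v = w (i - 1))"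
      then have nv: "v \<noteq> w (i + 1)" "v \<noteq> w (i - 1)" by auto
      have om: "odd (int m)" using m(1) by simp
      obtain j e where j: "odd j" "e \<in> range w" "cycle_len E (range w - {e}) j"
        using ocyc_chord[OF sym irrefl w(1) om ch nv] by metis
      then show False using noN[of e j] F rw by auto
    qed
  qed (use m(1) maxi in auto)
qed

end

subsection \<open>Triangle-free graphs\<close>

text \<open>Here the common last edge is forgotten. The degree of \<open>x\<close> guarantees a
  vertex besides the two ends.\<close>

lemma rooted_paths:
  assumes "symp E" "irreflp E" and r: "rooted E S x y" and deg: "\<And>v. v \<in> S - {y} \<Longrightarrow> c + 1 \<le> card (nb E S v)" and c: "2 \<le> c"
  shows "adm c (path_lens E S x y)"
proof -
  have xy: "x \<in> S - {y}" "y \<in> S" using r unfolding rooted_def by auto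
  have "S \<noteq> {x, y}"
  proof
    assume "S = {x, y}"
    then have "nb E S x \<subseteq> {x, y}" by auto
    then have "card (nb E S x) \<le> 2" using card_mono[of "{x, y}" "nb E S x"] card_insert_le_m1[of 2 "{y}" x] by simp
    then show False using deg[OF xy(1)] c by simp
  qed
  then have "linked E S x y c"
    by (rule rooted_linked[OF assms(1-3)]) (use deg in \<open>auto simp: deg_ok_def\<close>)
  then obtain y' where y': "E y' y" and a: "adm c (path_lens E (S - {y}) x y')" unfolding linked_def by blast
  show ?thesis
  proof (rule adm_shift[OF a])
    fix n assume "n \<in> path_lens E (S - {y}) x y'"
    then have "Suc n \<in> path_lens E (insert y (S - {y})) x y" by (rule path_lens_snoc[of n E "S - {y}" x y' y, OF _ y']) simp
    then show "n + 1 \<in> path_lens E S x y" using xy(2) by (simp add: insert_absorb)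
  qed
qed

text \<open>An interval of at least two lengths fills the gaps of the progression in
  \<open>L2\<close>. The constant \<open>r\<close> accounts for fixed connecting pieces.\<close>

lemma consec_sum:
  assumes L1: "\<And>i. i < c \<Longrightarrow> a + i \<in> L1" and L2: "\<And>i. i < c' \<Longrightarrow> a' + d * i \<in> L2" and d: "d = 1 \<or> d = 2"
    and c: "2 \<le> c" "1 \<le> c'" "k \<le> c + d * (c' - 1)" and M: "\<And>n m. n \<in> L1 \<Longrightarrow> m \<in> L2 \<Longrightarrow> n + m + r \<in> M"
  shows "consec k M"
  unfolding consec_def
proof (intro exI allI impI)
  fix t assume t: "t < k"
  define j where "j = min (t div d) (c' - 1)"
  have j: "j < c'" using c unfolding j_def by auto
  have le: "d * j \<le> t" unfolding j_def using d by (auto simp: min_def)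
  have "t - d * j < c" using d
  proof
    assume "d = 1" then show ?thesis using t c unfolding j_def by (auto simp: min_def)
  next
    assume "d = 2" then show ?thesis using t c unfolding j_def by (auto simp: min_def)
  qed
  from M[OF L1[OF this] L2[OF j]] show "(a + a' + r) + t \<in> M" using le by (simp add: algebra_simps)
qed

text \<open>For two closing arcs whose lengths differ by 3. With difference 2 the two shifted copies
  have opposite parities and interleave from the second term of the lower copy on;
  \<open>4 \<le> c\<close> makes the overlap long enough. For \<open>c = k - 2\<close> this is the
  hypothesis \<open>6 \<le> k\<close>.\<close>

lemma consec_gap3:
  assumes "adm c L" "4 \<le> c" and M: "\<And>n. n \<in> L \<Longrightarrow> n + b \<in> M" "\<And>n. n \<in> L \<Longrightarrow> n + (b + 3) \<in> M"
  shows "consec (c + 2) M"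
proof -
  obtain a d where d: "d = 1 \<or> d = 2" and L: "\<And>i. i < c \<Longrightarrow> a + d * i \<in> L"
    using assms(1) unfolding adm_def by auto
  show ?thesis
  proof (cases "d = 1")
    case True
    have "a + b + i \<in> M" if i: "i < c + 2" for i
    proof (cases "i < c")
      case True
      then show ?thesis using M(1)[OF L[of i]] \<open>d = 1\<close> by (simp add: algebra_simps)
    next
      case False
      then have "i - 3 < c" "3 \<le> i" using i assms(2) by auto
      then show ?thesis using M(2)[OF L[of "i - 3"]] \<open>d = 1\<close> by (simp add: algebra_simps)
    qed
    then show ?thesis unfolding consec_def by blast
  next
    case False
    then have d2: "d = 2" using d by simp
    have "a + b + 2 + i \<in> M" if i: "i < c + 2" for i
    proof (cases "even i")
      case True
      then obtain j where j: "i = 2 * j" by blast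
      then have "Suc j < c" using i assms(2) by auto
      then show ?thesis using M(1)[OF L[of "Suc j"]] d2 j by (simp add: algebra_simps)
    next
      case False
      then obtain j where j: "i = 2 * j + 1" by (rule oddE)
      then have "j < c" using i assms(2) by auto
      then show ?thesis using M(2)[OF L[of j]] d2 j by (simp add: algebra_simps numeral_3_eq_3)
    qed
    then show ?thesis unfolding consec_def by blast
  qed
qed

text \<open>A subset of \<open>K - P\<close> without \<open>c\<close> has a leaving edge in
  \<open>K\<close>, and this edge does not enter \<open>P\<close>, whose own edges to the outside
  all end in \<open>c\<close>. For a subset containing \<open>c\<close> the complement is
  used.\<close>

lemma conn_set_remove:
  assumes sym: "symp E" and K: "conn_set E K" "c \<in> K - P" and P: "\<And>p v. p \<in> P \<Longrightarrow> v \<in> K \<Longrightarrow> E p v \<Longrightarrow> v \<in> P \<or> v = c"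
  shows "conn_set E (K - P)"
proof -
  have leave: "\<exists>t\<in>T. \<exists>v\<in>K - P - T. E t v" if T: "T \<noteq> {}" "T \<subseteq> K - P" "c \<notin> T" for T
  proof -
    have "T \<subseteq> K" "T \<noteq> K" using T K(2) by auto
    then obtain t v where tv: "t \<in> T" "v \<in> K" "v \<notin> T" "E t v" using conn_setD[OF K(1) T(1)] by metis
    moreover have "v \<notin> P" using P[of v t] sympD[OF sym tv(4)] tv(1) T by blast
    ultimately show ?thesis by blast
  qed
  show ?thesis unfolding conn_set_def
  proof (intro allI impI)
    fix S assume S: "S \<noteq> {}" "S \<subset> K - P"
    show "\<exists>d\<in>S. \<exists>e\<in>K - P - S. E d e"
    proof (cases "c \<in> S")
      case False
      then show ?thesis using leave[of S] S by blast
    next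
      case True
      then obtain t v where tv: "t \<in> K - P - S" "v \<in> K - P - (K - P - S)" "E t v"
        using leave[of "K - P - S"] S by blast
      then show ?thesis using sympD[OF sym tv(3)] by blast
    qed
  qed
qed

text \<open>The cycle has \<open>2 * q + 1\<close> vertices, so two vertices farthest apart on it
  are joined by arcs of lengths \<open>q\<close> and \<open>q + 1\<close>.\<close>

locale odd_frame = tricon +
  fixes D w and q :: int
  assumes DV: "D \<subseteq> V" and conD: "conn_set E D" and oc: "ocyc E (2 * q + 1) w" and rw: "range w = V - D"
    and attached: "\<And>i. \<exists>d\<in>D. E d (w i)"
    and induced: "\<And>i v. E (w i) v \<Longrightarrow> v \<in> range w \<Longrightarrow> v = w (i + 1) \<or> v = w (i - 1)"
    and maxD: "\<And>D' m. D' \<subseteq> V \<Longrightarrow> conn_set E D' \<Longrightarrow> odd m \<Longrightarrow> cycle_len E (V - D') m \<Longrightarrow> card D' \<le> card D"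
    and notri: "\<And>a b c. a \<in> V \<Longrightarrow> b \<in> V \<Longrightarrow> c \<in> V \<Longrightarrow> E a b \<Longrightarrow> E b c \<Longrightarrow> E c a \<Longrightarrow> False"
begin

lemma finD: "finite D" using DV finV by (rule finite_subset)

lemma per: "w (i + (2 * q + 1)) = w i" using oc unfolding ocyc_def by blast

lemma w_in: "w i \<in> V" "w i \<notin> D" using rw by auto

lemma w_edge: "E (w i) (w (i + 1))" using oc unfolding ocyc_def by blast

lemma q2: "2 \<le> q"
proof (rule ccontr)
  assume "\<not> 2 \<le> q"
  moreover have "1 \<le> q" using oc unfolding ocyc_def by simp
  ultimately have "q = 1" by simp
  then have "w (2 + 1) = w 0" using per[of 0] by simp
  then show False using notri[OF w_in(1) w_in(1) w_in(1), of 0 1 2] w_edge[of 0] w_edge[of 1] w_edge[of 2] by simp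
qed

lemma card_nbD: "k - 2 \<le> card (nb E D (w i))"
proof -
  have "nb E V (w i) \<subseteq> nb E D (w i) \<union> {w (i + 1), w (i - 1)}"
  proof
    fix v assume v: "v \<in> nb E V (w i)"
    then have "v \<in> D \<or> v \<in> range w" using rw by auto
    then show "v \<in> nb E D (w i) \<union> {w (i + 1), w (i - 1)}" using induced[of i v] v by auto
  qed
  then have "card (nb E V (w i)) \<le> card (nb E D (w i) \<union> {w (i + 1), w (i - 1)})" using finD by (intro card_mono) auto
  also have "\<dots> \<le> card (nb E D (w i)) + card {w (i + 1), w (i - 1)}" by (rule card_Un_le)
  also have "card {w (i + 1), w (i - 1)} \<le> 2" using card_insert_le_m1[of 2 "{w (i - 1)}" "w (i + 1)"] by simp
  finally show ?thesis using mindeg[OF w_in(1)[of i]] by linarith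
qed

lemma nbD_avoid: "\<exists>d\<in>D. d \<noteq> u \<and> E d (w i)"
proof (rule ccontr)
  assume a: "\<not> (\<exists>d\<in>D. d \<noteq> u \<and> E d (w i))"
  have "nb E D (w i) \<subseteq> {u}"
  proof
    fix d assume "d \<in> nb E D (w i)"
    then show "d \<in> {u}" using a E_sym[of "w i" d] by auto
  qed
  then have "card (nb E D (w i)) \<le> 1" using card_mono[of "{u}" "nb E D (w i)"] by simp
  then show False using card_nbD[of i] k6 by simp
qed

lemma arcs:
  assumes "0 \<le> d" "d \<le> 2 * q"
  shows "nat d \<in> path_lens E (range w) (w i) (w (i + d))" "nat d \<in> path_lens E (range w) (w (i + d)) (w i)"
  using ocyc_arcs[OF oc sym, of d i] assms by auto

lemma close_cycle:
  assumes p: "p \<in> path_lens E D x y" "x \<noteq> y" and e: "E x a" "E y b" and r: "r \<in> path_lens E (range w) b a"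
  shows "cycle_len E V (p + r + 2)"
proof -
  have xy: "x \<in> D" "y \<in> D" using path_lens_in[OF p(1)] by auto
  have nw: "x \<notin> range w" "y \<notin> range w" using xy rw by auto
  have "Suc r \<in> path_lens E (insert y (range w)) y a" by (rule path_lens_Cons[of r E "range w" b a y, OF r e(2) nw(2)])
  then have 1: "Suc (Suc r) \<in> path_lens E (insert x (insert y (range w))) y x"
    by (rule path_lens_snoc[of _ E _ y a x, OF _ E_sym[OF e(1)]]) (use nw p(2) in auto)
  have "p \<noteq> 0"
  proof
    assume "p = 0"
    then obtain xs where "hd xs = x" "last xs = y" "length xs = Suc 0" using p(1) by (auto elim: path_lensE)
    then show False using p(2) by (cases xs) auto
  qed
  then have "cycle_len E (D \<union> insert x (insert y (range w))) (p + Suc (Suc r))"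
    by (intro cycle_join[OF p(1) 1]) (use rw p(2) in auto)
  then have "cycle_len E V (p + Suc (Suc r))" by (rule cycle_len_mono) (use rw xy DV in auto)
  then show ?thesis by simp
qed

text \<open>Otherwise \<open>u\<close> and the odd arc between its two neighbours form an odd cycle, and the rest of
  the graph contains a connected set larger than \<open>D\<close>.\<close>

lemma twin_offset:
  assumes u: "u \<in> D" "conn_set E (D - {u})" and e: "E u (w i)" "E u (w (i + d))" and d: "0 < d" "d \<le> 2 * q"
  shows "d = 2 \<or> d = 2 * q - 1"
proof -
  have odd_arc: "t = 2 * q - 1" if t: "odd t" "0 < t" "t \<le> 2 * q" "E u (w s)" "E u (w (s + t))" for s t
  proof -
    \<comment> \<open>The \<open>2 * q - t\<close> cycle vertices outside the odd arc. Each has a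
      neighbour in \<open>D\<close> other than \<open>u\<close>, so they can join
      \<open>D - {u}\<close>; maximality of \<open>D\<close> permits at most one of them.\<close>
    define X where "X = w ` {s + t + 1..s + 2 * q}"
    have inj: "inj_on w {s + t + 1..s + 2 * q}" using ocyc_inj[OF oc] t by (auto intro!: inj_onI)
    have cX: "card X = nat (2 * q - t)" unfolding X_def using card_image[OF inj] t by simp
    have conn: "conn_set E (D - {u} \<union> X)"
    proof (rule conn_set_attach[OF sym u(2)])
      fix x assume "x \<in> X"
      then obtain j where "x = w j" unfolding X_def by blast
      then show "\<exists>a\<in>D - {u}. E x a" using nbD_avoid[of u j] E_sym by blast
    qed
    have uw: "u \<notin> range w" using u(1) rw by auto
    have 1: "nat t \<in> path_lens E (w ` {s..s + t}) (w s) (w (s + t))" using ocyc_arc[OF oc] t by simp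
    have uX: "u \<notin> w ` {s..s + t}" using uw by auto
    have 2: "Suc (nat t) \<in> path_lens E (insert u (w ` {s..s + t})) u (w (s + t))"
      by (rule path_lens_Cons[of _ E _ "w s" _ u, OF 1 t(4) uX])
    have 3: "1 \<in> path_lens E {w (s + t), u} (w (s + t)) u" by (rule edge_path[of E, OF E_sym[OF t(5)]]) (use uw in auto)
    have "cycle_len E (insert u (w ` {s..s + t}) \<union> {w (s + t), u}) (Suc (nat t) + 1)"
      by (rule cycle_join[OF 2 3]) (use uw t in auto)
    moreover have "w ` {s..s + t} \<inter> X = {}"
    proof (rule ccontr)
      assume "w ` {s..s + t} \<inter> X \<noteq> {}"
      then obtain a b where "a \<in> {s..s + t}" "b \<in> {s + t + 1..s + 2 * q}" "w a = w b" unfolding X_def by blast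
      then show False using ocyc_inj[OF oc, of a b] by auto
    qed
    moreover have "w ` {s..s + t} \<subseteq> V - D" using rw by auto
    moreover have "w (s + t) \<in> w ` {s..s + t}" using t by auto
    ultimately have "cycle_len E (V - (D - {u} \<union> X)) (Suc (nat t) + 1)"
      using u(1) DV rw by (elim cycle_len_mono) (auto simp: X_def)
    moreover have "odd (Suc (nat t) + 1)" using t by (simp add: even_nat_iff)
    moreover have XV: "X \<subseteq> V - D" unfolding X_def using rw by auto
    ultimately have "card (D - {u} \<union> X) \<le> card D" using maxD[OF _ conn] DV by blast
    moreover have "card (D - {u} \<union> X) = card D - 1 + card X"
      using finD u(1) XV finV by (subst card_Un_disjoint) (auto intro: finite_subset)
    moreover have "1 \<le> card D" using u(1) finD by (simp add: Suc_le_eq card_gt_0_iff) blast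
    ultimately have "card X \<le> 1" by linarith
    then have "2 * q - t \<le> 1" using cX by simp
    then show ?thesis using t by presburger
  qed
  show ?thesis
  proof (cases "odd d")
    case True
    then show ?thesis using odd_arc[OF True d e] by simp
  next
    case False
    \<comment> \<open>For even \<open>d\<close> the complementary arc is the odd one.\<close>
    have "w (i + d + (2 * q + 1 - d)) = w i" using per[of i] by simp
    then have "2 * q + 1 - d = 2 * q - 1" using odd_arc[of "2 * q + 1 - d" "i + d"] False d e by simp
    then show ?thesis by simp
  qed
qed

text \<open>Such a vertex has the two cycle neighbours of \<open>w i\<close>, so it could replace
  \<open>w i\<close> on the cycle.\<close>

definition twin :: "'a \<Rightarrow> int \<Rightarrow> bool" where
  "twin u i \<longleftrightarrow> E u (w (i - 1)) \<and> E u (w (i + 1))"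

lemma nbC_noncut:
  assumes u: "u \<in> D" "conn_set E (D - {u})" and e: "E u (w i)" "E u v" "v \<in> range w" "v \<noteq> w i"
  shows "v = w (i + 2) \<and> twin u (i + 1) \<or> v = w (i - 2) \<and> twin u (i - 1)"
proof -
  obtain d where d: "0 \<le> d" "d < 2 * q + 1" "v = w (i + d)" using ocyc_offset[OF oc e(3)] by metis
  then have "d \<noteq> 0" using e(4) by auto
  then have "d = 2 \<or> d = 2 * q - 1" using twin_offset[OF u e(1), of d] e(2) d by auto
  moreover have "w (i + (2 * q - 1)) = w (i - 2)" using per[of "i - 2"] by (simp add: algebra_simps)
  ultimately have "v = w (i + 2) \<or> v = w (i - 2)" using d(3) by auto
  then show ?thesis using e unfolding twin_def by (auto simp: algebra_simps)
qed

text \<open>Two neighbours on the cycle are always at distance 2. A third one would produce a pair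
  at distance 4, but 4 is neither 2 nor the odd number \<open>2 * q - 1\<close>.\<close>

lemma card_nbC:
  assumes u: "u \<in> D" "conn_set E (D - {u})"
  shows "card (nb E (range w) u) \<le> 2" "(\<And>i. \<not> twin u i) \<Longrightarrow> card (nb E (range w) u) \<le> 1"
proof -
  have "card (nb E (range w) u) \<le> 2 \<and> ((\<forall>i. \<not> twin u i) \<longrightarrow> card (nb E (range w) u) \<le> 1)"
  proof (cases "nb E (range w) u = {}")
    case False
    then obtain i where i: "E u (w i)" by auto
    have sub: "nb E (range w) u \<subseteq> {w i, w (i + 2), w (i - 2)}"
    proof
      fix v assume "v \<in> nb E (range w) u"
      then show "v \<in> {w i, w (i + 2), w (i - 2)}" using nbC_noncut[OF u i, of v] by auto
    qed
    have notboth: "\<not> (E u (w (i + 2)) \<and> E u (w (i - 2)))"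
    proof
      assume a: "E u (w (i + 2)) \<and> E u (w (i - 2))"
      have "w (i - 2 + 4) = w (i + 2)" by (simp add: algebra_simps)
      then have "4 = (2 :: int) \<or> 4 = 2 * q - 1" using twin_offset[OF u, of "i - 2" 4] a q2 by simp
      then show False by presburger
    qed
    have "card (nb E (range w) u) \<le> 2"
    proof -
      have "nb E (range w) u \<subseteq> {w i, w (i + 2)} \<or> nb E (range w) u \<subseteq> {w i, w (i - 2)}" using sub notboth by auto
      then show ?thesis using card_mono[of "{w i, w (i + 2)}" "nb E (range w) u"] card_mono[of "{w i, w (i - 2)}" "nb E (range w) u"]
          card_insert_le_m1[of 2 "{w (i + 2)}" "w i"] card_insert_le_m1[of 2 "{w (i - 2)}" "w i"] by auto
    qed
    moreover have "card (nb E (range w) u) \<le> 1" if "\<forall>i. \<not> twin u i"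
    proof -
      have "nb E (range w) u \<subseteq> {w i}"
      proof
        fix v assume "v \<in> nb E (range w) u"
        then show "v \<in> {w i}" using nbC_noncut[OF u i, of v] that by auto
      qed
      then show ?thesis using card_mono[of "{w i}" "nb E (range w) u"] by simp
    qed
    ultimately show ?thesis by blast
  qed simp
  then show "card (nb E (range w) u) \<le> 2" "(\<And>i. \<not> twin u i) \<Longrightarrow> card (nb E (range w) u) \<le> 1" by auto
qed

lemma card_nb_noncut:
  assumes u: "u \<in> D" "conn_set E (D - {u})"
  shows "k - 2 \<le> card (nb E D u)" "(\<And>i. \<not> twin u i) \<Longrightarrow> k - 1 \<le> card (nb E D u)"
proof -
  have "nb E V u = nb E D u \<union> nb E (range w) u" using rw DV by auto
  then have "card (nb E V u) \<le> card (nb E D u) + card (nb E (range w) u)" using card_Un_le by metis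
  then have "k \<le> card (nb E D u) + card (nb E (range w) u)" using mindeg[of u] u(1) DV by force
  moreover note card_nbC(1)[OF u]
  ultimately show "k - 2 \<le> card (nb E D u)" by linarith
  show "k - 1 \<le> card (nb E D u)" if "\<And>i. \<not> twin u i"
    using card_nbC(2)[OF u that] \<open>k \<le> card (nb E D u) + card (nb E (range w) u)\<close> by linarith
qed

text \<open>\<open>D\<close> has no cut vertex, so any two of its vertices can be roots. A twin
  costs one more length, leaving \<open>k - 3\<close>, but offers closing arcs of the four lengths
  \<open>q - 1\<close> to \<open>q + 2\<close>. Without twins there are \<open>k - 2\<close>
  lengths, and two arcs of lengths \<open>q - 1\<close> and \<open>q + 2\<close> suffice.\<close>

lemma consec_2connected:
  assumes nc: "\<And>u. u \<in> D \<Longrightarrow> conn_set E (D - {u})"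
  shows "consec k {m. cycle_len E V m}"
proof -
  have rt: "rooted E D x y" if xy: "x \<in> D" "y \<in> D" "x \<noteq> y" for x y
    unfolding rooted_def
  proof (intro conjI allI impI)
    fix S c assume S: "S \<noteq> {}" "S \<subseteq> D - {x, y}"
    show "\<exists>d\<in>S. \<exists>v\<in>D - S - {c}. E d v"
    proof (cases "c \<in> D - S")
      case True
      have "S \<subseteq> D - {c}" "S \<noteq> D - {c}" using S True xy by auto
      then obtain d v where "d \<in> S" "v \<in> D - {c}" "v \<notin> S" "E d v" using conn_setD[OF nc[of c] S(1)] True by blast
      then show ?thesis by blast
    next
      case False
      have "S \<subseteq> D" "S \<noteq> D" using S xy by auto
      then obtain d v where "d \<in> S" "v \<in> D" "v \<notin> S" "E d v" using conn_setD[OF conD S(1)] by metis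
      then show ?thesis using False by blast
    qed
  qed (use finD xy in auto)
  show ?thesis
  proof (cases "\<exists>u\<in>D. \<exists>i. twin u i")
    case True
    then obtain u i where u: "u \<in> D" "twin u i" by blast
    \<comment> \<open>\<open>w (i + q)\<close> is nearly opposite to \<open>w i\<close>: its arcs to
      \<open>w (i + 1)\<close> have lengths \<open>q - 1\<close> and \<open>q + 2\<close>, those to
      \<open>w (i - 1)\<close> lengths \<open>q\<close> and \<open>q + 1\<close>.\<close>
    obtain y where y: "y \<in> D" "y \<noteq> u" "E y (w (i + q))" using nbD_avoid[of u "i + q"] by blast
    have ad: "adm (k - 3) (path_lens E D u y)"
    proof (rule rooted_paths[OF sym irrefl rt])
      fix v assume "v \<in> D - {y}"
      then show "k - 3 + 1 \<le> card (nb E D v)" using card_nb_noncut(1)[OF _ nc, of v] k6 by force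
    qed (use u y k6 in auto)
    show ?thesis
    proof (rule consec_interval[OF ad, of 3 k "nat (q - 1) + 2"])
      fix n j assume n: "n \<in> path_lens E D u y" and j: "j \<le> (3::nat)"
      have tw: "E u (w (i - 1))" "E u (w (i + 1))" using u unfolding twin_def by auto
      have pq: "w (i + q + q) = w (i - 1)" "w (i + q + (q + 1)) = w i" "w (i + q + (q + 2)) = w (i + 1)"
        using per[of "i - 1"] per[of i] per[of "i + 1"] by (auto simp: algebra_simps)
      have e: "(i - 1) + (q + 1) = i + q" "(i + 1) + (q - 1) = i + q" by auto
      have "\<exists>a. E u a \<and> nat (q - 1) + j \<in> path_lens E (range w) (w (i + q)) a"
      proof -
        consider "j = 0" | "j = 1" | "j = 2" | "j = 3" using j by linarith
        then show ?thesis
        proof cases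
          case 1
          then show ?thesis using arcs(2)[of "q - 1" "i + 1"] q2 tw e(2) by auto
        next
          case 2
          then have "nat (q - 1) + j = nat q" using q2 by simp
          then show ?thesis using arcs(1)[of q "i + q"] q2 tw pq(1) by auto
        next
          case 3
          then have "nat (q - 1) + j = nat (q + 1)" using q2 by simp
          then show ?thesis using arcs(2)[of "q + 1" "i - 1"] q2 tw e(1) by auto
        next
          case 4
          then have "nat (q - 1) + j = nat (q + 2)" using q2 by simp
          then show ?thesis using arcs(1)[of "q + 2" "i + q"] q2 tw pq(3) by auto
        qed
      qed
      then obtain a where a: "E u a" "nat (q - 1) + j \<in> path_lens E (range w) (w (i + q)) a" by blast
      then show "n + (nat (q - 1) + 2 + j) \<in> {m. cycle_len E V m}"
        using close_cycle[OF n _ a(1) y(3) a(2)] y(2) by (simp add: algebra_simps)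
    qed (use k6 in auto)
  next
    case False
    obtain x where x: "x \<in> D" "E x (w 0)" using nbD_avoid by blast
    obtain y where y: "y \<in> D" "y \<noteq> x" "E y (w (q - 1))" using nbD_avoid by blast
    have ad: "adm (k - 2) (path_lens E D x y)"
    proof (rule rooted_paths[OF sym irrefl rt])
      fix v assume "v \<in> D - {y}"
      then show "k - 2 + 1 \<le> card (nb E D v)" using card_nb_noncut(2)[OF _ nc, of v] False k6 by force
    qed (use x y k6 in auto)
    have "consec (k - 2 + 2) {m. cycle_len E V m}"
    proof (rule consec_gap3[OF ad, of "nat (q - 1) + 2"])
      fix n assume n: "n \<in> path_lens E D x y"
      have "nat (q - 1) \<in> path_lens E (range w) (w (q - 1)) (w 0)" using arcs(2)[of "q - 1" 0] q2 by simp
      from close_cycle[OF n _ x(2) y(3) this] show "n + (nat (q - 1) + 2) \<in> {m. cycle_len E V m}"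
        using y(2) by (simp add: algebra_simps)
      have "w (q - 1 + (q + 2)) = w 0" using per[of 0] by (simp add: algebra_simps)
      then have "nat (q + 2) \<in> path_lens E (range w) (w (q - 1)) (w 0)" using arcs(1)[of "q + 2" "q - 1"] q2 by simp
      moreover have "nat (q + 2) = nat (q - 1) + 3" using q2 by simp
      ultimately have "nat (q - 1) + 3 \<in> path_lens E (range w) (w (q - 1)) (w 0)" by simp
      from close_cycle[OF n _ x(2) y(3) this] show "n + (nat (q - 1) + 2 + 3) \<in> {m. cycle_len E V m}"
        using y(2) by (simp add: algebra_simps numeral_eq_Suc)
    qed (use k6 in auto)
    moreover have "k - 2 + 2 = k" using k6 by simp
    ultimately show ?thesis by simp
  qed
qed

end

section \<open>Pieces of the connected set at a cut vertex\<close>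

context odd_frame begin

text \<open>A union of some but not all components of \<open>D - {c}\<close>. Connectivity is not
  part of it, so the complement is a piece again.\<close>

definition piece :: "'a \<Rightarrow> 'a set \<Rightarrow> bool" where
  "piece c P \<longleftrightarrow> c \<in> D \<and> P \<noteq> {} \<and> P \<subseteq> D - {c} \<and> P \<noteq> D - {c} \<and> (\<forall>p\<in>P. \<forall>v\<in>D. E p v \<longrightarrow> v \<in> P \<or> v = c)"

text \<open>The counterpart of an end block with cut vertex \<open>c\<close>. As no vertex of
  \<open>P\<close> separates \<open>D\<close>, the degree bounds for non-separating vertices hold
  throughout \<open>P\<close>.\<close>

definition end_piece :: "'a \<Rightarrow> 'a set \<Rightarrow> bool" where
  "end_piece c P \<longleftrightarrow> piece c P \<and> conn_set E P \<and> (\<forall>u\<in>P. conn_set E (D - {u}))"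

lemma piece_compl: "piece c P \<Longrightarrow> piece c (D - {c} - P)"
  unfolding piece_def using E_sym by blast

lemma piece_of_cut:
  assumes "u \<in> D" "\<not> conn_set E (D - {u})"
  obtains P where "piece u P"
proof -
  obtain P where P: "P \<noteq> {}" "P \<subset> D - {u}" "\<not> (\<exists>d\<in>P. \<exists>e\<in>D - {u} - P. E d e)"
    using assms(2) unfolding conn_set_def by blast
  then have "piece u P" unfolding piece_def using assms(1) by blast
  then show ?thesis by (rule that)
qed

text \<open>A smallest piece avoiding \<open>X\<close> will do: if one of its vertices
  \<open>u\<close> separated \<open>D\<close>, a piece at \<open>u\<close> without \<open>c\<close>
  would meet it in a smaller piece. The set \<open>X\<close> serves to find a second end piece away
  from the first.\<close>

lemma ex_end_piece:
  assumes "piece c0 P0" "P0 \<inter> X = {}"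
  obtains c P where "end_piece c P" "P \<inter> X = {}"
proof -
  define good where "good = (\<lambda>m. \<exists>c P. piece c P \<and> P \<inter> X = {} \<and> card P = m)"
  have "good (card P0)" unfolding good_def using assms by blast
  then have "good (LEAST m. good m)" by (rule LeastI)
  then obtain c P where P: "piece c P" "P \<inter> X = {}" "card P = (LEAST m. good m)" unfolding good_def by blast
  have least: "\<not> (piece d S \<and> S \<subset> P)" for d S
  proof
    assume S: "piece d S \<and> S \<subset> P"
    then have "good (card S)" unfolding good_def using P(2) by blast
    then have "card P \<le> card S" using P(3) by (simp add: Least_le)
    moreover have "finite P" using P(1) finD unfolding piece_def by (auto intro: finite_subset)
    ultimately show False using S psubset_card_mono[of P S] by simp
  qed
  have Pc: "c \<in> D" "P \<noteq> {}" "P \<subseteq> D - {c}" "P \<noteq> D - {c}" using P(1) unfolding piece_def by auto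
  have clP: "v \<in> P \<or> v = c" if "p \<in> P" "v \<in> D" "E p v" for p v using P(1) that unfolding piece_def by blast
  have "conn_set E P" unfolding conn_set_def
  proof (intro allI impI, rule ccontr)
    fix S assume S: "S \<noteq> {}" "S \<subset> P" and n: "\<not> (\<exists>d\<in>S. \<exists>e\<in>P - S. E d e)"
    have "v \<in> S \<or> v = c" if "p \<in> S" "v \<in> D" "E p v" for p v using clP[of p v] that n S by blast
    then have "piece c S" unfolding piece_def using S Pc by blast
    then show False using least S by blast
  qed
  moreover have "conn_set E (D - {u})" if u: "u \<in> P" for u
  proof (rule ccontr)
    assume "\<not> conn_set E (D - {u})"
    then obtain S1 where S1: "piece u S1" using piece_of_cut u Pc by blast
    have cu: "c \<noteq> u" using u Pc by blast
    obtain S where S: "piece u S" "c \<notin> S"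
    proof (cases "c \<in> S1")
      case True
      then show ?thesis using that[OF piece_compl[OF S1]] by blast
    next
      case False
      then show ?thesis using that[OF S1] by blast
    qed
    have Sc: "S \<noteq> {}" "S \<subseteq> D - {u}" using S unfolding piece_def by auto
    have clS: "v \<in> S \<or> v = u" if "p \<in> S" "v \<in> D" "E p v" for p v using S that unfolding piece_def by blast
    show False
    proof (cases "S \<inter> P = {}")
      case True
      have "S \<subseteq> D" "S \<noteq> D" using Sc u Pc by auto
      then obtain d v where dv: "d \<in> S" "v \<in> D" "v \<notin> S" "E d v" using conn_setD[OF conD Sc(1)] by metis
      then have "v = u" using clS[of d v] by blast
      then have "d \<in> P \<or> d = c" using clP[of u d] u dv E_sym[of d v] Sc by blast
      then show False using True dv S(2) by blast
    next
      case False
      have "v \<in> S \<inter> P \<or> v = u" if "p \<in> S \<inter> P" "v \<in> D" "E p v" for p v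
        using clS[of p v] clP[of p v] that S(2) by blast
      moreover have "S \<inter> P \<subseteq> D - {u}" "S \<inter> P \<noteq> D - {u}" using Sc S(2) Pc cu by auto
      ultimately have "piece u (S \<inter> P)" unfolding piece_def using False u Pc by blast
      moreover have "S \<inter> P \<subset> P" using u Sc by blast
      ultimately show False using least by blast
    qed
  qed
  ultimately have "end_piece c P" unfolding end_piece_def using P(1) by blast
  then show ?thesis using that P(2) by blast
qed

text \<open>Three connectivity facts cover the excluded vertex \<open>e\<close>: connectivity of
  \<open>P\<close> if it is \<open>c\<close>, of \<open>D - {e}\<close> if it lies in
  \<open>P - S\<close>, and of \<open>D\<close> otherwise.\<close>

lemma end_piece_rooted:
  assumes "end_piece c P" "x \<in> P"
  shows "rooted E (insert c P) x c"
proof -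
  have P: "c \<in> D" "P \<noteq> {}" "P \<subseteq> D - {c}" "conn_set E P" and nc: "\<And>u. u \<in> P \<Longrightarrow> conn_set E (D - {u})"
    and cl: "\<And>p v. p \<in> P \<Longrightarrow> v \<in> D \<Longrightarrow> E p v \<Longrightarrow> v \<in> P \<or> v = c"
    using assms(1) unfolding end_piece_def piece_def by auto
  show ?thesis unfolding rooted_def
  proof (intro conjI allI impI)
    fix S e assume S: "S \<noteq> {}" "S \<subseteq> insert c P - {x, c}"
    then have SP: "S \<subseteq> P" "x \<notin> S" by auto
    consider "e = c" | "e \<in> P - S" | "e \<notin> insert c P - S" using SP P(3) by blast
    then show "\<exists>d\<in>S. \<exists>v\<in>insert c P - S - {e}. E d v"
    proof cases
      case 1
      have "S \<noteq> P" using SP assms(2) by blast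
      then obtain d v where "d \<in> S" "v \<in> P" "v \<notin> S" "E d v" using conn_setD[OF P(4) S(1) SP(1)] by metis
      then show ?thesis using 1 P(3) by blast
    next
      case 2
      have "S \<subseteq> D - {e}" "S \<noteq> D - {e}" using SP 2 P by auto
      then obtain d v where dv: "d \<in> S" "v \<in> D - {e}" "v \<notin> S" "E d v"
        using conn_setD[OF nc[of e] S(1)] 2 by blast
      then show ?thesis using cl[of d v] SP by blast
    next
      case 3
      have "S \<subseteq> D" "S \<noteq> D" using SP P by auto
      then obtain d v where dv: "d \<in> S" "v \<in> D" "v \<notin> S" "E d v" using conn_setD[OF conD S(1)] by metis
      then show ?thesis using cl[of d v] SP 3 by blast
    qed
  qed (use P finD assms(2) in \<open>auto intro: finite_subset\<close>)
qed

text \<open>All neighbours in \<open>D\<close> of a vertex of \<open>P\<close> lie in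
  \<open>insert c P\<close>, so the degree bounds \<open>k - 2\<close> and \<open>k - 1\<close>
  carry over, and the number of lengths is one less than the degree.\<close>

lemma end_piece_paths:
  assumes ep: "end_piece c P" "x \<in> P"
  shows "adm (k - 3) (path_lens E (insert c P) x c)"
    "(\<And>u i. u \<in> P \<Longrightarrow> \<not> twin u i) \<Longrightarrow> adm (k - 2) (path_lens E (insert c P) x c)"
proof -
  have P: "P \<subseteq> D - {c}" and nc: "\<And>u. u \<in> P \<Longrightarrow> conn_set E (D - {u})"
    and cl: "\<And>p v. p \<in> P \<Longrightarrow> v \<in> D \<Longrightarrow> E p v \<Longrightarrow> v \<in> P \<or> v = c" and c: "c \<in> D"
    using ep(1) unfolding end_piece_def piece_def by auto
  have nbs: "card (nb E D v) = card (nb E (insert c P) v)" if "v \<in> P" for v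
  proof -
    have "nb E D v = nb E (insert c P) v"
    proof
      show "nb E D v \<subseteq> nb E (insert c P) v"
      proof
        fix z assume "z \<in> nb E D v"
        then show "z \<in> nb E (insert c P) v" using cl[OF that, of z] by auto
      qed
      show "nb E (insert c P) v \<subseteq> nb E D v" using P c by auto
    qed
    then show ?thesis by simp
  qed
  show "adm (k - 3) (path_lens E (insert c P) x c)"
  proof (rule rooted_paths[OF sym irrefl end_piece_rooted[OF ep]])
    fix v assume "v \<in> insert c P - {c}"
    then show "k - 3 + 1 \<le> card (nb E (insert c P) v)" using card_nb_noncut(1)[OF _ nc, of v] nbs[of v] P k6 by force
  qed (use k6 in simp)
  show "adm (k - 2) (path_lens E (insert c P) x c)" if nt: "\<And>u i. u \<in> P \<Longrightarrow> \<not> twin u i"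
  proof (rule rooted_paths[OF sym irrefl end_piece_rooted[OF ep]])
    fix v assume "v \<in> insert c P - {c}"
    then show "k - 2 + 1 \<le> card (nb E (insert c P) v)" using card_nb_noncut(2)[OF _ nc nt, of v] nbs[of v] P k6 by force
  qed (use k6 in simp)
qed

lemma piece_attached:
  assumes "piece c P"
  obtains x i where "x \<in> P" "E x (w i)"
proof -
  have P: "P \<noteq> {}" "P \<subseteq> D - {c}" "P \<noteq> D - {c}" and cl: "\<And>p v. p \<in> P \<Longrightarrow> v \<in> D \<Longrightarrow> E p v \<Longrightarrow> v \<in> P \<or> v = c"
    using assms unfolding piece_def by auto
  have "P \<subseteq> V - {c, c}" "V - P - {c, c} \<noteq> {}" using P DV by auto
  then obtain x v where xv: "x \<in> P" "v \<in> V - P - {c, c}" "E x v" using con3[OF P(1)] by blast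
  then have "v \<in> range w" using cl[of x v] rw by blast
  then show ?thesis using that xv by blast
qed

text \<open>Otherwise the indices of cycle vertices touched by \<open>P\<close> are closed under
  adding \<open>q\<close>, hence under adding 1. Then \<open>P\<close> touches every cycle vertex,
  in particular the one \<open>q\<close> steps before a vertex touched by the complementary
  piece.\<close>

lemma piece_antipodal:
  assumes p: "piece c P"
  obtains x y i where "x \<in> P" "E x (w i)" "y \<in> D - P" "E y (w (i + q))"
proof (rule ccontr)
  assume "\<not> thesis"
  then have no: "\<not> (x \<in> P \<and> E x (w i) \<and> y \<in> D - P \<and> E y (w (i + q)))" for x y i using that by blast
  define I where "I = {i. \<exists>x\<in>P. E x (w i)}"
  have step: "i + q \<in> I" if "i \<in> I" for i
  proof -
    from that have "\<exists>x\<in>P. E x (w i)" unfolding I_def by simp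
    then obtain x where x: "x \<in> P" "E x (w i)" by blast
    obtain y where y: "y \<in> D" "E y (w (i + q))" using attached by blast
    then have "y \<in> P" using no[of x i y] x by blast
    then show ?thesis using y unfolding I_def by blast
  qed
  have steps: "i + q * int m \<in> I" if "i \<in> I" for i m
  proof (induction m)
    case (Suc m)
    then show ?case using step[of "i + q * int m"] by (simp add: algebra_simps)
  qed (use that in simp)
  have suc: "i + 1 \<in> I" if "i \<in> I" for i
  proof -
    \<comment> \<open>\<open>q\<close> is invertible modulo \<open>2 * q + 1\<close>, with inverse \<open>2 * q - 1\<close>\<close>
    have "i + q * int (nat (2 * q - 1)) \<in> I" using steps[OF that] .
    moreover have "i + q * int (nat (2 * q - 1)) = (i + 1) + (2 * q + 1) * (q - 1)" using q2 by (simp add: algebra_simps)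
    ultimately have "(i + 1) + (2 * q + 1) * (q - 1) \<in> I" by metis
    moreover have "w ((i + 1) + (2 * q + 1) * (q - 1)) = w (i + 1)" by (rule ocyc_cong[OF oc]) simp
    ultimately show ?thesis unfolding I_def mem_Collect_eq by metis
  qed
  obtain x i where "x \<in> P" "E x (w i)" using piece_attached[OF p] .
  then have i: "i \<in> I" unfolding I_def by blast
  have all: "i + int m \<in> I" for m
  proof (induction m)
    case (Suc m)
    then show ?case using suc[of "i + int m"] by (simp add: algebra_simps)
  qed (use i in simp)
  obtain y j where y: "y \<in> D - {c} - P" "E y (w j)" using piece_attached[OF piece_compl[OF p]] .
  obtain d where d: "0 \<le> d" "w (j - q) = w (i + d)" using ocyc_offset[OF oc, of "w (j - q)"] by (metis rangeI)
  then have "j - q \<in> I" using all[of "nat d"] unfolding I_def by simp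
  then obtain x where "x \<in> P" "E x (w (j - q))" unfolding I_def by blast
  then show False using no[of x "j - q" y] y by simp
qed

text \<open>Moving from one neighbour of \<open>y\<close> to the other lengthens the arc to a fixed
  neighbour of \<open>x\<close> by 2, unless it would wrap around the cycle. In that case the
  neighbour of \<open>y\<close> is fixed and the one of \<open>x\<close> is moved.\<close>

lemma twin_closers:
  assumes "twin x i" "twin y j"
  obtains a b b' r where "E x a" "E y b" "E y b'" "r \<in> path_lens E (range w) b a" "r + 2 \<in> path_lens E (range w) b' a"
    | a a' b r where "E x a" "E x a'" "E y b" "r \<in> path_lens E (range w) b a" "r + 2 \<in> path_lens E (range w) b a'"
proof -
  have t: "E x (w (i - 1))" "E x (w (i + 1))" "E y (w (j - 1))" "E y (w (j + 1))" using assms unfolding twin_def by auto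
  obtain d where d: "0 \<le> d" "d < 2 * q + 1" "w (j + 1) = w (i + 1 + d)" using ocyc_offset[OF oc, of "w (j + 1)" "i + 1"] by (metis rangeI)
  have "(j + 1) mod (2 * q + 1) = (i + 1 + d) mod (2 * q + 1)" using d(3) oc unfolding ocyc_def by blast
  then have "(j - 1) mod (2 * q + 1) = (i - 1 + d) mod (2 * q + 1)"
    by (metis (no_types, opaque_lifting) add_diff_cancel_right' diff_add_eq mod_diff_left_eq one_add_one diff_diff_eq)
  then have d': "w (j - 1) = w (i - 1 + d)" by (rule ocyc_cong[OF oc])
  show ?thesis
  proof (cases "d + 2 \<le> 2 * q")
    case True
    have "nat d \<in> path_lens E (range w) (w (j - 1)) (w (i - 1))" using arcs(2)[of d "i - 1"] d d' by simp
    moreover have "nat (d + 2) \<in> path_lens E (range w) (w (i - 1 + (d + 2))) (w (i - 1))" using arcs(2)[of "d + 2" "i - 1"] d True by simp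
    then have "nat d + 2 \<in> path_lens E (range w) (w (j + 1)) (w (i - 1))" using d by (simp add: nat_add_distrib algebra_simps)
    ultimately show ?thesis using that(1) t by blast
  next
    case False
    have "w (i + 1 + (d - 2)) = w (j - 1)" using d' by (simp add: algebra_simps)
    then have "nat (d - 2) \<in> path_lens E (range w) (w (j - 1)) (w (i + 1))" using arcs(2)[of "d - 2" "i + 1"] d False q2 by simp
    moreover have "nat d \<in> path_lens E (range w) (w (j - 1)) (w (i - 1))" using arcs(2)[of d "i - 1"] d d' by simp
    moreover have "nat d = nat (d - 2) + 2" using False q2 by linarith
    ultimately have "nat (d - 2) \<in> path_lens E (range w) (w (j - 1)) (w (i + 1))"
      "nat (d - 2) + 2 \<in> path_lens E (range w) (w (j - 1)) (w (i - 1))" by auto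
    then show ?thesis using that(2) t by blast
  qed
qed

text \<open>If the lengths in an end piece have difference 2, closing arcs \<open>q\<close> and
  \<open>q + 1\<close> interleave them. If they form an interval, the lengths in a second end piece
  are added. The difficult case has twins in both pieces and difference 1 on both sides:
  \<open>k - 3\<close> lengths each give only \<open>2 * k - 7\<close> sums, one too few for
  \<open>k = 6\<close>, and two twins as ends provide closing arcs that extend this range by
  2.\<close>

lemma consec_cutvertex:
  assumes "u \<in> D" "\<not> conn_set E (D - {u})"
  shows "consec k {m. cycle_len E V m}"
proof -
  obtain P0 where "piece u P0" using piece_of_cut[OF assms] .
  then obtain c P where ep: "end_piece c P" using ex_end_piece[of u P0 "{}"] by blast
  then have pc: "piece c P" unfolding end_piece_def by blast
  have P: "c \<in> D" "P \<noteq> {}" "P \<subseteq> D - {c}" and cl: "\<And>p v. p \<in> P \<Longrightarrow> v \<in> D \<Longrightarrow> E p v \<Longrightarrow> v \<in> P \<or> v = c"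
    using pc unfolding piece_def by auto
  obtain c2 P2 where ep2: "end_piece c2 P2" and dis: "P2 \<inter> insert c P = {}"
    using ex_end_piece[OF piece_compl[OF pc], of "insert c P"] by blast
  have P2: "c2 \<in> D" "P2 \<noteq> {}" "P2 \<subseteq> D - {c2}" and cl2: "\<And>p v. p \<in> P2 \<Longrightarrow> v \<in> D \<Longrightarrow> E p v \<Longrightarrow> v \<in> P2 \<or> v = c2"
    using ep2 unfolding end_piece_def piece_def by auto
  have c2P: "c2 \<notin> P"
  proof
    assume c2: "c2 \<in> P"
    have "P2 \<subseteq> D" "P2 \<noteq> D" using P2 by auto
    then obtain d v where dv: "d \<in> P2" "v \<in> D" "v \<notin> P2" "E d v" using conn_setD[OF conD P2(2)] by metis
    then have "v = c2" using cl2[of d v] by blast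
    then have "d \<in> P \<or> d = c" using cl[of c2 d] c2 E_sym[OF dv(4)] dv(1) P2(3) by blast
    then show False using dis dv(1) by blast
  qed
  have conP: "conn_set E (D - P)" by (rule conn_set_remove[OF sym conD _ cl]) (use P in auto)
  have conR: "conn_set E (D - P - P2)" by (rule conn_set_remove[OF sym conP _ cl2]) (use P2 c2P in auto)
  have "c \<in> D - P - P2" "c2 \<in> D - P - P2" using P P2 dis c2P by auto
  then obtain g where g: "g \<in> path_lens E (D - P - P2) c c2" using conn_set_path[OF conR] by metis
  have join: "n + g + m \<in> path_lens E D x x2" if n: "n \<in> path_lens E (insert c P) x c" and m: "m \<in> path_lens E (insert c2 P2) x2 c2" for n m x x2
  proof -
    have "n + g \<in> path_lens E (insert c P \<union> (D - P - P2)) x c2" by (rule path_lens_join[OF n g]) blast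
    from path_lens_join[OF this path_lens_rev[OF sym m]]
    have "n + g + m \<in> path_lens E (insert c P \<union> (D - P - P2) \<union> insert c2 P2) x x2" using dis c2P by blast
    then show ?thesis by (rule path_lens_mono) (use P P2 in auto)
  qed
  \<comment> \<open>One side has to be an interval, while the other may have difference 2; then a
    single closing arc is enough.\<close>
  have wide: "consec k {m. cycle_len E V m}"
    if x: "x \<in> P" "E x (w i)" "\<And>t. t < a1 \<Longrightarrow> l1 + d1 * t \<in> path_lens E (insert c P) x c"
      and x2: "x2 \<in> P2" "E x2 (w j)" "\<And>t. t < a2 \<Longrightarrow> l2 + d2 * t \<in> path_lens E (insert c2 P2) x2 c2"
      and d: "d1 = 1 \<and> (d2 = 1 \<or> d2 = 2) \<and> k \<le> a1 + d2 * (a2 - 1) \<or> d2 = 1 \<and> d1 = 2 \<and> k \<le> a2 + d1 * (a1 - 1)"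
      and a: "2 \<le> a1" "2 \<le> a2" for x i a1 l1 d1 x2 j a2 l2 d2
  proof -
    have ne: "x \<noteq> x2" using x(1) x2(1) dis by blast
    obtain d where dd: "0 \<le> d" "d < 2 * q + 1" "w j = w (i + d)" using ocyc_offset[OF oc, of "w j"] by (metis rangeI)
    then have r: "nat d \<in> path_lens E (range w) (w j) (w i)" using arcs(2)[of d i] by simp
    have M: "n + m + (g + nat d + 2) \<in> {m. cycle_len E V m}"
      if "n \<in> path_lens E (insert c P) x c" "m \<in> path_lens E (insert c2 P2) x2 c2" for n m
      using close_cycle[OF join[OF that] ne x(2) x2(2) r] by (simp add: algebra_simps)
    have M': "m + n + (g + nat d + 2) \<in> {m. cycle_len E V m}"
      if "m \<in> path_lens E (insert c2 P2) x2 c2" "n \<in> path_lens E (insert c P) x c" for n m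
      using M[OF that(2,1)] by (simp add: algebra_simps)
    from d show ?thesis
    proof
      assume h: "d1 = 1 \<and> (d2 = 1 \<or> d2 = 2) \<and> k \<le> a1 + d2 * (a2 - 1)"
      show ?thesis
        by (rule consec_sum[of a1 l1 "path_lens E (insert c P) x c" a2 l2 d2 "path_lens E (insert c2 P2) x2 c2", OF _ x2(3) _ _ _ _ M])
          (use x(3) h a in auto)
    next
      assume h: "d2 = 1 \<and> d1 = 2 \<and> k \<le> a2 + d1 * (a1 - 1)"
      show ?thesis
        by (rule consec_sum[of a2 l2 "path_lens E (insert c2 P2) x2 c2" a1 l1 d1 "path_lens E (insert c P) x c", OF _ x(3) _ _ _ _ M'])
          (use x2(3) h a in auto)
    qed
  qed
  obtain x y i where xy: "x \<in> P" "E x (w i)" "y \<in> D - P" "E y (w (i + q))" using piece_antipodal[OF pc] .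
  define tw where "tw = (\<lambda>S. \<exists>u\<in>S. \<exists>i. twin u i)"
  define a1 where "a1 = (if tw P then k - 3 else k - 2)"
  define a2 where "a2 = (if tw P2 then k - 3 else k - 2)"
  have "adm a1 (path_lens E (insert c P) x c)"
    using end_piece_paths[OF ep xy(1)] unfolding a1_def tw_def by auto
  then obtain l1 d1 where F: "d1 = 1 \<or> d1 = 2" "\<And>t. t < a1 \<Longrightarrow> l1 + d1 * t \<in> path_lens E (insert c P) x c"
    unfolding adm_def by blast
  have a: "k - 3 \<le> a1" "k - 3 \<le> a2" unfolding a1_def a2_def by auto
  show ?thesis
  proof (cases "d1 = 2")
    case True
    obtain h where h: "h \<in> path_lens E (D - P) c y" using conn_set_path[OF conP] P xy(3) by blast
    have ne: "x \<noteq> y" using xy by blast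
    have pq: "w (i + q + (q + 1)) = w i" using per[of i] by (simp add: algebra_simps)
    have arc: "n \<in> path_lens E (range w) (w (i + q)) (w i)" if "n \<in> {nat q, nat q + 1}" for n
    proof -
      have "nat (q + 1) = nat q + 1" using q2 by simp
      then show ?thesis using that arcs(2)[of q i] arcs(1)[of "q + 1" "i + q"] pq q2 by auto
    qed
    show ?thesis
    \<comment> \<open>The two arcs are the interval here, and the paths in the piece are the
      progression. This makes \<open>2 + 2 * (a1 - 1)\<close> lengths, at least
      \<open>2 * (k - 3)\<close>.\<close>
    proof (rule consec_sum[of 2 "nat q" "{nat q, nat q + 1}" a1 l1 d1 "path_lens E (insert c P) x c", OF _ F(2)])
      fix n m assume n: "n \<in> {nat q, nat q + 1}" and m: "m \<in> path_lens E (insert c P) x c"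
      have "m + h \<in> path_lens E (insert c P \<union> (D - P)) x y" by (rule path_lens_join[OF m h]) blast
      then have "m + h \<in> path_lens E D x y" by (rule path_lens_mono) (use P in auto)
      from close_cycle[OF this ne xy(2,4) arc[OF n]] show "n + m + (h + 2) \<in> {m. cycle_len E V m}" by (simp add: algebra_simps)
    qed (use a k6 True in auto)
  next
    case False
    then have d1: "d1 = 1" using F(1) by simp
    \<comment> \<open>The end \<open>x2\<close> is taken to be a twin whenever \<open>P2\<close>
      contains one, in view of the case where both pieces do.\<close>
    obtain x2 j where x2: "x2 \<in> P2" "E x2 (w j)" and tx2: "tw P2 \<Longrightarrow> \<exists>j. twin x2 j"
    proof (cases "tw P2")
      case True
      then obtain v j where "v \<in> P2" "twin v j" unfolding tw_def by blast
      then show ?thesis using that[of v "j + 1"] unfolding twin_def by blast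
    next
      case False
      obtain v j where "v \<in> P2" "E v (w j)" using piece_attached[of c2 P2] ep2 unfolding end_piece_def by blast
      then show ?thesis using that[of v j] False by blast
    qed
    have "adm a2 (path_lens E (insert c2 P2) x2 c2)"
      using end_piece_paths[OF ep2 x2(1)] unfolding a2_def tw_def by auto
    then obtain l2 d2 where F2: "d2 = 1 \<or> d2 = 2" "\<And>t. t < a2 \<Longrightarrow> l2 + d2 * t \<in> path_lens E (insert c2 P2) x2 c2"
      unfolding adm_def by blast
    show ?thesis
    proof (cases "d2 = 2 \<or> \<not> (tw P \<and> tw P2)")
      case True
      \<comment> \<open>For \<open>d2 = 2\<close> the right side is at least
        \<open>3 * k - 11\<close>, and with one piece free of twins at least
        \<open>2 * k - 6\<close>; both reach \<open>k\<close> from \<open>k = 6\<close> on.\<close>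
      have "k \<le> a1 + d2 * (a2 - 1)" using True F2(1) a k6 unfolding a1_def a2_def by auto
      then show ?thesis using wide[OF xy(1,2) F(2) x2 F2(2)] d1 F2(1) a k6 by auto
    next
      case False
      then have d2: "d2 = 1" and tws: "tw P" "tw P2" and aa: "a1 = k - 3" "a2 = k - 3" using F2(1) unfolding a1_def a2_def by auto
      obtain x1 i1 where x1: "x1 \<in> P" "twin x1 i1" using tws unfolding tw_def by blast
      obtain j2 where j2: "twin x2 j2" using tx2 tws by blast
      \<comment> \<open>The paths in \<open>P\<close> are chosen anew from the twin
        \<open>x1\<close>, and their difference may now be 2.\<close>
      have "adm a1 (path_lens E (insert c P) x1 c)" using end_piece_paths(1)[OF ep x1(1)] aa by simp
      then obtain l3 d3 where F3: "d3 = 1 \<or> d3 = 2" "\<And>t. t < a1 \<Longrightarrow> l3 + d3 * t \<in> path_lens E (insert c P) x1 c"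
        unfolding adm_def by blast
      have e1: "E x1 (w (i1 + 1))" using x1 unfolding twin_def by blast
      show ?thesis
      proof (cases "d3 = 2")
        case True
        then show ?thesis using wide[OF x1(1) e1 F3(2) x2 F2(2)] d2 aa k6 by auto
      next
        case False
        then have d3: "d3 = 1" using F3(1) by simp
        define M where "M = path_lens E D x1 x2"
        have ne: "x1 \<noteq> x2" using x1(1) x2(1) dis by blast
        have "consec (2 * k - 7) M"
          by (rule consec_sum[of a1 l3 "path_lens E (insert c P) x1 c" a2 l2 d2 "path_lens E (insert c2 P2) x2 c2" _ g, OF _ F2(2)])
            (use F3(2) d2 d3 aa k6 join[of _ x1 _ x2] in \<open>auto simp: M_def algebra_simps\<close>)
        then obtain l where l: "\<And>t. t < 2 * k - 7 \<Longrightarrow> l + t \<in> M" unfolding consec_def by blast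
        obtain r where r: "\<And>n m. n \<in> M \<Longrightarrow> m \<in> {r, r + 2} \<Longrightarrow> n + m + 2 \<in> {m. cycle_len E V m}"
        proof (cases rule: twin_closers[OF x1(2) j2])
          case (1 a b b' r)
          have "n + m + 2 \<in> {m. cycle_len E V m}" if "n \<in> M" "m \<in> {r, r + 2}" for n m
            using close_cycle[of n x1 x2 a b m] close_cycle[of n x1 x2 a b' m] that 1 ne unfolding M_def by auto
          then show ?thesis using that by blast
        next
          case (2 a a' b r)
          have "n + m + 2 \<in> {m. cycle_len E V m}" if "n \<in> M" "m \<in> {r, r + 2}" for n m
            using close_cycle[of n x1 x2 a b m] close_cycle[of n x1 x2 a' b m] that 2 ne unfolding M_def by auto
          then show ?thesis using that by blast
        qed
        show ?thesis
        proof (rule consec_sum[of "2 * k - 7" l M 2 r 2 "{r, r + 2}", OF l _ _ _ _ _ r])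
          show "r + 2 * t \<in> {r, r + 2}" if "t < 2" for t using that by (auto simp: less_2_cases_iff)
        qed (use k6 in auto)
      qed
    qed
  qed
qed

lemma consec_odd_frame: "consec k {m. cycle_len E V m}"
  using consec_2connected consec_cutvertex by blast

end

context tricon begin

theorem consecutive_cycles:
  assumes nonbip: "\<not> (\<exists>f :: 'a \<Rightarrow> bool. \<forall>a\<in>V. \<forall>b\<in>V. E a b \<longrightarrow> f a \<noteq> f b)"
    and nK: "\<not> (clique E V \<and> card V = k + 1)"
  shows "consec k {m. cycle_len E V m}"
proof (cases "\<exists>a b c. a \<in> V \<and> b \<in> V \<and> c \<in> V \<and> E a b \<and> E b c \<and> E c a")
  case True
  then obtain a b c where t: "a \<in> V" "b \<in> V" "c \<in> V" "E a b" "E b c" "E c a" by blast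
  show ?thesis by (rule triangle_consec[OF t(1-3) t(4) E_sym[OF t(6)] t(5) nK])
next
  case False
  obtain D n w where f: "D \<subseteq> V" "conn_set E D" "ocyc E n w" "odd n" "range w = V - D"
    "\<And>i. \<exists>d\<in>D. E d (w i)" "\<And>i v. E (w i) v \<Longrightarrow> v \<in> range w \<Longrightarrow> v = w (i + 1) \<or> v = w (i - 1)"
    "\<And>D' m. D' \<subseteq> V \<Longrightarrow> conn_set E D' \<Longrightarrow> odd m \<Longrightarrow> cycle_len E (V - D') m \<Longrightarrow> card D' \<le> card D"
    using extremal_odd_cycle[OF nonbip] by blast
  obtain q where q: "n = 2 * q + 1" using f(4) by (rule oddE)
  interpret odd_frame E V k D w q
  proof
    show "ocyc E (2 * q + 1) w" using f(3) q by simp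
    show False if "a \<in> V" "b \<in> V" "c \<in> V" "E a b" "E b c" "E c a" for a b c using False that by blast
  qed (fact f)+
  show ?thesis by (rule consec_odd_frame)
qed

end

subsection \<open>Digraph representation\<close>

context graph begin

lemma awalk_of_path:
  assumes "xs \<noteq> []" "set xs \<subseteq> verts G" "successively (\<lambda>u v. (u, v) \<in> arcs_ends G) xs"
  obtains p where "awalk (hd xs) p (last xs)" "awalk_verts (hd xs) p = xs"
  using assms
proof (induction xs arbitrary: thesis)
  case (Cons v xs)
  show ?case
  proof (cases "xs = []")
    case True
    then show ?thesis using Cons.prems(1)[of "[]"] Cons.prems(3) by (simp add: awalk_def)
  next
    case False
    then have s: "successively (\<lambda>u v. (u, v) \<in> arcs_ends G) xs" "(v, hd xs) \<in> arcs_ends G"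
      using Cons.prems(4) by (auto simp: successively_Cons)
    obtain p where p: "awalk (hd xs) p (last xs)" "awalk_verts (hd xs) p = xs"
      using Cons.IH[OF _ False _ s(1)] Cons.prems(3) by auto
    obtain e where e: "e \<in> arcs G" "tail G e = v" "head G e = hd xs"
      using s(2) by (auto simp: arcs_ends_def arc_to_ends_def)
    show ?thesis by (rule Cons.prems(1)[of "e # p"]) (use p e False in \<open>auto simp: awalk_Cons_iff\<close>)
  qed
qed simp

text \<open>A \<open>cycle\<close> has distinct vertices apart from its start, so the walk begins at
  \<open>last xs\<close> with the closing arc: its remaining vertices are exactly
  \<open>xs\<close>.\<close>

lemma has_cycle_of_cycle_len:
  assumes "cycle_len (\<lambda>u v. (u, v) \<in> arcs_ends G) (verts G) n"
  shows "has_cycle_of_length G n"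
proof -
  obtain xs where xs: "3 \<le> n" "gpath (\<lambda>u v. (u, v) \<in> arcs_ends G) (verts G) xs" "(last xs, hd xs) \<in> arcs_ends G" "length xs = n"
    using assms unfolding cycle_len_def by blast
  have g: "xs \<noteq> []" "distinct xs" "set xs \<subseteq> verts G" "successively (\<lambda>u v. (u, v) \<in> arcs_ends G) xs"
    using xs(2) unfolding gpath_def by auto
  obtain p where p: "awalk (hd xs) p (last xs)" "awalk_verts (hd xs) p = xs" using awalk_of_path[OF g(1,3,4)] .
  obtain e where e: "e \<in> arcs G" "tail G e = last xs" "head G e = hd xs"
    using xs(3) by (auto simp: arcs_ends_def arc_to_ends_def)
  have "awalk (last xs) (e # p) (last xs)" using p(1) e by (simp add: awalk_Cons_iff)
  moreover have "awalk_verts (last xs) (e # p) = last xs # xs" using p(2) e by simp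
  ultimately have "cycle (e # p)" unfolding cycle_def using g(2) by force
  moreover have "length (awalk_verts (hd xs) p) = Suc (length p)" by (rule length_awalk_verts)
  then have "length (e # p) = n" using p(2) xs(4) by simp
  ultimately show ?thesis unfolding has_cycle_of_length_def using xs(1) by blast
qed

text \<open>In the absence of parallel arcs, \<open>head G\<close> is injective on the arcs leaving
  \<open>v\<close>.\<close>

lemma card_nb_out_degree: "card (nb (\<lambda>u v. (u, v) \<in> arcs_ends G) (verts G) v) = out_degree G v"
proof -
  have "bij_betw (head G) (out_arcs G v) (nb (\<lambda>u v. (u, v) \<in> arcs_ends G) (verts G) v)"
    unfolding bij_betw_def
  proof
    show "inj_on (head G) (out_arcs G v)"
      using no_multi_arcs by (auto intro!: inj_onI simp: arc_to_ends_def)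
    show "head G ` out_arcs G v = nb (\<lambda>u v. (u, v) \<in> arcs_ends G) (verts G) v"
      by (auto simp: arcs_ends_def arc_to_ends_def out_arcs_def image_iff)
  qed
  then show ?thesis unfolding out_degree_def by (simp add: bij_betw_same_card)
qed

text \<open>If every edge out of \<open>D\<close> ended in \<open>a\<close> or \<open>b\<close>, a
  walk avoiding these two could never leave \<open>D\<close>. Since \<open>a\<close> and
  \<open>b\<close> need not be vertices, the removed set is their intersection with
  \<open>verts G\<close>.\<close>

lemma vertex_connected_3_edge:
  assumes vc: "vertex_connected 3 G" and D: "D \<noteq> {}" "D \<subseteq> verts G - {a, b}" "verts G - D - {a, b} \<noteq> {}"
  shows "\<exists>d\<in>D. \<exists>v\<in>verts G - D - {a, b}. (d, v) \<in> arcs_ends G"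
proof (rule ccontr)
  assume no: "\<not> ?thesis"
  define X where "X = {a, b} \<inter> verts G"
  have "card X \<le> card {a, b}" unfolding X_def by (rule card_mono) auto
  also have "\<dots> < 3" using card_insert_le_m1[of 2 "{b}" a] by simp
  finally have "connected (G \<restriction> (verts G - X))" using vc unfolding vertex_connected_def X_def by blast
  moreover obtain d v where dv: "d \<in> D" "v \<in> verts G - D - {a, b}" using D by blast
  ultimately have "(d, v) \<in> rtrancl_on (verts G - X) (parcs (mk_symmetric (G \<restriction> (verts G - X))))"
    using D(2) unfolding connected_def strongly_connected_def reachable_def X_def by auto
  then have "v \<in> D"
  proof (induction rule: rtrancl_on_induct)
    case (step y z)
    then obtain e where e: "e \<in> arcs G" "(y, z) = (tail G e, head G e) \<or> (y, z) = (head G e, tail G e)"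
      by (auto simp: parcs_mk_symmetric)
    then have "(tail G e, head G e) \<in> arcs_ends G" by (auto simp: arcs_ends_def arc_to_ends_def)
    then have "(y, z) \<in> arcs_ends G" using e(2) arcs_ends_symmetric[OF sym_arcs] by auto
    then show ?case using no step unfolding X_def by blast
  qed (use dv in simp)
  then show False using dv by blast
qed

end

theorem theorem1p3:
  fixes G :: "('a, 'b) pre_digraph" and k :: nat
  assumes "6 \<le> k"
    and "graph G"
    and "vertex_connected 3 G"
    and "\<not> bipartite G"
    and "k \<le> min_degree G"
    and "\<not> complete_digraph (k + 1) G"
  shows "\<exists>l. \<forall>i \<in> {0..k - 1}. has_cycle_of_length G (l + i)"
proof -
  interpret graph G by fact
  let ?E = "\<lambda>u v. (u, v) \<in> arcs_ends G"
  interpret tricon ?E "verts G" k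
  proof
    show "symp ?E" using arcs_ends_symmetric[OF sym_arcs] by (intro sympI)
    show "irreflp ?E" using no_loops by (auto intro!: irreflpI simp: arcs_ends_def arc_to_ends_def)
    show "k \<le> card (nb ?E (verts G) v)" if "v \<in> verts G" for v
    proof -
      have "min_degree G \<le> out_degree G v" unfolding min_degree_def using that by (intro Min_le) auto
      then show ?thesis using assms(5) card_nb_out_degree[of v] by simp
    qed
  qed (use assms(1) vertex_connected_3_edge[OF assms(3)] in auto)
  have "consec k {n. cycle_len ?E (verts G) n}"
  proof (rule consecutive_cycles)
    show "\<not> (\<exists>f :: 'a \<Rightarrow> bool. \<forall>u\<in>verts G. \<forall>v\<in>verts G. (u, v) \<in> arcs_ends G \<longrightarrow> f u \<noteq> f v)"
    proof
      assume "\<exists>f :: 'a \<Rightarrow> bool. \<forall>u\<in>verts G. \<forall>v\<in>verts G. (u, v) \<in> arcs_ends G \<longrightarrow> f u \<noteq> f v"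
      then obtain f :: "'a \<Rightarrow> bool" where f: "\<And>u v. u \<in> verts G \<Longrightarrow> v \<in> verts G \<Longrightarrow> (u, v) \<in> arcs_ends G \<Longrightarrow> f u \<noteq> f v"
        by blast
      have fe: "f (tail G e) \<noteq> f (head G e)" if "e \<in> arcs G" for e
        by (rule f) (use that in \<open>auto simp: arcs_ends_def arc_to_ends_def\<close>)
      have "bipartite G" unfolding bipartite_def
        by (rule exI[of _ "{v \<in> verts G. f v}"], rule exI[of _ "{v \<in> verts G. \<not> f v}"])
          (use fe in \<open>auto simp: arcs_ends_def arc_to_ends_def\<close>)
      then show False using assms(4) by contradiction
    qed
    show "\<not> (clique ?E (verts G) \<and> card (verts G) = k + 1)"
    proof
      assume K: "clique ?E (verts G) \<and> card (verts G) = k + 1"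
      have "arcs_ends G = {(u, v). (u, v) \<in> verts G \<times> verts G \<and> u \<noteq> v}"
        using K no_loops unfolding clique_def by (auto simp: arcs_ends_def arc_to_ends_def)
      then show False using K assms(2,6) unfolding complete_digraph_def by blast
    qed
  qed
  then obtain l where "\<And>i. i < k \<Longrightarrow> cycle_len ?E (verts G) (l + i)" unfolding consec_def by blast
  then show ?thesis using assms(1) by (intro exI[of _ l]) (auto intro!: has_cycle_of_cycle_len)
qed

end
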